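(* Let $\Pi=(p_i)_{i\in\mathbb{N}}$ be a sequence of pairwise distinct primes. Let $\mathbf{G}$ be a topologically finitely generated $\Pi$-graded profinite group. Then $\mathbf{G}$ has polynomial normal subgroup growth.
   Context: For a profinite group $\mathbf{G}$ and a prime $p$, let $D_p(\mathbf{G})$ be the kernel of the canonical map $\mathbf{G}\to H_1(\mathbf{G},\mathbb{F}_p)$ (continuous homology), i.e. the closed subgroup topologically generated by all commutators and $p$-th powers. Put $\mathbf{G}^{\Pi(0)}=\mathbf{G}$ and $\mathbf{G}^{\Pi(n)}=D_{p_n}(\mathbf{G}^{\Pi(n-1)})$ for $n\ge1$. $\mathbf{G}$ is called $\Pi$-graded if $\bigcap_{n\in\mathbb{N}}\mathbf{G}^{\Pi(n)}=\{1\}$. A profinite group is topologically finitely generated if it contains a finitely generated dense subgroup. For a topologically finitely generated profinite group $\mathbf{G}$, $a_k^{\triangleleft}(\mathbf{G})$ denotes the number of open normal subgroups of index $k$ and $s_k^{\triangleleft}(\mathbf{G})=\sum_{\ell=1}^k a_\ell^{\triangleleft}(\mathbf{G})$. $\mathbf{G}$ has polynomial normal subgroup growth if $s_k^{\triangleleft}(\mathbf{G})$ (equivalently $a_k^{\triangleleft}(\mathbf{G})$) grows at most polynomially in $k$. *)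

theory Defs
  imports
    "HOL-Analysis.Abstract_Topological_Spaces"
    "HOL-Algebra.Generated_Groups"
    "HOL-Computational_Algebra.Primes"
begin

locale topological_group = group G for G :: "('a, 'b) monoid_scheme" (structure) +
  fixes T :: "'a topology"
  assumes topspace_eq: "topspace T = carrier G"
    and continuous_mult: "continuous_map (prod_topology T T) T (\<lambda>(x, y). x \<otimes> y)"
    and continuous_inv: "continuous_map T T (\<lambda>x. inv x)"

locale profinite_group = topological_group +
  assumes compact: "compact_space T"
    and Hausdorff: "Hausdorff_space T"
    and totally_disconnected: "\<And>S. connectedin T S \<Longrightarrow> \<exists>a. S \<subseteq> {a}"

definition topologically_finitely_generated ::
    "('a, 'b) monoid_scheme \<Rightarrow> 'a topology \<Rightarrow> bool" where
  "topologically_finitely_generated G T \<longleftrightarrow>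
     (\<exists>S. finite S \<and> S \<subseteq> carrier G \<and> T closure_of (generate G S) = carrier G)"

text \<open>The library's \<open>derived_set G (carrier G)\<close> is the set of all commutators of \<open>G\<close>.\<close>

definition D_subgroup ::
    "nat \<Rightarrow> ('a, 'b) monoid_scheme \<Rightarrow> 'a topology \<Rightarrow> 'a set" where
  "D_subgroup p G T =
     T closure_of
       (generate G (derived_set G (carrier G) \<union> {x [^]\<^bsub>G\<^esub> p | x. x \<in> carrier G}))"

text \<open>
  Each step applies \<open>D_subgroup\<close> to the previous term, regarded as a topological group in its
  own right. The first step uses \<open>p 1\<close>; the value \<open>p 0\<close> is never used.
\<close>

primrec Pi_series ::
    "('a, 'b) monoid_scheme \<Rightarrow> 'a topology \<Rightarrow> (nat \<Rightarrow> nat) \<Rightarrow> nat \<Rightarrow> 'a set" where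
  "Pi_series G T p 0 = carrier G"
| "Pi_series G T p (Suc n) =
     D_subgroup (p (Suc n)) (G\<lparr>carrier := Pi_series G T p n\<rparr>)
       (subtopology T (Pi_series G T p n))"

definition Pi_graded ::
    "(nat \<Rightarrow> nat) \<Rightarrow> ('a, 'b) monoid_scheme \<Rightarrow> 'a topology \<Rightarrow> bool" where
  "Pi_graded p G T \<longleftrightarrow> (\<Inter>n. Pi_series G T p n) = {\<one>\<^bsub>G\<^esub>}"

text \<open>Only for \<open>k \<ge> 1\<close>: since \<open>card\<close> of an infinite set is 0, \<open>k = 0\<close> would mean infinite index.\<close>

definition open_normal_subgroups ::
    "('a, 'b) monoid_scheme \<Rightarrow> 'a topology \<Rightarrow> nat \<Rightarrow> 'a set set" where
  "open_normal_subgroups G T k =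
     {N. N \<lhd> G \<and> openin T N \<and> card (rcosets\<^bsub>G\<^esub> N) = k}"

definition a_normal :: "('a, 'b) monoid_scheme \<Rightarrow> 'a topology \<Rightarrow> nat \<Rightarrow> nat" where
  "a_normal G T k = card (open_normal_subgroups G T k)"

definition s_normal :: "('a, 'b) monoid_scheme \<Rightarrow> 'a topology \<Rightarrow> nat \<Rightarrow> nat" where
  "s_normal G T k = (\<Sum>l = 1..k. a_normal G T l)"

text \<open>
  The finiteness clause ensures that the counts \<open>a_normal\<close> are genuine and do not vanish by the
  convention that \<open>card\<close> of an infinite set is 0.
\<close>

definition polynomial_normal_subgroup_growth ::
    "('a, 'b) monoid_scheme \<Rightarrow> 'a topology \<Rightarrow> bool" where
  "polynomial_normal_subgroup_growth G T \<longleftrightarrow>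
     (\<forall>k\<ge>1. finite (open_normal_subgroups G T k)) \<and>
     (\<exists>(C::real) (c::nat). \<forall>k\<ge>1. real (s_normal G T k) \<le> C * real k ^ c)"

end

theory Submission
  imports Defs "HOL-Algebra.Sylow" "HOL-Algebra.Multiplicative_Group" "HOL-Algebra.Zassenhaus"
    "HOL-Algebra.SndIsomorphismGrp" "HOL-Algebra.Subrings"
begin

text \<open>
  Every open normal subgroup of index \<open>k\<close>, and every finite family of them, is visible in one finite
  quotient. So it suffices to bound the number of normal subgroups of index \<open>k\<close> in a finite quotient
  by a polynomial in \<open>k\<close> whose degree depends only on the number \<open>d\<close> of generators. The images of the
  \<open>\<Pi>\<close>-series make each such quotient a group with a finite normal series whose \<open>i\<close>-th factor is
  elementary abelian of exponent \<open>p i\<close>, for pairwise distinct primes: a prime tower. Subgroups and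
  quotients of prime towers are prime towers, so inductions are free to pass to both.

  Since the primes are distinct, \<open>p i\<close>-torsion cannot hide below the \<open>i\<close>-th factor. This has two
  consequences. Every abelian normal subgroup has a complement (\<open>abelian_normal_complement\<close>), by
  averaging over the cosets of a subgroup of coprime index; and every maximal abelian normal subgroup is its own
  centraliser (\<open>self_centralizing_normal_exists\<close>).

  Let \<open>N\<close> be normal of index \<open>k\<close> and \<open>A / N\<close> a chief factor, of order \<open>n \<ge> 2\<close>. There are
  few possibilities for \<open>A\<close> by induction, so one has to bound the number of \<open>N\<close> for given \<open>A\<close>. A
  \<open>d\<close>-generated group can act on an elementary abelian group of order \<open>n\<close> in about
  \<open>n ^ (d * log n)\<close> ways, which is too many; but a prime tower acts in a very restricted manner. Let \<open>F\<close>
  be a self-centralising abelian normal subgroup of the acting group and \<open>K\<close> its bicommutant in the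
  endomorphism ring of the module. If the commutative ring \<open>K\<close> is not a field, its conjugate maximal
  ideals split the module, by the Chinese remainder theorem, over a subgroup of the acting group. If \<open>K\<close> is a field, then
  distinct cosets of \<open>F\<close> act on \<open>K\<close> by distinct automorphisms; Dedekind independence makes the
  sum over a complement of \<open>F\<close> nonzero, which gives a vector \<open>v\<close> fixed by that complement, and the
  module is the line \<open>K v\<close> with the group acting by \<open>w \<mapsto> a * \<sigma> w\<close>, where \<open>\<sigma>\<close> is a field
  automorphism. Iterating (\<open>semilinear_descent\<close>) yields, in every chief factor of order \<open>n\<close>, a
  subgroup \<open>T\<close> of some index \<open>t\<close> that acts semilinearly on a line of order \<open>q\<close> with
  \<open>q ^ t \<le> n\<close>.

  The complement turns the action on the line into an affine one, and the stabiliser \<open>L\<close> of its origin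
  determines \<open>N\<close>, as the largest normal subgroup of \<open>G\<close> inside \<open>A \<inter> L\<close>
  (\<open>chief_factor_witness\<close>). Now everything is polynomial in \<open>n\<close>. The number of subgroups \<open>T\<close> of index
  \<open>t\<close> is at most \<open>2 ^ (18 * d * (t - 1))\<close> (\<open>card_subgroups_of_index_le\<close>), and \<open>2 ^ t \<le> q ^ t \<le> n\<close>. Such
  a \<open>T\<close> has \<open>t * d\<close> generators by Schreier, and a generator acts on the line in polynomially many
  ways in \<open>q\<close> (\<open>card_semilinear_kernels_le\<close>), which costs a bounded power of \<open>(q ^ t) ^ d \<le> n ^ d\<close>.
  With at most \<open>n ^ c\<close> choices of \<open>L\<close>, the number \<open>a k\<close> of normal subgroups of index \<open>k\<close> satisfies
  \<open>a k \<le> (\<Sum>n | n dvd k \<and> n \<ge> 2. a (k div n) * n ^ c)\<close>, and \<open>a k \<le> k ^ (c + 2)\<close> follows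
  because the inverse squares of the integers from 2 on sum to at most 1
  (\<open>card_normal_subgroups_le\<close>).
\<close>

section \<open>Prime towers of finite groups\<close>

definition prime_series ::
    "(nat \<Rightarrow> nat) \<Rightarrow> ('a, 'b) monoid_scheme \<Rightarrow> (nat \<Rightarrow> 'a set) \<Rightarrow> bool" where
  "prime_series p G Q \<longleftrightarrow> Q 0 = carrier G \<and>
     (\<forall>i. Q i \<lhd> G \<and> Q (Suc i) \<subseteq> Q i \<and> (\<forall>x\<in>Q i. x [^]\<^bsub>G\<^esub> p i \<in> Q (Suc i)) \<and>
        (\<forall>x\<in>Q i. \<forall>y\<in>Q i. x \<otimes>\<^bsub>G\<^esub> y \<otimes>\<^bsub>G\<^esub> inv\<^bsub>G\<^esub> x \<otimes>\<^bsub>G\<^esub> inv\<^bsub>G\<^esub> y \<in> Q (Suc i)))"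

definition prime_tower ::
    "(nat \<Rightarrow> nat) \<Rightarrow> ('a, 'b) monoid_scheme \<Rightarrow> (nat \<Rightarrow> 'a set) \<Rightarrow> bool" where
  "prime_tower p G Q \<longleftrightarrow> prime_series p G Q \<and> (\<exists>n. Q n = {\<one>\<^bsub>G\<^esub>})"

lemma prime_seriesD:
  assumes "prime_series p G Q"
  shows "Q 0 = carrier G" "Q i \<lhd> G" "Q (Suc i) \<subseteq> Q i" "x \<in> Q i \<Longrightarrow> x [^]\<^bsub>G\<^esub> p i \<in> Q (Suc i)"
    "x \<in> Q i \<Longrightarrow> y \<in> Q i \<Longrightarrow> x \<otimes>\<^bsub>G\<^esub> y \<otimes>\<^bsub>G\<^esub> inv\<^bsub>G\<^esub> x \<otimes>\<^bsub>G\<^esub> inv\<^bsub>G\<^esub> y \<in> Q (Suc i)"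
  using assms by (auto simp: prime_series_def)

lemma prime_towerD:
  assumes "prime_tower p G Q"
  shows "Q 0 = carrier G" "Q i \<lhd> G" "Q (Suc i) \<subseteq> Q i" "x \<in> Q i \<Longrightarrow> x [^]\<^bsub>G\<^esub> p i \<in> Q (Suc i)"
    "x \<in> Q i \<Longrightarrow> y \<in> Q i \<Longrightarrow> x \<otimes>\<^bsub>G\<^esub> y \<otimes>\<^bsub>G\<^esub> inv\<^bsub>G\<^esub> x \<otimes>\<^bsub>G\<^esub> inv\<^bsub>G\<^esub> y \<in> Q (Suc i)"
  using assms prime_seriesD[of p G Q] by (auto simp: prime_tower_def)

lemma prime_tower_antimono: "prime_tower p G Q \<Longrightarrow> i \<le> j \<Longrightarrow> Q j \<subseteq> Q i"
  by (rule lift_Suc_antimono_le[of Q]) (auto dest: prime_towerD)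

lemma prime_tower_last:
  assumes "prime_tower p G Q"
  obtains n where "Q n = {\<one>\<^bsub>G\<^esub>}"
  using assms by (auto simp: prime_tower_def)

text \<open>
  Most arguments about a subgroup \<open>A\<close> of a prime tower concentrate on the last place where \<open>A\<close> still
  leaves \<open>F\<close>: there, \<open>p i\<close>-th powers and commutators of elements of \<open>A \<inter> Q i\<close> already lie in \<open>F\<close>.
\<close>

lemma prime_tower_last_layer:
  assumes "prime_tower p G Q" "A \<subseteq> carrier G" "\<one>\<^bsub>G\<^esub> \<in> F" "\<not> A \<subseteq> F"
  obtains i where "\<not> A \<inter> Q i \<subseteq> F" "A \<inter> Q (Suc i) \<subseteq> F"
proof -
  obtain n where n: "Q n = {\<one>\<^bsub>G\<^esub>}" using prime_tower_last[OF assms(1)] .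
  define m where "m = (LEAST m. A \<inter> Q m \<subseteq> F)"
  have ex: "A \<inter> Q n \<subseteq> F" using n assms by auto
  have m: "A \<inter> Q m \<subseteq> F" unfolding m_def by (rule LeastI[of _ n]) (rule ex)
  have "m \<noteq> 0" using m assms prime_towerD(1)[OF assms(1)] by (metis inf.absorb_iff1)
  then obtain i where i: "m = Suc i" by (cases m) auto
  have "\<not> A \<inter> Q i \<subseteq> F" using not_less_Least[of i "\<lambda>m. A \<inter> Q m \<subseteq> F"] i m_def by auto
  with m i that show thesis by blast
qed

lemma (in group) prime_tower_subgroup:
  assumes t: "prime_tower p G Q" and S: "subgroup S G"
  shows "prime_tower p (G\<lparr>carrier := S\<rparr>) (\<lambda>i. S \<inter> Q i)"
proof -
  interpret S: subgroup S G by fact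
  have pw: "x [^]\<^bsub>G\<lparr>carrier := S\<rparr>\<^esub> (n::nat) = x [^] n" for x n
    by (simp add: nat_pow_def)
  show ?thesis
    unfolding prime_tower_def prime_series_def
  proof (intro conjI allI ballI)
    show "S \<inter> Q 0 = carrier (G\<lparr>carrier := S\<rparr>)" using prime_towerD(1)[OF t] S.subset by auto
    show "\<exists>n. S \<inter> Q n = {\<one>\<^bsub>G\<lparr>carrier := S\<rparr>\<^esub>}"
    proof -
      obtain n where "Q n = {\<one>}" using prime_tower_last[OF t] .
      then show ?thesis by (intro exI[of _ n]) simp
    qed
    show "S \<inter> Q i \<lhd> G\<lparr>carrier := S\<rparr>" for i
      using normal_Int_subgroup[OF S prime_towerD(2)[OF t]] by (simp add: Int_commute)
    show "S \<inter> Q (Suc i) \<subseteq> S \<inter> Q i" for i using prime_towerD(3)[OF t] by auto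
    show "x [^]\<^bsub>G\<lparr>carrier := S\<rparr>\<^esub> p i \<in> S \<inter> Q (Suc i)" if "x \<in> S \<inter> Q i" for x i
    proof -
      interpret SG: group "G\<lparr>carrier := S\<rparr>" by (rule S.subgroup_is_group[OF is_group])
      have "x [^] p i \<in> S" using that SG.nat_pow_closed[of x "p i"] by (simp add: pw)
      then show ?thesis using prime_towerD(4)[OF t] that by (simp add: pw)
    qed
    show "x \<otimes>\<^bsub>G\<lparr>carrier := S\<rparr>\<^esub> y \<otimes>\<^bsub>G\<lparr>carrier := S\<rparr>\<^esub> inv\<^bsub>G\<lparr>carrier := S\<rparr>\<^esub> x \<otimes>\<^bsub>G\<lparr>carrier := S\<rparr>\<^esub> inv\<^bsub>G\<lparr>carrier := S\<rparr>\<^esub> y \<in> S \<inter> Q (Suc i)"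
      if "x \<in> S \<inter> Q i" "y \<in> S \<inter> Q i" for x y i
      using that prime_towerD(5)[OF t, of x i y] by (simp add: m_inv_consistent[OF S])
  qed
qed

lemma (in group_hom) prime_series_image:
  assumes t: "prime_series p G Q" and surj: "h ` carrier G = carrier H"
  shows "prime_series p H (\<lambda>i. h ` Q i)"
proof -
  have sub: "Q i \<subseteq> carrier G" for i
    using prime_seriesD(2)[OF t] normal_imp_subgroup subgroup.subset by blast
  show ?thesis
    unfolding prime_series_def
  proof (intro conjI allI ballI)
    show "h ` Q 0 = carrier H" using prime_seriesD(1)[OF t] surj by simp
    show "h ` Q i \<lhd> H" for i
      using normal.surj_hom_normal_subgroup[OF prime_seriesD(2)[OF t] group_hom_axioms surj] .
    show "h ` Q (Suc i) \<subseteq> h ` Q i" for i using prime_seriesD(3)[OF t] by (rule image_mono)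
    show "x [^]\<^bsub>H\<^esub> p i \<in> h ` Q (Suc i)" if x: "x \<in> h ` Q i" for x i
    proof -
      obtain g where g: "g \<in> Q i" "x = h g" using x by auto
      have gc: "g \<in> carrier G" using g sub by auto
      have "x [^]\<^bsub>H\<^esub> p i = h (g [^] p i)"
        unfolding g(2) by (rule hom_nat_pow[OF gc, symmetric])
      then show ?thesis using prime_seriesD(4)[OF t g(1)] by auto
    qed
    show "x \<otimes>\<^bsub>H\<^esub> y \<otimes>\<^bsub>H\<^esub> inv\<^bsub>H\<^esub> x \<otimes>\<^bsub>H\<^esub> inv\<^bsub>H\<^esub> y \<in> h ` Q (Suc i)"
      if xy: "x \<in> h ` Q i" "y \<in> h ` Q i" for x y i
    proof -
      obtain g k where g: "g \<in> Q i" "x = h g" and k: "k \<in> Q i" "y = h k" using xy by auto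
      have "g \<in> carrier G" "k \<in> carrier G" using g k sub by auto
      then have "x \<otimes>\<^bsub>H\<^esub> y \<otimes>\<^bsub>H\<^esub> inv\<^bsub>H\<^esub> x \<otimes>\<^bsub>H\<^esub> inv\<^bsub>H\<^esub> y = h (g \<otimes> k \<otimes> inv g \<otimes> inv k)" using g k by simp
      then show ?thesis using prime_seriesD(5)[OF t g(1) k(1)] by auto
    qed
  qed
qed

lemma (in group_hom) prime_tower_image:
  assumes t: "prime_tower p G Q" and surj: "h ` carrier G = carrier H"
  shows "prime_tower p H (\<lambda>i. h ` Q i)"
proof -
  obtain n where "Q n = {\<one>}" using prime_tower_last[OF t] .
  then have "h ` Q n = {\<one>\<^bsub>H\<^esub>}" by simp
  then show ?thesis using prime_series_image[OF _ surj] t by (auto simp: prime_tower_def)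
qed

locale prime_tower_group = group G for G :: "('a, 'b) monoid_scheme" (structure) +
  fixes p :: "nat \<Rightarrow> nat" and Q :: "nat \<Rightarrow> 'a set"
  assumes fin: "finite (carrier G)"
    and pr: "\<And>i. Factorial_Ring.prime (p i)"
    and inj: "inj p"
    and tower: "prime_tower p G Q"
begin

lemmas Q_0 = prime_towerD(1)[OF tower]
lemmas Q_normal = prime_towerD(2)[OF tower]
lemmas Q_Suc = prime_towerD(3)[OF tower]
lemmas Q_pow = prime_towerD(4)[OF tower]
lemmas Q_comm = prime_towerD(5)[OF tower]
lemmas Q_antimono = prime_tower_antimono[OF tower]

lemma Q_subgroup: "subgroup (Q i) G" using Q_normal normal_imp_subgroup by blast

lemma Q_carrier: "x \<in> Q i \<Longrightarrow> x \<in> carrier G" using Q_subgroup subgroup.subset by blast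

lemma prime_tower_group_subgroup:
  assumes S: "subgroup S G"
  shows "prime_tower_group (G\<lparr>carrier := S\<rparr>) p (\<lambda>i. S \<inter> Q i)"
proof -
  have "finite S" using fin S subgroup.subset finite_subset by blast
  then show ?thesis
    using S prime_tower_subgroup[OF tower S] pr inj subgroup.subgroup_is_group[OF S is_group]
    by (simp add: prime_tower_group_def prime_tower_group_axioms_def)
qed

lemma prime_tower_group_image:
  assumes "group_hom G H h" "h ` carrier G = carrier H"
  shows "prime_tower_group H p (\<lambda>i. h ` Q i)"
proof -
  interpret h: group_hom G H h by fact
  have "finite (carrier H)" using fin assms(2) by (metis finite_imageI)
  then show ?thesis using h.prime_tower_image[OF tower assms(2)] pr inj h.H.is_group
    by (simp add: prime_tower_group_def prime_tower_group_axioms_def)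
qed

end

text \<open>
  A Bezout identity for the exponents writes \<open>x\<close> as a product of powers of \<open>x [^] a\<close> and
  \<open>x [^] b\<close>.
\<close>

lemma (in group) subgroup_pow_coprime:
  assumes "subgroup H G" "x \<in> carrier G" "x [^] (a::nat) \<in> H" "x [^] (b::nat) \<in> H" "coprime a b"
  shows "x \<in> H"
proof -
  obtain u v where uv: "int a * u + int b * v = 1"
    using bezout_int[of "int a" "int b"] assms(5) by (metis coprime_iff_gcd_eq_1 gcd_int_int_eq mult.commute of_nat_1)
  have pc: "h [^] (n::int) \<in> H" if "h \<in> H" for h n
    using subgroup_int_pow_closed[OF assms(1) that] .
  have "x = x [^] (int a * u + int b * v)" using uv assms(2) by (simp add: int_pow_1)
  also have "\<dots> = (x [^] a) [^] u \<otimes> (x [^] b) [^] v"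
    using assms(2) by (simp add: int_pow_mult int_pow_pow flip: int_pow_int)
  also have "\<dots> \<in> H" using pc assms by (simp add: subgroup.m_closed)
  finally show ?thesis .
qed

context prime_tower_group begin

text \<open>
  In a factor \<open>Q j / Q (j + 1)\<close> with \<open>p j \<noteq> r\<close> the map \<open>x \<mapsto> x [^] r\<close> is injective, so an
  element whose \<open>r\<close>-th power lies deep in the tower lies equally deep.
\<close>

lemma Q_mem_of_pow:
  assumes z: "z \<in> Q k" "z [^] r \<in> Q i" and r: "Factorial_Ring.prime r" and ne: "\<And>j. k \<le> j \<Longrightarrow> j < i \<Longrightarrow> r \<noteq> p j"
  shows "z \<in> Q i"
proof -
  have "z \<in> Q j" if "k \<le> j" "j \<le> i" for j using that
  proof (induction j rule: dec_induct)
    case (step j)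
    then have zj: "z \<in> Q j" by auto
    have "z [^] r \<in> Q (Suc j)" using z(2) Q_antimono[of "Suc j" i] step.prems by auto
    moreover have "coprime r (p j)" using ne[of j] step pr r by (simp add: primes_coprime)
    ultimately show ?case using subgroup_pow_coprime[OF Q_subgroup, of z r "Suc j" "p j"] Q_pow[OF zj] Q_carrier[OF zj]
      by auto
  qed (use z in auto)
  then show ?thesis
    by (metis Q_antimono z(1) linorder_le_cases order_refl subsetD)
qed

text \<open>
  This is where the primes have to be distinct: the prime \<open>p i\<close> does not occur again after step \<open>i\<close>.
\<close>

lemma Q_torsion_free:
  assumes z: "z \<in> Q k" "z [^] p i = \<one>" and "i < k"
  shows "z = \<one>"
proof -
  obtain n where n: "Q n = {\<one>}" using prime_tower_last[OF tower] .
  have "z \<in> Q n"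
    by (rule Q_mem_of_pow[OF z(1), of "p i"]) (use z n pr assms(3) inj in \<open>auto dest!: injD\<close>)
  then show ?thesis using n by simp
qed

end

section \<open>Complements of abelian normal subgroups\<close>

lemma finprod_hom:
  assumes "comm_group G" "comm_group H" "h \<in> hom G H" "f \<in> I \<rightarrow> carrier G"
  shows "h (finprod G f I) = finprod H (\<lambda>i. h (f i)) I"
proof -
  interpret G: comm_group G by fact
  interpret H: comm_group H by fact
  interpret h: group_hom G H h by unfold_locales fact
  show ?thesis
    using assms(4)
  proof (induction I rule: infinite_finite_induct)
    case (insert x I)
    then show ?case by (simp add: Pi_iff)
  qed auto
qed

context group begin

definition complements :: "'a set \<Rightarrow> 'a set \<Rightarrow> bool" where
  "complements M A \<longleftrightarrow> subgroup M G \<and> M \<inter> A = {\<one>} \<and> (\<forall>g\<in>carrier G. \<exists>a\<in>A. \<exists>m\<in>M. g = a \<otimes> m)"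

text \<open>
  A crossed homomorphism \<open>\<phi>\<close> into \<open>A\<close> that is injective on the finite group \<open>A\<close> maps \<open>A\<close> onto itself.
  Hence every \<open>g\<close> can be corrected by an \<open>a \<in> A\<close> to an element on which \<open>\<phi>\<close> vanishes.
\<close>

lemma crossed_hom_kernel_complements:
  assumes fin: "finite (carrier G)" and A: "A \<lhd> G" and phi: "\<And>g. g \<in> carrier G \<Longrightarrow> \<phi> g \<in> A"
    and cross: "\<And>g h. g \<in> carrier G \<Longrightarrow> h \<in> carrier G \<Longrightarrow> \<phi> (g \<otimes> h) = \<phi> g \<otimes> (g \<otimes> \<phi> h \<otimes> inv g)"
    and inj: "inj_on \<phi> A"
  shows "complements {g \<in> carrier G. \<phi> g = \<one>} A"
proof -
  interpret A: normal A G by fact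
  have c: "\<phi> g \<in> carrier G" if "g \<in> carrier G" for g using phi[OF that] A.subset by auto
  have phi1: "\<phi> \<one> = \<one>" using cross[of \<one> \<one>] c[of \<one>] by simp
  have "finite A" using fin A.subset finite_subset by blast
  then have surj: "\<phi> ` A = A" using inj phi A.subset by (intro endo_inj_surj) auto
  have inv1: "\<phi> (inv g) = \<one>" if "g \<in> carrier G" "\<phi> g = \<one>" for g
  proof -
    have "\<one> = g \<otimes> \<phi> (inv g) \<otimes> inv g" using cross[of g "inv g"] that phi1 c[of "inv g"] by simp
    then have "inv g \<otimes> \<one> \<otimes> g = \<phi> (inv g)" using that c[of "inv g"] by (metis inv_solve_left inv_solve_right' inv_closed l_inv l_one m_closed r_inv r_one m_assoc)
    then show ?thesis using that by simp
  qed
  have sub: "subgroup {g \<in> carrier G. \<phi> g = \<one>} G"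
    by (rule subgroupI) (use phi1 inv1 cross in auto)
  have int: "{g \<in> carrier G. \<phi> g = \<one>} \<inter> A = {\<one>}"
  proof -
    have "a = \<one>" if "a \<in> A" "\<phi> a = \<one>" for a
      using inj_onD[OF inj, of a \<one>] that phi1 A.one_closed by simp
    then show ?thesis using phi1 A.one_closed A.subset by auto
  qed
  have dec: "\<exists>a\<in>A. \<exists>m\<in>{g \<in> carrier G. \<phi> g = \<one>}. g = a \<otimes> m" if g: "g \<in> carrier G" for g
  proof -
    have "inv g \<otimes> inv (\<phi> g) \<otimes> g \<in> A"
      using A.inv_op_closed1[OF g] A.m_inv_closed[OF phi[OF g]] by simp
    then obtain a where a: "a \<in> A" "\<phi> a = inv g \<otimes> inv (\<phi> g) \<otimes> g" using surj by (metis imageE)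
    have ac: "a \<in> carrier G" using a A.subset by auto
    have "\<phi> (g \<otimes> a) = \<phi> g \<otimes> (g \<otimes> (inv g \<otimes> inv (\<phi> g) \<otimes> g) \<otimes> inv g)"
      using cross[OF g ac] a by simp
    also have "\<dots> = \<one>" using g c[OF g] by (simp add: m_assoc[symmetric])
    finally have m: "\<phi> (g \<otimes> a) = \<one>" .
    have b: "(g \<otimes> a) \<otimes> inv a \<otimes> inv (g \<otimes> a) \<in> A"
      using A.inv_op_closed2[of "g \<otimes> a" "inv a"] g ac a A.m_inv_closed by simp
    have "g = ((g \<otimes> a) \<otimes> inv a \<otimes> inv (g \<otimes> a)) \<otimes> (g \<otimes> a)" using g ac by (simp add: m_assoc)
    then show ?thesis using b m g ac by (intro bexI[OF _ b] bexI[of _ "g \<otimes> a"]) auto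
  qed
  show ?thesis unfolding complements_def using sub int dec by blast
qed

lemma cauchy:
  assumes "finite (carrier G)" "Factorial_Ring.prime r" "r dvd order G"
  obtains x where "x \<in> carrier G" "x \<noteq> \<one>" "x [^] r = \<one>"
proof -
  obtain m where "order G = r ^ 1 * m" using assms(3) by auto
  then obtain H where H: "subgroup H G" "card H = r ^ 1" using sylow_thm[OF assms(2) is_group _ assms(1)] by blast
  have "card H \<noteq> 1" "card H \<noteq> 0" using H prime_gt_1_nat[OF assms(2)] by auto
  then obtain x where x: "x \<in> H" "x \<noteq> \<one>"
    using H(1) by (metis card_1_singleton_iff is_singletonI' is_singleton_altdef subgroup.one_closed empty_iff)
  interpret HG: group "G\<lparr>carrier := H\<rparr>" using H(1) by (rule subgroup.subgroup_is_group) (rule is_group)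
  have "x [^]\<^bsub>G\<lparr>carrier := H\<rparr>\<^esub> order (G\<lparr>carrier := H\<rparr>) = \<one>"
    using HG.pow_order_eq_1[of x] x by simp
  then have "x [^] r = \<one>" using H(2) by (simp add: order_def nat_pow_def)
  moreover have "x \<in> carrier G" using x H(1) subgroup.subset by blast
  ultimately show thesis using that x by blast
qed

text \<open>
  A nonabelian form of averaging, due to Gaschuetz. The retraction \<open>\<pi>\<close> is a homomorphism on \<open>P\<close>
  only; transporting it to all cosets of \<open>P\<close> and multiplying the results gives a crossed homomorphism
  \<open>\<phi>\<close> on \<open>G\<close>. On \<open>A\<close> it is the power map with exponent the index of \<open>P\<close>, which is injective because
  that index is prime to the exponent of \<open>A\<close>.
\<close>

lemma complement_of_retract:
  assumes fin: "finite (carrier G)" and A: "A \<lhd> G" and P: "subgroup P G" and AP: "A \<subseteq> P"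
    and cent: "\<And>a u. a \<in> A \<Longrightarrow> u \<in> P \<Longrightarrow> a \<otimes> u = u \<otimes> a"
    and ret: "\<And>u. u \<in> P \<Longrightarrow> \<pi> u \<in> A" "\<And>u v. u \<in> P \<Longrightarrow> v \<in> P \<Longrightarrow> \<pi> (u \<otimes> v) = \<pi> u \<otimes> \<pi> v"
      "\<And>a. a \<in> A \<Longrightarrow> \<pi> a = a"
    and exp: "\<And>a. a \<in> A \<Longrightarrow> a [^] r = \<one>" and cop: "coprime (card (rcosets P)) r"
  shows "\<exists>M. complements M A"
proof -
  interpret A: normal A G by fact
  interpret P: subgroup P G by fact
  let ?A = "G\<lparr>carrier := A\<rparr>"
  interpret CA: comm_group ?A
    using A.subgroup_is_group[OF is_group] cent AP A.subset
    by (intro group.group_comm_groupI) (auto simp: subset_iff)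
  \<comment> \<open>\<open>S\<close> is the action of \<open>G\<close> on right cosets by \<open>C \<mapsto> C #> inv g\<close>, and \<open>u g C\<close> the resulting cocycle
    with values in \<open>P\<close>; conjugating \<open>\<pi> (u g C)\<close> back by the representative gives
    values in \<open>A\<close> that again satisfy a cocycle identity.\<close>
  define rep where "rep C = inv (SOME y. y \<in> C)" for C
  define S where "S g C = C #> inv g" for g C
  define u where "u g C = inv (rep (S g C)) \<otimes> g \<otimes> rep C" for g C
  define \<tau> where "\<tau> g C = rep (S g C) \<otimes> \<pi> (u g C) \<otimes> inv (rep (S g C))" for g C
  define \<phi> where "\<phi> g = finprod ?A (\<tau> g) (rcosets P)" for g
  have repy: "inv (rep C) \<in> C" and rep: "rep C \<in> carrier G" and Crep: "C = P #> inv (rep C)"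
    if C: "C \<in> rcosets P" for C
  proof -
    have ne: "C \<noteq> {}" using P.rcosets_non_empty[OF that] .
    have sub: "C \<subseteq> carrier G" using P.rcosets_carrier[OF is_group that] .
    have 1: "(SOME y. y \<in> C) \<in> C" using ne by (simp add: some_in_eq)
    then show y: "inv (rep C) \<in> C" and "rep C \<in> carrier G" using sub by (auto simp: rep_def)
    obtain x where x: "x \<in> carrier G" "C = P #> x" using C unfolding RCOSETS_def by blast
    show "C = P #> inv (rep C)" using repr_independence[of "inv (rep C)" P x] y x P.subgroup_axioms by simp
  qed
  have SC: "S g C \<in> rcosets P" if "g \<in> carrier G" and C: "C \<in> rcosets P" for g C
  proof -
    obtain x where x: "x \<in> carrier G" "C = P #> x" using C unfolding RCOSETS_def by blast
    then show ?thesis using that by (auto simp: S_def coset_mult_assoc[OF P.subset] intro!: rcosetsI P.subset)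
  qed
  have Smult: "S (g \<otimes> h) C = S g (S h C)" if "g \<in> carrier G" "h \<in> carrier G" and C: "C \<in> rcosets P" for g h C
  proof -
    obtain x where x: "x \<in> carrier G" "C = P #> x" using C unfolding RCOSETS_def by blast
    then show ?thesis using that by (auto simp: S_def coset_mult_assoc[OF P.subset] inv_mult_group m_assoc)
  qed
  have S1: "S \<one> C = C" if "C \<in> rcosets P" for C
    using that P.rcosets_carrier[OF is_group that] by (simp add: S_def)
  have Sbij: "bij_betw (S h) (rcosets P) (rcosets P)" if "h \<in> carrier G" for h
    by (rule bij_betw_byWitness[where f' = "S (inv h)"])
       (use that SC S1 in \<open>auto simp: Smult[symmetric]\<close>)
  have uP: "u g C \<in> P" if g: "g \<in> carrier G" and C: "C \<in> rcosets P" for g C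
  proof -
    have "inv (rep (S g C)) \<in> C #> inv g" using repy[OF SC[OF g C]] by (simp add: S_def)
    also have "C #> inv g = P #> (inv (rep C) \<otimes> inv g)"
      using Crep[OF C] coset_mult_assoc[OF P.subset, of "inv (rep C)" "inv g"] rep[OF C] g by simp
    finally obtain w where w: "w \<in> P" "inv (rep (S g C)) = w \<otimes> (inv (rep C) \<otimes> inv g)"
      by (auto simp: r_coset_def)
    have wc: "w \<in> carrier G" using w by simp
    have "u g C = w \<otimes> (inv (rep C) \<otimes> inv g) \<otimes> g \<otimes> rep C" by (simp add: u_def w(2))
    also have "\<dots> = w" using wc g rep[OF C] by (simp add: m_assoc)
    finally show ?thesis using w by simp
  qed
  have tauA: "\<tau> g C \<in> A" if "g \<in> carrier G" "C \<in> rcosets P" for g C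
    unfolding \<tau>_def using A.inv_op_closed2[OF rep[OF SC[OF that]] ret(1)[OF uP[OF that]]] .
  have taumult: "\<tau> (g \<otimes> h) C = \<tau> g (S h C) \<otimes> (g \<otimes> \<tau> h C \<otimes> inv g)"
    if g: "g \<in> carrier G" and h: "h \<in> carrier G" and C: "C \<in> rcosets P" for g h C
  proof -
    define R2 R1 R0 where "R2 = rep (S g (S h C))" and "R1 = rep (S h C)" and "R0 = rep C"
    have R: "R2 \<in> carrier G" "R1 \<in> carrier G" "R0 \<in> carrier G"
      using rep SC g h C by (auto simp: R2_def R1_def R0_def)
    define a b where "a = u g (S h C)" and "b = u h C"
    have ab: "a \<in> P" "b \<in> P" using uP SC g h C by (auto simp: a_def b_def)
    have abc: "a \<in> carrier G" "b \<in> carrier G" using ab by auto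
    have pic: "\<pi> a \<in> carrier G" "\<pi> b \<in> carrier G" using ret(1) ab A.subset by auto
    have uab: "u (g \<otimes> h) C = a \<otimes> b"
      unfolding u_def a_def b_def Smult[OF g h C] using R g h
      by (simp add: R2_def[symmetric] R1_def[symmetric] R0_def[symmetric] m_assoc inv_solve_left)
         (simp add: m_assoc[symmetric])
    have aeq: "R2 \<otimes> a = g \<otimes> R1" using R g
      unfolding a_def u_def R2_def[symmetric] R1_def[symmetric] by (simp add: m_assoc[symmetric])
    have com: "\<pi> b = a \<otimes> \<pi> b \<otimes> inv a" using cent[OF ret(1)[OF ab(2)] ab(1)] abc pic
      by (metis inv_solve_right m_closed)
    have "R2 \<otimes> \<pi> b \<otimes> inv R2 = R2 \<otimes> (a \<otimes> \<pi> b \<otimes> inv a) \<otimes> inv R2" using com by simp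
    also have "\<dots> = (R2 \<otimes> a) \<otimes> \<pi> b \<otimes> inv (R2 \<otimes> a)" using R abc pic by (simp add: m_assoc inv_mult_group)
    also have "\<dots> = g \<otimes> (R1 \<otimes> \<pi> b \<otimes> inv R1) \<otimes> inv g" unfolding aeq using R g pic by (simp add: m_assoc inv_mult_group)
    finally have e: "R2 \<otimes> \<pi> b \<otimes> inv R2 = g \<otimes> (R1 \<otimes> \<pi> b \<otimes> inv R1) \<otimes> inv g" .
    have "\<tau> (g \<otimes> h) C = R2 \<otimes> (\<pi> a \<otimes> \<pi> b) \<otimes> inv R2"
      unfolding \<tau>_def Smult[OF g h C] uab R2_def[symmetric] using ret(2)[OF ab] by simp
    also have "\<dots> = (R2 \<otimes> \<pi> a \<otimes> inv R2) \<otimes> (R2 \<otimes> \<pi> b \<otimes> inv R2)"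
      using R pic by (simp add: m_assoc inv_solve_left)
    finally show ?thesis unfolding e by (simp add: \<tau>_def R2_def R1_def a_def b_def)
  qed
  have conj: "(\<lambda>x. g \<otimes> x \<otimes> inv g) \<in> hom ?A ?A" if "g \<in> carrier G" for g
  proof (rule homI)
    fix x y assume "x \<in> carrier ?A" "y \<in> carrier ?A"
    then have xy: "x \<in> carrier G" "y \<in> carrier G" using A.subset by auto
    show "g \<otimes> (x \<otimes>\<^bsub>?A\<^esub> y) \<otimes> inv g = (g \<otimes> x \<otimes> inv g) \<otimes>\<^bsub>?A\<^esub> (g \<otimes> y \<otimes> inv g)"
      using that xy by (simp add: m_assoc inv_solve_left)
  qed (use that A.inv_op_closed2 in auto)
  have cross: "\<phi> (g \<otimes> h) = \<phi> g \<otimes> (g \<otimes> \<phi> h \<otimes> inv g)" if g: "g \<in> carrier G" and h: "h \<in> carrier G" for g h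
  proof -
    have "\<phi> (g \<otimes> h) = finprod ?A (\<lambda>C. \<tau> g (S h C) \<otimes>\<^bsub>?A\<^esub> (g \<otimes> \<tau> h C \<otimes> inv g)) (rcosets P)"
      unfolding \<phi>_def by (rule CA.finprod_cong') (use tauA SC g h A.inv_op_closed2 in \<open>auto simp: taumult\<close>)
    also have "\<dots> = finprod ?A (\<lambda>C. \<tau> g (S h C)) (rcosets P) \<otimes>\<^bsub>?A\<^esub> finprod ?A (\<lambda>C. g \<otimes> \<tau> h C \<otimes> inv g) (rcosets P)"
      by (rule CA.finprod_multf) (use tauA SC g h A.inv_op_closed2 in auto)
    also have "finprod ?A (\<lambda>C. \<tau> g (S h C)) (rcosets P) = \<phi> g"
      unfolding \<phi>_def using CA.finprod_reindex[of "\<tau> g" "S h" "rcosets P"] Sbij[OF h] tauA[OF g] SC[OF h]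
      by (auto simp: bij_betw_def Pi_iff)
    also have "finprod ?A (\<lambda>C. g \<otimes> \<tau> h C \<otimes> inv g) (rcosets P) = g \<otimes> \<phi> h \<otimes> inv g"
      unfolding \<phi>_def using finprod_hom[OF CA.comm_group_axioms CA.comm_group_axioms conj[OF g], of "\<tau> h" "rcosets P"] tauA h
      by (auto simp: Pi_iff)
    finally show ?thesis by simp
  qed
  have phiA: "\<phi> g \<in> A" if "g \<in> carrier G" for g
    unfolding \<phi>_def using CA.finprod_closed[of "\<tau> g" "rcosets P"] tauA that by (auto simp: Pi_iff)
  have pw: "x [^]\<^bsub>?A\<^esub> (n::nat) = x [^] n" for x n by (simp add: nat_pow_def)
  have phia: "\<phi> a = a [^] card (rcosets P)" if a: "a \<in> A" for a
  proof -
    have ac: "a \<in> carrier G" using a by simp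
    have "\<tau> a C = a" if C: "C \<in> rcosets P" for C
    proof -
      define y where "y = inv (rep C)"
      have y: "y \<in> carrier G" "C = P #> y" using rep[OF C] Crep[OF C] by (auto simp: y_def)
      have "y \<otimes> inv a \<otimes> inv y \<in> P" using A.inv_op_closed2[of y "inv a"] y a AP by auto
      then have "P #> (y \<otimes> inv a \<otimes> inv y) = P" using P.rcos_const[OF is_group] by simp
      then have "P #> y = P #> ((y \<otimes> inv a \<otimes> inv y) \<otimes> y)"
        using coset_mult_assoc[OF P.subset, of "y \<otimes> inv a \<otimes> inv y" y] y ac by simp
      also have "(y \<otimes> inv a \<otimes> inv y) \<otimes> y = y \<otimes> inv a" using y(1) ac by (simp add: m_assoc)
      also have "P #> (y \<otimes> inv a) = S a C"
        using y ac by (simp add: S_def coset_mult_assoc[OF P.subset])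
      finally have "S a C = C" using y(2) by simp
      then have "\<tau> a C = inv y \<otimes> \<pi> (y \<otimes> a \<otimes> inv y) \<otimes> y"
        using rep[OF C] by (simp add: \<tau>_def u_def y_def)
      also have "\<pi> (y \<otimes> a \<otimes> inv y) = y \<otimes> a \<otimes> inv y" using ret(3) A.inv_op_closed2[OF y(1) a] by simp
      also have "inv y \<otimes> (y \<otimes> a \<otimes> inv y) \<otimes> y = a" using y ac by (simp add: m_assoc[symmetric]) (simp add: m_assoc)
      finally show ?thesis .
    qed
    then have "\<phi> a = finprod ?A (\<lambda>_. a) (rcosets P)"
      unfolding \<phi>_def by (intro CA.finprod_cong') (use a in auto)
    also have "\<dots> = a [^] card (rcosets P)" using CA.finprod_const[of a "rcosets P"] a by (simp add: pw)
    finally show ?thesis .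
  qed
  have "inj_on \<phi> A"
  proof (rule inj_onI)
    fix a b assume ab: "a \<in> A" "b \<in> A" "\<phi> a = \<phi> b"
    define c where "c = a \<otimes> inv b"
    have c: "c \<in> A" using ab by (simp add: c_def)
    have comm: "a \<otimes> b = b \<otimes> a" using cent[of a b] ab AP by auto
    have cb: "c \<otimes> b = a" using ab by (simp add: c_def m_assoc)
    have phc: "\<phi> c \<in> carrier G" "\<phi> b \<in> carrier G" using phiA c ab by auto
    have "\<phi> a = \<phi> c \<otimes> (c \<otimes> \<phi> b \<otimes> inv c)" using cross[of c b] c ab cb by simp
    also have "c \<otimes> \<phi> b = \<phi> b \<otimes> c" using cent[of c "\<phi> b"] c phiA[of b] ab AP by auto
    also have "\<phi> b \<otimes> c \<otimes> inv c = \<phi> b" using c phc by (simp add: m_assoc)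
    finally have "\<phi> b = \<phi> c \<otimes> \<phi> b" using ab by simp
    then have "\<phi> c = \<one>" using r_cancel_one'[OF phc(2,1)] by simp
    then have "c [^] card (rcosets P) = \<one>" using phia[OF c] by simp
    moreover have "c [^] r = \<one>" using exp[OF c] .
    ultimately have "c = \<one>"
      using subgroup_pow_coprime[OF triv_subgroup, of c "card (rcosets P)" r] cop c A.subset by auto
    then show "a = b" using cb ab by simp
  qed
  then show ?thesis using crossed_hom_kernel_complements[OF fin A phiA cross] by blast
qed

end

lemma (in group) inv_mult_cancel [simp]:
  assumes "x \<in> carrier G" "y \<in> carrier G"
  shows "inv x \<otimes> (x \<otimes> y) = y" "x \<otimes> (inv x \<otimes> y) = y"
  using assms by (simp_all add: m_assoc[symmetric])

lemma (in group) set_mult_incl: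
  assumes "subgroup H G" "subgroup K G"
  shows "H \<subseteq> H <#> K" "K \<subseteq> H <#> K"
proof -
  have "h \<otimes> \<one> \<in> H <#> K" if "h \<in> H" for h
    unfolding set_mult_def using that subgroup.one_closed[OF assms(2)] by blast
  then show "H \<subseteq> H <#> K" using subgroup.mem_carrier[OF assms(1)] by auto
  have "\<one> \<otimes> k \<in> H <#> K" if "k \<in> K" for k
    unfolding set_mult_def using that subgroup.one_closed[OF assms(1)] by blast
  then show "K \<subseteq> H <#> K" using subgroup.mem_carrier[OF assms(2)] by auto
qed

context prime_tower_group begin

text \<open>
  The quotient \<open>G / Q i\<close> is built from the primes \<open>p 0, \<dots>, p (i - 1)\<close>, none of which is \<open>p i\<close>.
\<close>

lemma prime_index_coprime: "coprime (card (rcosets (Q i))) (p i)"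
proof -
  interpret N: normal "Q i" G by (rule Q_normal)
  have "\<not> p i dvd order (G Mod Q i)"
  proof
    assume d: "p i dvd order (G Mod Q i)"
    interpret M: group "G Mod Q i" by (rule N.factorgroup_is_group)
    have "finite (carrier (G Mod Q i))" using fin by (simp add: carrier_FactGroup)
    then obtain X where X: "X \<in> carrier (G Mod Q i)" "X \<noteq> \<one>\<^bsub>G Mod Q i\<^esub>" "X [^]\<^bsub>G Mod Q i\<^esub> p i = \<one>\<^bsub>G Mod Q i\<^esub>"
      using M.cauchy[OF _ pr d] by blast
    obtain x where x: "x \<in> carrier G" "X = Q i #> x" using X(1) by (auto simp: carrier_FactGroup)
    have "Q i #> (x [^] p i) = Q i" using X(3) N.FactGroup_pow[OF x(1)] x(2) by simp
    then have "x [^] p i \<in> Q i" using rcos_self[OF nat_pow_closed[OF x(1)] Q_subgroup] by metis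
    then have "x \<in> Q i"
      by (intro Q_mem_of_pow[of x 0 "p i" i]) (use x Q_0 pr inj in \<open>auto dest!: injD\<close>)
    then show False using X(2) x N.rcos_const[OF is_group] by simp
  qed
  then have "coprime (p i) (card (rcosets (Q i)))"
    using prime_imp_coprime[OF pr[of i]] by (simp add: order_def FactGroup_def)
  then show ?thesis using coprime_commute by blast
qed

text \<open>
  Let \<open>j\<close> be the last step whose term meets \<open>A\<close>. Then \<open>r = p j\<close> and \<open>A\<close> lies in \<open>Q j\<close>, where it is
  central because \<open>[A, Q j]\<close> lies in \<open>A \<inter> Q (j + 1) = 1\<close>. As \<open>Q j / Q (j + 1)\<close> is elementary
  abelian, \<open>A\<close> is a direct factor of \<open>Q j\<close>; the projection onto \<open>A\<close> is the retraction to be averaged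
  over the cosets of \<open>Q j\<close>.
\<close>

lemma prime_exponent_complement:
  assumes A: "A \<lhd> G" and comm: "\<And>a b. a \<in> A \<Longrightarrow> b \<in> A \<Longrightarrow> a \<otimes> b = b \<otimes> a"
    and r: "Factorial_Ring.prime (r :: nat)" and exp: "\<And>a. a \<in> A \<Longrightarrow> a [^] r = \<one>"
  shows "\<exists>M. complements M A"
proof (cases "A \<subseteq> {\<one>}")
  case True
  interpret A: normal A G by fact
  have "A = {\<one>}" using True A.one_closed by auto
  then have "complements (carrier G) A" by (auto simp: complements_def subgroup_self intro!: bexI[of _ "\<one>"])
  then show ?thesis by blast
next
  case False
  interpret A: normal A G by fact
  obtain j where j: "\<not> A \<inter> Q j \<subseteq> {\<one>}" "A \<inter> Q (Suc j) \<subseteq> {\<one>}"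
    using prime_tower_last_layer[OF tower A.subset _ False] by auto
  have rp: "r = p j"
  proof (rule ccontr)
    assume ne: "r \<noteq> p j"
    obtain a where a: "a \<in> A" "a \<in> Q j" "a \<noteq> \<one>" using j by auto
    have "a [^] p j \<in> A \<inter> Q (Suc j)" using Q_pow[OF a(2)] subgroup_int_pow_closed[OF A.subgroup_axioms a(1), of "int (p j)"]
      by (simp add: int_pow_int)
    then have "a [^] p j = \<one>" using j by auto
    then show False
      using subgroup_pow_coprime[OF triv_subgroup, of a r "p j"] exp[OF a(1)] a ne r pr
      by (auto simp: primes_coprime)
  qed
  have AQ: "A \<subseteq> Q j"
  proof
    fix a assume a: "a \<in> A"
    show "a \<in> Q j"
      by (rule Q_mem_of_pow[of a 0 r])
         (use a Q_0 exp[OF a] r rp inj subgroup.one_closed[OF Q_subgroup] in \<open>auto dest!: injD\<close>)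
  qed
  interpret Qj: subgroup "Q j" G by (rule Q_subgroup)
  interpret QS: normal "Q (Suc j)" G by (rule Q_normal)
  have cent: "a \<otimes> u = u \<otimes> a" if a: "a \<in> A" and u: "u \<in> Q j" for a u
  proof -
    have "a \<otimes> u \<otimes> inv a \<otimes> inv u \<in> Q (Suc j)" using Q_comm[of a j u] a u AQ by auto
    moreover have "a \<otimes> u \<otimes> inv a \<otimes> inv u \<in> A"
      using A.inv_op_closed2[of u "inv a"] a u by (simp add: m_assoc)
    ultimately have "a \<otimes> u \<otimes> inv a \<otimes> inv u = \<one>" using j by auto
    then have "a \<otimes> u \<otimes> inv a = u" using a u
      by (metis A.mem_carrier Qj.mem_carrier inv_closed inv_equality inv_inv m_closed)
    then show ?thesis using a u by (metis A.mem_carrier Qj.mem_carrier inv_solve_right m_closed)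
  qed
  \<comment> \<open>A maximal element of \<open>\<Z>\<close> is the other direct factor.\<close>
  define \<Z> where "\<Z> = {Z. subgroup Z G \<and> Q (Suc j) \<subseteq> Z \<and> Z \<subseteq> Q j \<and> Z \<inter> A = {\<one>}}"
  have "finite \<Z>" by (rule finite_subset[of _ "Pow (carrier G)"]) (use fin subgroup.subset in \<open>auto simp: \<Z>_def\<close>)
  moreover have "Q (Suc j) \<in> \<Z>"
    using j Q_Suc QS.subgroup_axioms A.one_closed by (auto simp: \<Z>_def)
  ultimately obtain Z where Z: "Z \<in> \<Z>" and max: "\<And>Y. Y \<in> \<Z> \<Longrightarrow> Z \<subseteq> Y \<Longrightarrow> Z = Y"
    using finite_has_maximal[of \<Z>] by (metis empty_iff)
  interpret Z: subgroup Z G using Z by (simp add: \<Z>_def)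
  have ZQ: "Q (Suc j) \<subseteq> Z" "Z \<subseteq> Q j" "Z \<inter> A = {\<one>}" using Z by (auto simp: \<Z>_def)
  have Zconj: "x \<otimes> z \<otimes> inv x \<in> Z" if x: "x \<in> Q j" and z: "z \<in> Z" for x z
  proof -
    have "x \<otimes> z \<otimes> inv x \<otimes> inv z \<in> Z" using Q_comm[of x j z] ZQ x z by auto
    then have "x \<otimes> z \<otimes> inv x \<otimes> inv z \<otimes> z \<in> Z" using z by (rule Z.m_closed)
    then show ?thesis using x z by (simp add: m_assoc)
  qed
  have ZQj: "normal Z (G\<lparr>carrier := Q j\<rparr>)"
  proof (rule group.normalI[OF Qj.subgroup_is_group[OF is_group]])
    interpret Gj: group "G\<lparr>carrier := Q j\<rparr>" by (rule Qj.subgroup_is_group[OF is_group])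
    show "\<forall>x\<in>carrier (G\<lparr>carrier := Q j\<rparr>). Z #>\<^bsub>G\<lparr>carrier := Q j\<rparr>\<^esub> x = x <#\<^bsub>G\<lparr>carrier := Q j\<rparr>\<^esub> Z"
    proof (intro ballI)
      fix x assume "x \<in> carrier (G\<lparr>carrier := Q j\<rparr>)"
      then have x: "x \<in> Q j" by simp
      have "Z #> x = x <# Z"
      proof
        show "Z #> x \<subseteq> x <# Z"
        proof
          fix y assume "y \<in> Z #> x"
          then obtain z where z: "z \<in> Z" "y = z \<otimes> x" by (auto simp: r_coset_def)
          have "inv x \<otimes> z \<otimes> inv (inv x) \<in> Z" using Zconj[of "inv x" z] x z by simp
          moreover have "y = x \<otimes> (inv x \<otimes> z \<otimes> inv (inv x))" using x z by (simp add: m_assoc[symmetric])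
          ultimately show "y \<in> x <# Z" by (auto simp: l_coset_def)
        qed
        show "x <# Z \<subseteq> Z #> x"
        proof
          fix y assume "y \<in> x <# Z"
          then obtain z where z: "z \<in> Z" "y = x \<otimes> z" by (auto simp: l_coset_def)
          have "y = (x \<otimes> z \<otimes> inv x) \<otimes> x" using x z by (simp add: m_assoc)
          then show "y \<in> Z #> x" using Zconj[OF x z(1)] by (auto simp: r_coset_def)
        qed
      qed
      then show "Z #>\<^bsub>G\<lparr>carrier := Q j\<rparr>\<^esub> x = x <#\<^bsub>G\<lparr>carrier := Q j\<rparr>\<^esub> Z" by simp
    qed
    show "subgroup Z (G\<lparr>carrier := Q j\<rparr>)" using subgroup_incl[OF Z.subgroup_axioms Q_subgroup ZQ(2)] .
  qed
  have sub: "subgroup (Z <#> Y) G" if "subgroup Y G" "Y \<subseteq> Q j" for Y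
  proof -
    interpret Gj: group "G\<lparr>carrier := Q j\<rparr>" by (rule Qj.subgroup_is_group[OF is_group])
    have "subgroup (Z <#>\<^bsub>G\<lparr>carrier := Q j\<rparr>\<^esub> Y) (G\<lparr>carrier := Q j\<rparr>)"
      using Gj.mult_norm_subgroup[OF ZQj] subgroup_incl[OF that(1) Q_subgroup that(2)] by blast
    then show ?thesis using incl_subgroup[OF Q_subgroup] by simp
  qed
  have ZA: "Q j \<subseteq> Z <#> A"
  proof (rule ccontr)
    assume "\<not> Q j \<subseteq> Z <#> A"
    then obtain x where x: "x \<in> Q j" "x \<notin> Z <#> A" by auto
    have xc: "x \<in> carrier G" using x by simp
    define C where "C = generate G {x}"
    have C: "subgroup C G" "x \<in> C" "C \<subseteq> Q j"
      using generate_is_subgroup[of "{x}"] generate_subgroup_incl[OF _ Q_subgroup, of "{x}" j] x xc generate.incl[of x "{x}" G] by (auto simp: C_def)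
    have ZAsub: "subgroup (Z <#> A) G" using sub[OF A.subgroup_axioms AQ] .
    have incl: "Z \<subseteq> Z <#> Y" "Y \<subseteq> Z <#> Y" if "subgroup Y G" for Y
      using set_mult_incl[OF Z.subgroup_axioms that] by auto
    have "Z <#> C \<notin> \<Z>"
    proof
      assume "Z <#> C \<in> \<Z>"
      then have "Z = Z <#> C" using max incl(1)[OF C(1)] by blast
      then have "x \<in> Z" using incl(2)[OF C(1)] C by auto
      then show False using x incl(1)[OF A.subgroup_axioms] by auto
    qed
    moreover have "subgroup (Z <#> C) G" "Q (Suc j) \<subseteq> Z <#> C" "Z <#> C \<subseteq> Q j"
      using sub[OF C(1,3)] incl(1)[OF C(1)] ZQ C(3) by (auto simp: set_mult_def)
    ultimately have "(Z <#> C) \<inter> A \<noteq> {\<one>}" by (simp add: \<Z>_def)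
    then obtain a where a: "a \<in> Z <#> C" "a \<in> A" "a \<noteq> \<one>"
      using subgroup.one_closed[OF \<open>subgroup (Z <#> C) G\<close>] A.one_closed by blast
    obtain z n where zn: "z \<in> Z" "a = z \<otimes> x [^] (n::nat)"
      using a(1) generate_pow_on_finite_carrier[OF fin xc] by (auto simp: set_mult_def C_def)
    have xr: "x [^] r \<in> Q (Suc j)" using Q_pow[OF x(1)] rp by simp
    have "\<not> r dvd n"
    proof
      assume "r dvd n"
      then obtain k where k: "n = r * k" by auto
      have "x [^] n = (x [^] r) [^] k" using xc by (simp add: k nat_pow_pow)
      also have "\<dots> \<in> Z" using subgroup_int_pow_closed[OF Z.subgroup_axioms, of "x [^] r" "int k"] xr ZQ by (auto simp: int_pow_int)
      finally have "a \<in> Z" using zn by simp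
      then show False using a ZQ by auto
    qed
    then have cop: "coprime n r" using prime_imp_coprime[OF r] coprime_commute by blast
    have "x [^] n = inv z \<otimes> a" using zn xc by (simp add: m_assoc[symmetric])
    then have "x [^] n \<in> Z <#> A" using zn(1) a(2) by (auto simp: set_mult_def)
    moreover have "x [^] r \<in> Z <#> A" using xr ZQ incl(1)[OF A.subgroup_axioms] by auto
    ultimately show False using subgroup_pow_coprime[OF ZAsub xc _ _ cop] x by blast
  qed
  define \<pi> where "\<pi> u = (THE a. a \<in> A \<and> (\<exists>z\<in>Z. u = z \<otimes> a))" for u
  have piI: "\<pi> (z \<otimes> a) = a" if "z \<in> Z" "a \<in> A" for z a
    unfolding \<pi>_def
  proof (rule the_equality)
    fix b assume "b \<in> A \<and> (\<exists>w\<in>Z. z \<otimes> a = w \<otimes> b)"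
    then obtain w where w: "b \<in> A" "w \<in> Z" "z \<otimes> a = w \<otimes> b" by auto
    have c: "z \<in> carrier G" "w \<in> carrier G" "a \<in> carrier G" "b \<in> carrier G" using that w by auto
    have e: "inv w \<otimes> z = b \<otimes> inv a" using w(3) c by (metis inv_closed inv_solve_left inv_solve_right m_assoc m_closed)
    have "inv w \<otimes> z \<in> Z" using w that by simp
    moreover have "b \<otimes> inv a \<in> A" using w that by simp
    ultimately have "b \<otimes> inv a \<in> Z \<inter> A" using e by simp
    then have "b \<otimes> inv a = \<one>" using ZQ by simp
    then show "b = a" using c by (metis inv_equality inv_inv inv_closed)
  qed (use that in auto)
  have dec: "\<exists>z\<in>Z. \<exists>a\<in>A. u = z \<otimes> a" if "u \<in> Q j" for u using that ZA unfolding set_mult_def by blast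
  have "\<pi> (u \<otimes> v) = \<pi> u \<otimes> \<pi> v" if "u \<in> Q j" "v \<in> Q j" for u v
  proof -
    obtain z a w b where *: "z \<in> Z" "a \<in> A" "u = z \<otimes> a" "w \<in> Z" "b \<in> A" "v = w \<otimes> b" using dec \<open>u \<in> Q j\<close> \<open>v \<in> Q j\<close> by metis
    have c: "z \<in> carrier G" "w \<in> carrier G" "a \<in> carrier G" "b \<in> carrier G" using * by auto
    have "a \<otimes> w = w \<otimes> a" using cent[of a w] * ZQ by auto
    then have "u \<otimes> v = (z \<otimes> w) \<otimes> (a \<otimes> b)" using c * by (metis m_assoc m_closed)
    then show ?thesis using piI[of "z \<otimes> w" "a \<otimes> b"] piI * by simp
  qed
  moreover have "\<pi> u \<in> A" if u: "u \<in> Q j" for u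
    using dec[OF u] piI by auto
  moreover have "\<pi> a = a" if "a \<in> A" for a using piI[OF Z.one_closed that] that by simp
  ultimately show ?thesis
    by (intro complement_of_retract[OF fin A Q_subgroup AQ, of \<pi> r])
       (use cent exp prime_index_coprime[of j] rp in auto)
qed

end

text \<open>
  Split off the \<open>r\<close>-torsion \<open>B\<close> of \<open>A\<close> by a complement \<open>M\<close>. As \<open>M\<close> is again a prime tower and
  \<open>A \<inter> M\<close> is smaller than \<open>A\<close>, induction provides a complement of \<open>A \<inter> M\<close> in \<open>M\<close>, and it is one of
  \<open>A\<close> in \<open>G\<close>.
\<close>

lemma abelian_normal_complement:
  fixes G :: "('a, 'b) monoid_scheme"
  assumes "prime_tower_group G p Q" "A \<lhd> G" "\<And>a b. a \<in> A \<Longrightarrow> b \<in> A \<Longrightarrow> a \<otimes>\<^bsub>G\<^esub> b = b \<otimes>\<^bsub>G\<^esub> a"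
  shows "\<exists>M. group.complements G M A"
  using assms
proof (induction "card A" arbitrary: G A Q rule: less_induct)
  case less
  interpret prime_tower_group G p Q by fact
  note A = less.prems(2) and comm = less.prems(3)
  interpret A: normal A G by (rule A)
  show ?case
  proof (cases "card A = 1")
    case True
    then have "A = {\<one>\<^bsub>G\<^esub>}" using A.one_closed by (metis card_1_singletonE singletonD)
    then have "\<And>a. a \<in> A \<Longrightarrow> a [^]\<^bsub>G\<^esub> (2::nat) = \<one>\<^bsub>G\<^esub>" by simp
    then show ?thesis using prime_exponent_complement[OF A comm two_is_prime_nat] by blast
  next
    case False
    have finA: "finite A" using fin A.subset finite_subset by blast
    obtain r where r: "Factorial_Ring.prime r" "r dvd card A" using False prime_factor_nat by blast
    interpret GA: group "G\<lparr>carrier := A\<rparr>" by (rule A.subgroup_is_group[OF is_group])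
    have pw: "x [^]\<^bsub>G\<lparr>carrier := A\<rparr>\<^esub> (n::nat) = x [^]\<^bsub>G\<^esub> n" for x n by (simp add: nat_pow_def)
    obtain x where x: "x \<in> A" "x \<noteq> \<one>\<^bsub>G\<^esub>" "x [^]\<^bsub>G\<^esub> r = \<one>\<^bsub>G\<^esub>"
      using GA.cauchy[of r] finA r by (auto simp: order_def pw)
    define B where "B = {a \<in> A. a [^]\<^bsub>G\<^esub> r = \<one>\<^bsub>G\<^esub>}"
    have powmult: "(a \<otimes>\<^bsub>G\<^esub> b) [^]\<^bsub>G\<^esub> r = a [^]\<^bsub>G\<^esub> r \<otimes>\<^bsub>G\<^esub> b [^]\<^bsub>G\<^esub> r" if "a \<in> A" "b \<in> A" for a b
      using pow_mult_distrib[of a b r] comm[OF that] that by simp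
    have Bsub: "subgroup B G"
    proof (rule subgroupI)
      show "B \<noteq> {}" using x by (auto simp: B_def)
      show "inv\<^bsub>G\<^esub> a \<in> B" if "a \<in> B" for a using that A.subset by (auto simp: B_def nat_pow_inv)
    qed (use A.one_closed powmult A.subset in \<open>auto simp: B_def\<close>)
    have conjpow: "(g \<otimes>\<^bsub>G\<^esub> a \<otimes>\<^bsub>G\<^esub> inv\<^bsub>G\<^esub> g) [^]\<^bsub>G\<^esub> (n::nat) = g \<otimes>\<^bsub>G\<^esub> a [^]\<^bsub>G\<^esub> n \<otimes>\<^bsub>G\<^esub> inv\<^bsub>G\<^esub> g"
      if "g \<in> carrier G" "a \<in> carrier G" for g a n
      using that by (induction n) (auto simp: m_assoc inv_solve_left)
    have B: "B \<lhd> G"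
      unfolding normal_inv_iff
    proof (intro conjI ballI Bsub)
      fix g b assume g: "g \<in> carrier G" and b: "b \<in> B"
      have bA: "b \<in> A" "b [^]\<^bsub>G\<^esub> r = \<one>\<^bsub>G\<^esub>" using b by (auto simp: B_def)
      have "(g \<otimes>\<^bsub>G\<^esub> b \<otimes>\<^bsub>G\<^esub> inv\<^bsub>G\<^esub> g) [^]\<^bsub>G\<^esub> r = \<one>\<^bsub>G\<^esub>"
        using conjpow[OF g A.mem_carrier[OF bA(1)], of r] bA g by simp
      then show "g \<otimes>\<^bsub>G\<^esub> b \<otimes>\<^bsub>G\<^esub> inv\<^bsub>G\<^esub> g \<in> B"
        using A.inv_op_closed2[OF g bA(1)] by (simp add: B_def)
    qed
    have "\<exists>M. complements M B"
      by (rule prime_exponent_complement[OF B _ r(1)]) (auto simp: B_def intro: comm)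
    then obtain M where M: "complements M B" by blast
    have Msub: "subgroup M G" and MB: "M \<inter> B = {\<one>\<^bsub>G\<^esub>}" and dec: "\<And>g. g \<in> carrier G \<Longrightarrow> \<exists>a\<in>B. \<exists>m\<in>M. g = a \<otimes>\<^bsub>G\<^esub> m"
      using M by (auto simp: complements_def)
    interpret MM: group "G\<lparr>carrier := M\<rparr>" by (rule subgroup.subgroup_is_group[OF Msub is_group])
    have "x \<in> B" using x by (simp add: B_def)
    then have "x \<notin> M" using MB x by auto
    then have "A \<inter> M \<subset> A" using x by auto
    then have lt: "card (A \<inter> M) < card A" using finA by (rule psubset_card_mono[rotated])
    have "\<exists>H. MM.complements H (A \<inter> M)"
      by (rule less.hyps[OF lt prime_tower_group_subgroup[OF Msub] normal_Int_subgroup[OF Msub A]])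
         (auto intro: comm)
    then obtain H where H: "MM.complements H (A \<inter> M)" by blast
    have "complements H A"
      unfolding complements_def
    proof (intro conjI ballI)
      show "subgroup H G" using H incl_subgroup[OF Msub] by (auto simp: MM.complements_def)
      have "H \<subseteq> M" using H subgroup.subset by (fastforce simp: MM.complements_def)
      then show "H \<inter> A = {\<one>\<^bsub>G\<^esub>}" using H by (auto simp: MM.complements_def)
      fix g assume "g \<in> carrier G"
      then obtain b m where bm: "b \<in> B" "m \<in> M" "g = b \<otimes>\<^bsub>G\<^esub> m" using dec by blast
      then obtain a h where ah: "a \<in> A \<inter> M" "h \<in> H" "m = a \<otimes>\<^bsub>G\<^esub> h" using H by (auto simp: MM.complements_def)
      have "b \<in> A" using bm by (simp add: B_def)
      moreover have "h \<in> carrier G" using \<open>subgroup H G\<close> ah subgroup.subset by blast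
      ultimately have "g = (b \<otimes>\<^bsub>G\<^esub> a) \<otimes>\<^bsub>G\<^esub> h" "b \<otimes>\<^bsub>G\<^esub> a \<in> A" using bm ah by (auto simp: m_assoc)
      then show "\<exists>a\<in>A. \<exists>m\<in>H. g = a \<otimes>\<^bsub>G\<^esub> m" using ah by blast
    qed
    then show ?thesis by blast
  qed
qed

context prime_tower_group begin

text \<open>
  Let \<open>F\<close> be a maximal abelian normal subgroup, \<open>C\<close> its centraliser, and \<open>E\<close> the part of \<open>C\<close> in the
  last term of the tower in which \<open>C\<close> leaves \<open>F\<close>. For \<open>x, y \<in> E\<close> the commutator \<open>z\<close> and the power
  \<open>x [^] p i\<close> lie in \<open>F\<close>, hence commute with \<open>E\<close>, and so \<open>z [^] p i = [x [^] p i, y] = 1\<close>. Since \<open>z\<close>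
  lies in \<open>Q (i + 1)\<close>, which has no \<open>p i\<close>-torsion, \<open>E\<close> is abelian, and \<open>F E\<close> contradicts the
  maximality of \<open>F\<close>.
\<close>

lemma self_centralizing_normal_exists:
  obtains F where "F \<lhd> G" "\<And>a b. a \<in> F \<Longrightarrow> b \<in> F \<Longrightarrow> a \<otimes> b = b \<otimes> a"
    "\<And>g. g \<in> carrier G \<Longrightarrow> (\<And>a. a \<in> F \<Longrightarrow> g \<otimes> a = a \<otimes> g) \<Longrightarrow> g \<in> F"
proof -
  define \<F> where "\<F> = {F. F \<lhd> G \<and> (\<forall>a\<in>F. \<forall>b\<in>F. a \<otimes> b = b \<otimes> a)}"
  have "finite \<F>"
    by (rule finite_subset[of _ "Pow (carrier G)"]) (use fin subgroup.subset[OF normal_imp_subgroup] in \<open>fastforce simp: \<F>_def\<close>)+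
  moreover have "{\<one>} \<in> \<F>" by (simp add: \<F>_def one_is_normal)
  ultimately obtain F where F: "F \<in> \<F>" and max: "\<And>Y. Y \<in> \<F> \<Longrightarrow> F \<subseteq> Y \<Longrightarrow> F = Y"
    using finite_has_maximal[of \<F>] by (metis empty_iff)
  interpret F: normal F G using F by (simp add: \<F>_def)
  have Fcomm: "a \<otimes> b = b \<otimes> a" if "a \<in> F" "b \<in> F" for a b using F that by (simp add: \<F>_def)
  define C where "C = {g \<in> carrier G. \<forall>a\<in>F. g \<otimes> a = a \<otimes> g}"
  have Csub: "subgroup C G"
  proof (rule subgroupI)
    show "inv g \<in> C" if g: "g \<in> C" for g
    proof -
      have "inv g \<otimes> a = a \<otimes> inv g" if "a \<in> F" for a
      proof -
        have "g \<otimes> a = a \<otimes> g" "g \<in> carrier G" "a \<in> carrier G" using g that by (auto simp: C_def)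
        then show ?thesis by (metis inv_closed inv_solve_left inv_solve_right m_assoc m_closed)
      qed
      then show ?thesis using g by (auto simp: C_def)
    qed
    show "g \<otimes> h \<in> C" if "g \<in> C" "h \<in> C" for g h
    proof -
      have "g \<otimes> h \<otimes> a = a \<otimes> (g \<otimes> h)" if a: "a \<in> F" for a
      proof -
        have "g \<otimes> a = a \<otimes> g" "h \<otimes> a = a \<otimes> h" "g \<in> carrier G" "h \<in> carrier G" "a \<in> carrier G"
          using \<open>g \<in> C\<close> \<open>h \<in> C\<close> a by (auto simp: C_def)
        then show ?thesis by (metis m_assoc)
      qed
      then show ?thesis using that by (auto simp: C_def)
    qed
  qed (auto simp: C_def F.mem_carrier)
  have C: "C \<lhd> G"
    unfolding normal_inv_iff
  proof (intro conjI ballI Csub)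
    fix x h assume x: "x \<in> carrier G" and h: "h \<in> C"
    have hc: "h \<in> carrier G" using h by (simp add: C_def)
    have "x \<otimes> h \<otimes> inv x \<otimes> a = a \<otimes> (x \<otimes> h \<otimes> inv x)" if a: "a \<in> F" for a
    proof -
      define b where "b = inv x \<otimes> a \<otimes> x"
      have b: "b \<in> F" using F.inv_op_closed1[OF x a] by (simp add: b_def)
      have ab: "a = x \<otimes> b \<otimes> inv x" using x a by (simp add: b_def m_assoc)
      have "h \<otimes> b = b \<otimes> h" using h b by (simp add: C_def)
      then have "x \<otimes> (h \<otimes> b) \<otimes> inv x = x \<otimes> (b \<otimes> h) \<otimes> inv x" by simp
      then show ?thesis unfolding ab using x hc b F.mem_carrier[OF b] by (simp add: m_assoc)
    qed
    then show "x \<otimes> h \<otimes> inv x \<in> C" using x hc by (auto simp: C_def)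
  qed
  have "C \<subseteq> F"
  proof (rule ccontr)
    assume "\<not> C \<subseteq> F"
    then obtain i where i: "\<not> C \<inter> Q i \<subseteq> F" "C \<inter> Q (Suc i) \<subseteq> F"
      using prime_tower_last_layer[OF tower subgroup.subset[OF Csub] F.one_closed] by blast
    define E where "E = C \<inter> Q i"
    have E: "E \<lhd> G" unfolding E_def using normal_subgroup_intersect[OF C Q_normal] .
    interpret E: normal E G by (rule E)
    have EC: "x \<otimes> a = a \<otimes> x" if "x \<in> E" "a \<in> F" for x a using that unfolding E_def C_def by blast
    have Ecomm: "x \<otimes> y = y \<otimes> x" if x: "x \<in> E" and y: "y \<in> E" for x y
    proof -
      have xc: "x \<in> carrier G" "y \<in> carrier G" using x y by auto
      define z where "z = x \<otimes> y \<otimes> inv x \<otimes> inv y"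
      have zE: "z \<in> E" unfolding z_def using x y by simp
      have zQ: "z \<in> Q (Suc i)" unfolding z_def using Q_comm[of x i y] x y by (simp add: E_def)
      have zF: "z \<in> F" using zE zQ i by (auto simp: E_def)
      have zc: "z \<in> carrier G" using zE by simp
      have xr: "x [^] p i \<in> F"
      proof -
        have "x [^] p i \<in> E" using subgroup_int_pow_closed[OF E.subgroup_axioms x, of "int (p i)"] by (simp add: int_pow_int)
        moreover have "x [^] p i \<in> Q (Suc i)" using Q_pow x by (simp add: E_def)
        ultimately show ?thesis using i by (auto simp: E_def)
      qed
      have xy: "x \<otimes> y = z \<otimes> (y \<otimes> x)" using xc by (simp add: z_def m_assoc)
      have "x [^] n \<otimes> y = z [^] n \<otimes> (y \<otimes> x [^] n)" for n :: nat
      proof (induction n)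
        case (Suc n)
        have zx: "x [^] n \<otimes> z = z \<otimes> x [^] n" 
          using EC[OF _ zF, of "x [^] n"] subgroup_int_pow_closed[OF E.subgroup_axioms x, of "int n"] by (simp add: int_pow_int)
        have "x [^] Suc n \<otimes> y = x [^] n \<otimes> (z \<otimes> (y \<otimes> x))" using xc xy by (simp add: m_assoc)
        also have "\<dots> = z \<otimes> (x [^] n \<otimes> y) \<otimes> x" using xc zc zx by (simp add: m_assoc[symmetric])
        also have "\<dots> = z [^] Suc n \<otimes> (y \<otimes> x [^] Suc n)" unfolding Suc nat_pow_Suc
          using xc zc nat_pow_Suc2[OF zc, of n] by (simp add: m_assoc[symmetric] del: nat_pow_Suc)
        finally show ?case .
      qed (use xc in simp)
      from this[of "p i"] have "x [^] p i \<otimes> y = z [^] p i \<otimes> (x [^] p i \<otimes> y)" using EC[OF y xr] by simp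
      then have "z [^] p i = \<one>" using r_cancel_one'[of "x [^] p i \<otimes> y" "z [^] p i"] xc zc by simp
      then have "z = \<one>" using Q_torsion_free[OF zQ] by simp
      then show ?thesis using xy xc by simp
    qed
    have "F <#> E \<in> \<F>"
    proof -
      have "F <#> E \<lhd> G" by (rule normal_subgroup_set_mult_closed[OF F.normal_axioms E])
      moreover have "a \<otimes> b = b \<otimes> a" if ab: "a \<in> F <#> E" "b \<in> F <#> E" for a b
      proof -
        obtain f e g d where *: "f \<in> F" "e \<in> E" "a = f \<otimes> e" "g \<in> F" "d \<in> E" "b = g \<otimes> d"
          using ab by (auto simp: set_mult_def)
        have c: "f \<in> carrier G" "e \<in> carrier G" "g \<in> carrier G" "d \<in> carrier G" using * by auto
        have "e \<otimes> g = g \<otimes> e" "d \<otimes> f = f \<otimes> d" "f \<otimes> g = g \<otimes> f" "e \<otimes> d = d \<otimes> e" using EC Fcomm Ecomm * by auto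
        then show ?thesis using c * by (metis m_assoc m_closed)
      qed
      ultimately show ?thesis by (simp add: \<F>_def)
    qed
    moreover have "F \<subseteq> F <#> E" "E \<subseteq> F <#> E"
      using set_mult_incl[OF F.subgroup_axioms E.subgroup_axioms] by auto
    ultimately have "E \<subseteq> F" using max by blast
    then show False using i by (simp add: E_def)
  qed
  then show thesis using that[OF F.normal_axioms Fcomm] unfolding C_def by blast
qed

end

section \<open>Prime towers of automorphisms and the bicommutant\<close>

text \<open>
  Endomorphisms are taken extensional, so that they are equal in the ring as soon as they agree on
  \<open>carrier W\<close>.
\<close>

definition End :: "('w, 'b) monoid_scheme \<Rightarrow> ('w \<Rightarrow> 'w) ring" where
  "End W = \<lparr>carrier = hom W W \<inter> extensional (carrier W), monoid.mult = compose (carrier W),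
     one = (\<lambda>w\<in>carrier W. w), zero = (\<lambda>w\<in>carrier W. \<one>\<^bsub>W\<^esub>),
     add = (\<lambda>f g. \<lambda>w\<in>carrier W. f w \<otimes>\<^bsub>W\<^esub> g w)\<rparr>"

lemma End_mem: "f \<in> carrier (End W) \<longleftrightarrow> f \<in> hom W W \<and> f \<in> extensional (carrier W)"
  by (simp add: End_def)

lemma End_apply:
  "w \<in> carrier W \<Longrightarrow> (f \<otimes>\<^bsub>End W\<^esub> g) w = f (g w)"
  "w \<in> carrier W \<Longrightarrow> (f \<oplus>\<^bsub>End W\<^esub> g) w = f w \<otimes>\<^bsub>W\<^esub> g w"
  "w \<in> carrier W \<Longrightarrow> \<one>\<^bsub>End W\<^esub> w = w"
  "w \<in> carrier W \<Longrightarrow> \<zero>\<^bsub>End W\<^esub> w = \<one>\<^bsub>W\<^esub>"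
  by (simp_all add: End_def compose_def)

lemma End_eqI:
  assumes "f \<in> carrier (End W)" "g \<in> carrier (End W)" "\<And>w. w \<in> carrier W \<Longrightarrow> f w = g w"
  shows "f = g"
  using assms by (auto simp: End_mem intro: extensionalityI)

lemma End_closed: "f \<in> carrier (End W) \<Longrightarrow> w \<in> carrier W \<Longrightarrow> f w \<in> carrier W"
  by (auto simp: End_mem hom_def)

lemma End_mult: "f \<in> carrier (End W) \<Longrightarrow> w \<in> carrier W \<Longrightarrow> u \<in> carrier W \<Longrightarrow> f (w \<otimes>\<^bsub>W\<^esub> u) = f w \<otimes>\<^bsub>W\<^esub> f u"
  by (auto simp: End_mem hom_def)

text \<open>
  The model is a line \<open>W\<close> over a finite field with generating vector \<open>v\<close> and primitive root \<open>\<zeta>\<close>, so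
  that its nonzero elements are the \<open>\<zeta> ^ i v\<close>. A semilinear map \<open>k v \<mapsto> (a * \<sigma> k) v\<close>, where \<open>\<sigma> \<zeta> = \<zeta> ^ \<rho>\<close>
  and \<open>a = \<zeta> ^ u\<close>, acts on exponents by \<open>i \<mapsto> \<rho> * i + u\<close>. This form mentions no field and makes
  the number of such maps visibly polynomial in the size of \<open>W\<close>.
\<close>

definition semilinear :: "('w, 'b) monoid_scheme \<Rightarrow> 'g set \<Rightarrow> ('g \<Rightarrow> 'w \<Rightarrow> 'w) \<Rightarrow> bool" where
  "semilinear W S act \<longleftrightarrow> (\<exists>\<zeta>\<in>carrier (End W). \<exists>v\<in>carrier W.
     carrier W = insert \<one>\<^bsub>W\<^esub> (range (\<lambda>i::nat. (\<zeta> [^]\<^bsub>End W\<^esub> i) v)) \<and>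
     (\<forall>g\<in>S. \<exists>\<rho> u. \<forall>i::nat. act g ((\<zeta> [^]\<^bsub>End W\<^esub> i) v) = (\<zeta> [^]\<^bsub>End W\<^esub> (\<rho> * i + u)) v))"

context comm_group begin

lemma End_add_closed: "f \<in> carrier (End G) \<Longrightarrow> g \<in> carrier (End G) \<Longrightarrow> f \<oplus>\<^bsub>End G\<^esub> g \<in> carrier (End G)"
  by (auto simp: End_def hom_def Pi_iff m_ac)

lemma End_mult_closed: "f \<in> carrier (End G) \<Longrightarrow> g \<in> carrier (End G) \<Longrightarrow> f \<otimes>\<^bsub>End G\<^esub> g \<in> carrier (End G)"
  by (auto simp: End_def hom_def Pi_iff compose_def)

lemma End_one_closed: "\<one>\<^bsub>End G\<^esub> \<in> carrier (End G)"
  by (auto simp: End_def hom_def)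

lemma End_zero_closed: "\<zero>\<^bsub>End G\<^esub> \<in> carrier (End G)"
  by (auto simp: End_def hom_def)

lemma End_ring: "ring (End G)"
proof (rule ringI)
  note cl = End_add_closed End_mult_closed End_one_closed End_zero_closed
  show "abelian_group (End G)"
  proof (rule abelian_groupI)
    fix f assume f: "f \<in> carrier (End G)"
    have hf: "f \<in> hom G G" using f by (simp add: End_mem)
    let ?g = "\<lambda>w\<in>carrier G. inv (f w)"
    have g: "?g \<in> carrier (End G)" using f by (auto simp: End_def hom_def Pi_iff inv_mult)
    have "?g \<oplus>\<^bsub>End G\<^esub> f = \<zero>\<^bsub>End G\<^esub>"
      by (rule End_eqI[where W = G]) (use cl f g End_closed[OF f] in \<open>auto simp: End_apply\<close>)
    then show "\<exists>g\<in>carrier (End G). g \<oplus>\<^bsub>End G\<^esub> f = \<zero>\<^bsub>End G\<^esub>" using g by blast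
  next
    fix f g h assume fgh: "f \<in> carrier (End G)" "g \<in> carrier (End G)" "h \<in> carrier (End G)"
    show "f \<oplus>\<^bsub>End G\<^esub> g \<oplus>\<^bsub>End G\<^esub> h = f \<oplus>\<^bsub>End G\<^esub> (g \<oplus>\<^bsub>End G\<^esub> h)"
      by (rule End_eqI[where W = G]) (use cl fgh End_closed[where W = G] in \<open>auto simp: End_apply m_assoc\<close>)
  next
    fix f g assume fg: "f \<in> carrier (End G)" "g \<in> carrier (End G)"
    show "f \<oplus>\<^bsub>End G\<^esub> g = g \<oplus>\<^bsub>End G\<^esub> f"
      by (rule End_eqI[where W = G]) (use cl fg End_closed[where W = G] in \<open>auto simp: End_apply m_comm\<close>)
  next
    fix f assume f: "f \<in> carrier (End G)"
    show "\<zero>\<^bsub>End G\<^esub> \<oplus>\<^bsub>End G\<^esub> f = f"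
      by (rule End_eqI[where W = G]) (use cl f End_closed[OF f] in \<open>auto simp: End_apply\<close>)
  qed (use cl in auto)
  show "Group.monoid (End G)"
  proof (rule monoidI)
    fix f g h assume fgh: "f \<in> carrier (End G)" "g \<in> carrier (End G)" "h \<in> carrier (End G)"
    show "f \<otimes>\<^bsub>End G\<^esub> g \<otimes>\<^bsub>End G\<^esub> h = f \<otimes>\<^bsub>End G\<^esub> (g \<otimes>\<^bsub>End G\<^esub> h)"
      by (rule End_eqI[where W = G]) (use cl fgh End_closed[OF fgh(3)] in \<open>auto simp: End_apply\<close>)
  next
    fix f assume f: "f \<in> carrier (End G)"
    show "\<one>\<^bsub>End G\<^esub> \<otimes>\<^bsub>End G\<^esub> f = f"
      by (rule End_eqI[where W = G]) (use cl f End_closed[OF f] in \<open>auto simp: End_apply\<close>)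
    show "f \<otimes>\<^bsub>End G\<^esub> \<one>\<^bsub>End G\<^esub> = f"
      by (rule End_eqI[where W = G]) (use cl f End_closed[OF f] in \<open>auto simp: End_apply\<close>)
  qed (use cl in auto)
  fix f g h assume fgh: "f \<in> carrier (End G)" "g \<in> carrier (End G)" "h \<in> carrier (End G)"
  show "(f \<oplus>\<^bsub>End G\<^esub> g) \<otimes>\<^bsub>End G\<^esub> h = f \<otimes>\<^bsub>End G\<^esub> h \<oplus>\<^bsub>End G\<^esub> g \<otimes>\<^bsub>End G\<^esub> h"
    by (rule End_eqI[where W = G]) (use cl fgh End_closed[OF fgh(3)] in \<open>auto simp: End_apply\<close>)
  show "h \<otimes>\<^bsub>End G\<^esub> (f \<oplus>\<^bsub>End G\<^esub> g) = h \<otimes>\<^bsub>End G\<^esub> f \<oplus>\<^bsub>End G\<^esub> h \<otimes>\<^bsub>End G\<^esub> g"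
    by (rule End_eqI[where W = G]) (use cl fgh End_closed[OF fgh(1)] End_closed[OF fgh(2)] in \<open>auto simp: End_apply End_mult\<close>)
qed

lemma End_finite: "finite (carrier G) \<Longrightarrow> finite (carrier (End G))"
  by (rule finite_subset[of _ "carrier G \<rightarrow>\<^sub>E carrier G"]) (auto simp: End_def hom_def PiE_def[symmetric] PiE_iff Pi_iff extensional_def intro!: finite_PiE)

end

locale linear_tower = W: comm_group W for W :: "('w, 'b) monoid_scheme" +
  fixes X :: "('w \<Rightarrow> 'w) set" and p :: "nat \<Rightarrow> nat" and Q :: "nat \<Rightarrow> ('w \<Rightarrow> 'w) set"
  assumes finW: "finite (carrier W)" and XE: "X \<subseteq> carrier (End W)"
    and XT: "prime_tower_group \<lparr>carrier = X, monoid.mult = monoid.mult (End W), one = \<one>\<^bsub>End W\<^esub>\<rparr> p Q"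
begin

abbreviation "R \<equiv> End W"
abbreviation comp (infixl "\<cdot>" 70) where "comp \<equiv> monoid.mult (End W)"
abbreviation "XG \<equiv> \<lparr>carrier = X, monoid.mult = monoid.mult (End W), one = \<one>\<^bsub>End W\<^esub>\<rparr>"

sublocale X: prime_tower_group XG p Q by (rule XT)
sublocale R: ring R by (rule W.End_ring)

lemma X_R: "x \<in> X \<Longrightarrow> x \<in> carrier R" using XE by auto

lemma X_inv:
  assumes "x \<in> X"
  shows "inv\<^bsub>XG\<^esub> x \<in> X" "x \<cdot> inv\<^bsub>XG\<^esub> x = \<one>\<^bsub>R\<^esub>" "inv\<^bsub>XG\<^esub> x \<cdot> x = \<one>\<^bsub>R\<^esub>"
  using assms X.inv_closed[of x] X.r_inv[of x] X.l_inv[of x] by auto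

lemma X_inv_apply:
  assumes "x \<in> X" "w \<in> carrier W"
  shows "x ((inv\<^bsub>XG\<^esub> x) w) = w" "(inv\<^bsub>XG\<^esub> x) (x w) = w"
  using X_inv[OF assms(1)] End_apply(1)[OF assms(2)] End_apply(3)[OF assms(2)] by metis+

text \<open>
  A self-centralising abelian normal subgroup of \<open>X\<close>, fixed once and for all.
\<close>

definition F where
  "F = (SOME F. F \<lhd> XG \<and> (\<forall>a\<in>F. \<forall>b\<in>F. a \<cdot> b = b \<cdot> a) \<and>
     (\<forall>g\<in>X. (\<forall>a\<in>F. g \<cdot> a = a \<cdot> g) \<longrightarrow> g \<in> F))"

lemma F: "F \<lhd> XG" "a \<in> F \<Longrightarrow> b \<in> F \<Longrightarrow> a \<cdot> b = b \<cdot> a"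
  "g \<in> X \<Longrightarrow> (\<And>a. a \<in> F \<Longrightarrow> g \<cdot> a = a \<cdot> g) \<Longrightarrow> g \<in> F"
proof -
  have "\<exists>F. F \<lhd> XG \<and> (\<forall>a\<in>F. \<forall>b\<in>F. a \<cdot> b = b \<cdot> a) \<and>
     (\<forall>g\<in>X. (\<forall>a\<in>F. g \<cdot> a = a \<cdot> g) \<longrightarrow> g \<in> F)"
    using X.self_centralizing_normal_exists by (metis (no_types, lifting) monoid.select_convs(1) partial_object.select_convs(1))
  from someI_ex[OF this] have "F \<lhd> XG \<and> (\<forall>a\<in>F. \<forall>b\<in>F. a \<cdot> b = b \<cdot> a) \<and>
     (\<forall>g\<in>X. (\<forall>a\<in>F. g \<cdot> a = a \<cdot> g) \<longrightarrow> g \<in> F)" unfolding F_def .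
  then show "F \<lhd> XG" "a \<in> F \<Longrightarrow> b \<in> F \<Longrightarrow> a \<cdot> b = b \<cdot> a"
    "g \<in> X \<Longrightarrow> (\<And>a. a \<in> F \<Longrightarrow> g \<cdot> a = a \<cdot> g) \<Longrightarrow> g \<in> F" by auto
qed

lemma F_X: "f \<in> F \<Longrightarrow> f \<in> X"
  using subgroup.subset[OF normal_imp_subgroup[OF F(1)]] by auto

text \<open>
  \<open>Z\<close> is the commutant of \<open>F\<close> and \<open>K\<close> its bicommutant. Compared with the subring generated by
  \<open>F\<close>, the bicommutant has the same virtues - it is commutative, contains \<open>F\<close> and is normalised by
  \<open>X\<close> - but membership in it is tested by equations.
\<close>

definition Z where "Z = {c \<in> carrier R. \<forall>f\<in>F. c \<cdot> f = f \<cdot> c}"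
definition K where "K = {k \<in> carrier R. \<forall>c\<in>Z. k \<cdot> c = c \<cdot> k}"

lemma F_Z: "F \<subseteq> Z" unfolding Z_def using F(2) F_X X_R by blast
lemma F_K: "F \<subseteq> K" unfolding K_def Z_def using F_X X_R by auto
lemma K_R: "k \<in> K \<Longrightarrow> k \<in> carrier R" by (simp add: K_def)
lemma K_comm: "k \<in> K \<Longrightarrow> l \<in> K \<Longrightarrow> k \<cdot> l = l \<cdot> k"
proof -
  assume k: "k \<in> K" and l: "l \<in> K"
  have "l \<in> Z" using l F_Z unfolding Z_def K_def by blast
  then show ?thesis using k unfolding K_def by blast
qed

lemma K_commD: "k \<in> K \<Longrightarrow> c \<in> Z \<Longrightarrow> k \<cdot> c = c \<cdot> k" unfolding K_def by blast

lemma K_subring: "subring K R"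
proof (rule R.subringI)
  show "K \<subseteq> carrier R" by (auto simp: K_def)
  have Zc: "c \<in> Z \<Longrightarrow> c \<in> carrier R" for c by (simp add: Z_def)
  show "\<one>\<^bsub>R\<^esub> \<in> K" using Zc by (auto simp: K_def)
  show "\<ominus>\<^bsub>R\<^esub> k \<in> K" if k: "k \<in> K" for k
    using k K_R[OF k] Zc by (auto simp: K_def R.l_minus R.r_minus)
  show "k \<cdot> l \<in> K" if k: "k \<in> K" and l: "l \<in> K" for k l
  proof -
    have "k \<cdot> l \<cdot> c = c \<cdot> (k \<cdot> l)" if c: "c \<in> Z" for c
      using K_commD[OF k c] K_commD[OF l c] K_R[OF k] K_R[OF l] Zc[OF c] by (metis R.m_assoc)
    then show ?thesis using K_R[OF k] K_R[OF l] by (simp add: K_def)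
  qed
  show "k \<oplus>\<^bsub>R\<^esub> l \<in> K" if k: "k \<in> K" and l: "l \<in> K" for k l
  proof -
    have "(k \<oplus>\<^bsub>R\<^esub> l) \<cdot> c = c \<cdot> (k \<oplus>\<^bsub>R\<^esub> l)" if c: "c \<in> Z" for c
      using K_commD[OF k c] K_commD[OF l c] K_R[OF k] K_R[OF l] Zc[OF c] by (simp add: R.l_distr R.r_distr)
    then show ?thesis using K_R[OF k] K_R[OF l] by (simp add: K_def)
  qed
qed

lemma K_conj:
  assumes x: "x \<in> X" and k: "k \<in> K"
  shows "x \<cdot> k \<cdot> inv\<^bsub>XG\<^esub> x \<in> K"
proof -
  define y where "y = inv\<^bsub>XG\<^esub> x"
  have y: "y \<in> X" "x \<cdot> y = \<one>\<^bsub>R\<^esub>" "y \<cdot> x = \<one>\<^bsub>R\<^esub>" using X_inv[OF x] by (auto simp: y_def)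
  note r = X_R[OF x] X_R[OF y(1)] K_R[OF k]
  have xy: "x \<cdot> (y \<cdot> a) = a" "y \<cdot> (x \<cdot> a) = a" if "a \<in> carrier R" for a
    using that r y by (simp_all add: R.m_assoc[symmetric])
  have "(x \<cdot> k \<cdot> y) \<cdot> c = c \<cdot> (x \<cdot> k \<cdot> y)" if c: "c \<in> Z" for c
  proof -
    have cR: "c \<in> carrier R" using c by (simp add: Z_def)
    have "y \<cdot> c \<cdot> x \<in> Z"
    proof -
      have "(y \<cdot> c \<cdot> x) \<cdot> f = f \<cdot> (y \<cdot> c \<cdot> x)" if f: "f \<in> F" for f
      proof -
        have fR: "f \<in> carrier R" using f F_X X_R by auto
        define g where "g = x \<cdot> f \<cdot> y"
        have "g \<in> F" using normal.inv_op_closed2[OF F(1), of x f] x f by (simp add: g_def y_def)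
        then have cg: "c \<cdot> g = g \<cdot> c" and gR: "g \<in> carrier R" using c F_X X_R by (auto simp: Z_def)
        have "x \<cdot> f = g \<cdot> x" using r fR y by (simp add: g_def R.m_assoc)
        then have "(y \<cdot> c \<cdot> x) \<cdot> f = y \<cdot> (c \<cdot> g) \<cdot> x"
          using r fR cR gR by (simp add: R.m_assoc)
        also have "\<dots> = (y \<cdot> g) \<cdot> c \<cdot> x" unfolding cg using r fR cR gR by (simp add: R.m_assoc)
        also have "y \<cdot> g = f \<cdot> y" using r fR xy by (simp add: g_def R.m_assoc)
        finally show ?thesis using r fR cR by (simp add: R.m_assoc)
      qed
      then show ?thesis using r cR by (simp add: Z_def)
    qed
    then have e: "k \<cdot> (y \<cdot> c \<cdot> x) = (y \<cdot> c \<cdot> x) \<cdot> k" by (rule K_commD[OF k])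
    have "(x \<cdot> k \<cdot> y) \<cdot> c = x \<cdot> (k \<cdot> (y \<cdot> c \<cdot> x)) \<cdot> y"
      using r cR y by (simp add: R.m_assoc)
    also have "\<dots> = c \<cdot> (x \<cdot> k \<cdot> y)" unfolding e using r cR xy by (simp add: R.m_assoc)
    finally show ?thesis .
  qed
  then show ?thesis using r by (simp add: K_def y_def)
qed

lemma K_inv: 
  assumes "x \<in> X" "k \<in> K"
  shows "x \<cdot> k = (x \<cdot> k \<cdot> inv\<^bsub>XG\<^esub> x) \<cdot> x"
  using X_R[OF assms(1)] K_R[OF assms(2)] X_R[OF X_inv(1)[OF assms(1)]] X_inv(3)[OF assms(1)]
  by (simp add: R.m_assoc)

definition invariant :: "'w set \<Rightarrow> bool" where
  "invariant U \<longleftrightarrow> subgroup U W \<and> (\<forall>x\<in>X. x ` U \<subseteq> U)"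

lemma End_one: "f \<in> carrier R \<Longrightarrow> f \<one>\<^bsub>W\<^esub> = \<one>\<^bsub>W\<^esub>"
  using End_mult[of f W "\<one>\<^bsub>W\<^esub>" "\<one>\<^bsub>W\<^esub>"] End_closed[of f W "\<one>\<^bsub>W\<^esub>"] W.l_cancel_one'[of "f \<one>\<^bsub>W\<^esub>" "f \<one>\<^bsub>W\<^esub>"] by simp

lemma End_group_hom: "f \<in> carrier R \<Longrightarrow> group_hom W W f"
  by unfold_locales (auto simp: End_mem)

lemma End_img_subgroup: "f \<in> carrier R \<Longrightarrow> subgroup U W \<Longrightarrow> subgroup (f ` U) W"
  using group_hom.subgroup_img_is_subgroup[OF End_group_hom] by blast

text \<open>
  With \<open>S = K\<close> this says that the line spanned by a vector is a subgroup.
\<close>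

lemma subring_orbit_subgroup: "subgroup {(k w) |k. k \<in> S} W" if S: "subring S R" and w: "w \<in> carrier W"
proof (rule W.subgroupI)
  have SR: "s \<in> S \<Longrightarrow> s \<in> carrier R" for s using subringE(1)[OF S] by auto
  show "{k w |k. k \<in> S} \<subseteq> carrier W" using End_closed[OF SR w] by auto
  show "{k w |k. k \<in> S} \<noteq> {}" using subringE(3)[OF S] by blast
  show "inv\<^bsub>W\<^esub> a \<in> {k w |k. k \<in> S}" if a: "a \<in> {k w |k. k \<in> S}" for a
  proof -
    obtain k where k: "k \<in> S" "a = k w" using a by auto
    have "(\<ominus>\<^bsub>R\<^esub> k \<oplus>\<^bsub>R\<^esub> k) w = \<one>\<^bsub>W\<^esub>" using SR[OF k(1)] w by (simp add: R.l_neg End_apply)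
    then have "(\<ominus>\<^bsub>R\<^esub> k) w \<otimes>\<^bsub>W\<^esub> a = \<one>\<^bsub>W\<^esub>" using k w by (simp add: End_apply)
    then have "inv\<^bsub>W\<^esub> a = (\<ominus>\<^bsub>R\<^esub> k) w"
      using W.inv_equality[of "(\<ominus>\<^bsub>R\<^esub> k) w" a] End_closed[of k W w] End_closed[of "\<ominus>\<^bsub>R\<^esub> k" W w] SR[OF k(1)] k w by simp
    then show ?thesis using subringE(5)[OF S k(1)] by auto
  qed
  show "a \<otimes>\<^bsub>W\<^esub> b \<in> {k w |k. k \<in> S}" if a: "a \<in> {k w |k. k \<in> S}" and b: "b \<in> {k w |k. k \<in> S}" for a b
  proof -
    obtain k l where kl: "k \<in> S" "a = k w" "l \<in> S" "b = l w" using a b by auto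
    then have "a \<otimes>\<^bsub>W\<^esub> b = (k \<oplus>\<^bsub>R\<^esub> l) w" using w by (simp add: End_apply)
    then show ?thesis using subringE(7)[OF S kl(1,3)] by blast
  qed
qed

lemma K_neg_add: "k \<in> K \<Longrightarrow> l \<in> K \<Longrightarrow> k \<oplus>\<^bsub>R\<^esub> l \<in> K" "k \<in> K \<Longrightarrow> \<ominus>\<^bsub>R\<^esub> k \<in> K"
  "k \<in> K \<Longrightarrow> l \<in> K \<Longrightarrow> k \<cdot> l \<in> K" "\<one>\<^bsub>R\<^esub> \<in> K" "\<zero>\<^bsub>R\<^esub> \<in> K"
  using subringE[OF K_subring] by auto

lemma finite_K: "finite K"
  using W.End_finite[OF finW] K_R by (metis finite_subset subsetI)

end

section \<open>Irreducible modules over a field: one-dimensional semilinear actions\<close>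

text \<open>
  Here \<open>K\<close> is a field: a finite commutative ring of endomorphisms whose nonzero elements are surjective.
\<close>

locale linear_tower_field = linear_tower +
  assumes field: "\<And>k. k \<in> K \<Longrightarrow> k \<noteq> \<zero>\<^bsub>End W\<^esub> \<Longrightarrow> k ` carrier W = carrier W"
    and nontrivial: "carrier W \<noteq> {\<one>\<^bsub>W\<^esub>}"
    and irreducible: "\<And>U. invariant U \<Longrightarrow> U = {\<one>\<^bsub>W\<^esub>} \<or> U = carrier W"
begin

lemma K_inj: "k \<in> K \<Longrightarrow> k \<noteq> \<zero>\<^bsub>R\<^esub> \<Longrightarrow> inj_on k (carrier W)"
  using field finW by (simp add: eq_card_imp_inj_on)

lemma K_domain:
  assumes k: "k \<in> K" "k \<noteq> \<zero>\<^bsub>R\<^esub>" and l: "l \<in> carrier R" and 0: "k \<cdot> l = \<zero>\<^bsub>R\<^esub>"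
  shows "l = \<zero>\<^bsub>R\<^esub>"
proof (rule End_eqI[where W = W])
  fix w assume w: "w \<in> carrier W"
  have "k (l w) = k \<one>\<^bsub>W\<^esub>" using End_apply(1,4)[OF w] 0 End_one[OF K_R[OF k(1)]] by metis
  then have "l w = \<one>\<^bsub>W\<^esub>" using K_inj[OF k] End_closed[OF l w] by (auto dest: inj_onD)
  then show "l w = \<zero>\<^bsub>R\<^esub> w" using w by (simp add: End_apply)
qed (use l in auto)

lemma R_one_not_zero: "\<one>\<^bsub>R\<^esub> \<noteq> \<zero>\<^bsub>R\<^esub>"
proof
  assume e: "\<one>\<^bsub>R\<^esub> = \<zero>\<^bsub>R\<^esub>"
  have "w = \<one>\<^bsub>W\<^esub>" if w: "w \<in> carrier W" for w
    by (rule trans[OF End_apply(3)[OF w, symmetric] trans[OF fun_cong[OF e] End_apply(4)[OF w]]])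
  then have "carrier W = {\<one>\<^bsub>W\<^esub>}" using W.one_closed by blast
  then show False using nontrivial by contradiction
qed

abbreviation "KR \<equiv> R\<lparr>carrier := K\<rparr>"

lemma KR_field: "field KR"
proof -
  have "subcring K R" using K_subring K_comm by (intro R.subcringI) auto
  then interpret KR: cring KR using R.subcring_iff[of K] K_R by auto
  show ?thesis
  proof (rule KR.cring_fieldI2)
    show "\<zero>\<^bsub>KR\<^esub> \<noteq> \<one>\<^bsub>KR\<^esub>" using R_one_not_zero by auto
    fix k assume k: "k \<in> carrier KR" "k \<noteq> \<zero>\<^bsub>KR\<^esub>"
    have kK: "k \<in> K" using k by simp
    have "inj_on (\<lambda>l. k \<cdot> l) K"
    proof (rule inj_onI)
      fix l m assume lm: "l \<in> K" "m \<in> K" "k \<cdot> l = k \<cdot> m"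
      then have "k \<cdot> (l \<ominus>\<^bsub>R\<^esub> m) = \<zero>\<^bsub>R\<^esub>" using k K_R[of k] K_R[of l] K_R[of m]
        by (simp add: R.minus_eq R.r_distr R.r_minus R.r_neg)
      then have "l \<ominus>\<^bsub>R\<^esub> m = \<zero>\<^bsub>R\<^esub>" using K_domain[OF kK] k lm K_R by simp
      then show "l = m" using K_R lm by (simp add: R.r_right_minus_eq)
    qed
    then have "(\<lambda>l. k \<cdot> l) ` K = K" using finite_K K_neg_add(3)[OF kK] by (intro endo_inj_surj) auto
    then show "\<exists>b\<in>carrier KR. k \<otimes>\<^bsub>KR\<^esub> b = \<one>\<^bsub>KR\<^esub>" using K_neg_add(4) by force
  qed
qed

lemma K_cyclic:
  obtains \<zeta> where "\<zeta> \<in> K" "\<zeta> \<noteq> \<zero>\<^bsub>R\<^esub>" "\<And>k. k \<in> K \<Longrightarrow> k \<noteq> \<zero>\<^bsub>R\<^esub> \<Longrightarrow> \<exists>i::nat. k = \<zeta> [^]\<^bsub>R\<^esub> i"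
proof -
  interpret KR: field KR by (rule KR_field)
  obtain a where a: "a \<in> carrier (mult_of KR)" "carrier (mult_of KR) = {a [^]\<^bsub>KR\<^esub> i | i::nat. i \<in> UNIV}"
    using KR.finite_field_mult_group_has_gen finite_K by auto
  have pw: "a [^]\<^bsub>KR\<^esub> (i::nat) = a [^]\<^bsub>R\<^esub> i" for i by (simp add: nat_pow_def)
  have "\<exists>i::nat. k = a [^]\<^bsub>R\<^esub> i" if "k \<in> K" "k \<noteq> \<zero>\<^bsub>R\<^esub>" for k
  proof -
    have "k \<in> carrier (mult_of KR)" using that by simp
    then show ?thesis unfolding a(2) by (auto simp: pw)
  qed
  then show thesis using a(1) that by auto
qed

lemma conj_mem: "x \<in> X \<Longrightarrow> k \<in> K \<Longrightarrow> \<exists>l\<in>K. x \<cdot> k = l \<cdot> x"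
  using K_conj[of x k] K_inv[of x k] by blast

lemma X_not_zero: "x \<in> X \<Longrightarrow> l \<cdot> x = \<zero>\<^bsub>R\<^esub> \<Longrightarrow> l \<in> carrier R \<Longrightarrow> l = \<zero>\<^bsub>R\<^esub>"
proof -
  assume x: "x \<in> X" and l: "l \<cdot> x = \<zero>\<^bsub>R\<^esub>" "l \<in> carrier R"
  have "l \<cdot> x \<cdot> inv\<^bsub>XG\<^esub> x = \<zero>\<^bsub>R\<^esub> \<cdot> inv\<^bsub>XG\<^esub> x" using l by simp
  then show "l = \<zero>\<^bsub>R\<^esub>" using l(2) X_R[OF x] X_R[OF X_inv(1)[OF x]] X_inv(2)[OF x] by (simp add: R.m_assoc)
qed

text \<open>
  The elements of \<open>X\<close> act on \<open>K\<close> by conjugation, and those in distinct cosets of \<open>F\<close> act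
  differently: otherwise their quotient would centralise \<open>F \<subseteq> K\<close> and so lie in \<open>F\<close>. The claim is
  therefore the linear independence of distinct field automorphisms, with Dedekind's proof: from a
  shortest relation, multiplied on the right by a suitable \<open>k\<close>, subtract a multiple of itself to obtain
  a shorter one.
\<close>

lemma dedekind_independence:
  assumes "finite I" "I \<noteq> {}" "I \<subseteq> X" "c \<in> I \<rightarrow> K - {\<zero>\<^bsub>R\<^esub>}"
    and "\<And>g h. g \<in> I \<Longrightarrow> h \<in> I \<Longrightarrow> g \<noteq> h \<Longrightarrow> inv\<^bsub>XG\<^esub> g \<cdot> h \<notin> F"
  shows "finsum R (\<lambda>h. c h \<cdot> h) I \<noteq> \<zero>\<^bsub>R\<^esub>"
  using assms
proof (induction "card I" arbitrary: I c rule: less_induct)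
  case less
  note fin = less.prems(1) and IX = less.prems(3) and cK = less.prems(4) and sep = less.prems(5)
  have IR: "h \<in> carrier R" if "h \<in> I" for h using IX X_R that by auto
  have cR: "c h \<in> carrier R" "c h \<in> K" "c h \<noteq> \<zero>\<^bsub>R\<^esub>" if "h \<in> I" for h using cK K_R that by auto
  obtain g where g: "g \<in> I" using less.prems(2) by auto
  have gX: "g \<in> X" using g IX by auto
  show ?case
  proof
    assume sum0: "finsum R (\<lambda>h. c h \<cdot> h) I = \<zero>\<^bsub>R\<^esub>"
    show False
    proof (cases "I = {g}")
      case True
      then have "c g \<cdot> g = \<zero>\<^bsub>R\<^esub>" using sum0 cR(1)[OF g] IR[OF g] by (simp add: R.finsum_insert)
      then show False using X_not_zero[OF gX] cR[OF g] by auto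
    next
      case False
      then obtain h where h: "h \<in> I" "h \<noteq> g" using g by auto
      have hX: "h \<in> X" using h IX by auto
      define y where "y = inv\<^bsub>XG\<^esub> g \<cdot> h"
      have yX: "y \<in> X" using X.m_closed[of "inv\<^bsub>XG\<^esub> g" h] X_inv(1)[OF gX] hX by (simp add: y_def)
      have "y \<notin> F" using sep[OF g h(1)] h(2) by (auto simp: y_def)
      then obtain k where k: "k \<in> F" "y \<cdot> k \<noteq> k \<cdot> y" using F(3)[OF yX] by blast
      have kK: "k \<in> K" using k F_K by auto
      have kR: "k \<in> carrier R" using K_R[OF kK] .
      \<comment> \<open>The automorphism of \<open>K\<close> induced by \<open>x\<close>, applied to \<open>k\<close>.\<close>
      define \<tau> where "\<tau> x = x \<cdot> k \<cdot> inv\<^bsub>XG\<^esub> x" for x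
      have \<tau>K: "\<tau> x \<in> K" "\<tau> x \<in> carrier R" "x \<cdot> k = \<tau> x \<cdot> x" if "x \<in> X" for x
        using K_conj[OF that kK] K_inv[OF that kK] K_R by (auto simp: \<tau>_def)
      have ne: "\<tau> h \<noteq> \<tau> g"
      proof
        assume e: "\<tau> h = \<tau> g"
        define gi where "gi = inv\<^bsub>XG\<^esub> g"
        have gi: "gi \<in> carrier R" "gi \<cdot> g = \<one>\<^bsub>R\<^esub>" using X_inv[OF gX] X_R by (auto simp: gi_def)
        have "y \<cdot> k = gi \<cdot> (\<tau> g \<cdot> h)"
          using gi kR IR[OF h(1)] \<tau>K(3)[OF hX] e by (simp add: y_def gi_def[symmetric] R.m_assoc)
        also have "\<dots> = gi \<cdot> \<tau> g \<cdot> h" using gi \<tau>K(2)[OF gX] IR[OF h(1)] by (simp add: R.m_assoc)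
        also have "gi \<cdot> \<tau> g = k \<cdot> gi"
        proof -
          have "gi \<cdot> \<tau> g = gi \<cdot> (g \<cdot> (k \<cdot> gi))"
            unfolding \<tau>_def gi_def[symmetric] using gi kR IR[OF g] by (simp add: R.m_assoc)
          also have "\<dots> = gi \<cdot> g \<cdot> (k \<cdot> gi)"
            by (rule R.m_assoc[symmetric]) (use gi kR IR[OF g] in auto)
          finally show ?thesis using gi kR by simp
        qed
        also have "k \<cdot> gi \<cdot> h = k \<cdot> y" using gi kR IR[OF h(1)] by (simp add: y_def gi_def[symmetric] R.m_assoc)
        finally show False using k(2) by simp
      qed
      define d where "d x = c x \<cdot> (\<tau> x \<ominus>\<^bsub>R\<^esub> \<tau> g)" for x
      have dK: "d x \<in> K" "d x \<in> carrier R" if "x \<in> I" for x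
      proof -
        show "d x \<in> K" unfolding d_def R.minus_eq using K_neg_add cR[OF that] \<tau>K[of x] \<tau>K[OF gX] IX that by auto
        then show "d x \<in> carrier R" by (rule K_R)
      qed
      have dsum: "finsum R (\<lambda>x. d x \<cdot> x) I = \<zero>\<^bsub>R\<^esub>"
      proof -
        have "finsum R (\<lambda>x. d x \<cdot> x) I
          = finsum R (\<lambda>x. (c x \<cdot> x) \<cdot> k \<oplus>\<^bsub>R\<^esub> (\<ominus>\<^bsub>R\<^esub> \<tau> g) \<cdot> (c x \<cdot> x)) I"
        proof (rule R.finsum_cong')
          fix x assume x: "x \<in> I"
          have xX: "x \<in> X" using IX x by auto
          note r = IR[OF x] cR(1)[OF x] \<tau>K(2)[OF xX] \<tau>K(2)[OF gX] kR
          have "(c x \<cdot> x) \<cdot> k = c x \<cdot> \<tau> x \<cdot> x" using r \<tau>K(3)[OF xX] by (simp add: R.m_assoc)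
          moreover have "(\<ominus>\<^bsub>R\<^esub> \<tau> g) \<cdot> (c x \<cdot> x) = \<ominus>\<^bsub>R\<^esub> (c x \<cdot> \<tau> g \<cdot> x)"
            using r K_comm[OF cR(2)[OF x] \<tau>K(1)[OF gX]] by (simp add: R.l_minus R.m_assoc[symmetric])
          ultimately show "d x \<cdot> x = (c x \<cdot> x) \<cdot> k \<oplus>\<^bsub>R\<^esub> (\<ominus>\<^bsub>R\<^esub> \<tau> g) \<cdot> (c x \<cdot> x)"
            using r by (simp add: d_def R.minus_eq R.r_distr R.l_distr R.r_minus R.l_minus)
        qed (use cR IR kR \<tau>K(2)[OF gX] in auto)
        also have "\<dots> = finsum R (\<lambda>x. c x \<cdot> x) I \<cdot> k \<oplus>\<^bsub>R\<^esub> (\<ominus>\<^bsub>R\<^esub> \<tau> g) \<cdot> finsum R (\<lambda>x. c x \<cdot> x) I"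
          using fin cR IR kR \<tau>K(2)[OF gX]
          by (subst R.finsum_addf) (auto simp: R.finsum_ldistr R.finsum_rdistr Pi_iff)
        also have "\<dots> = \<zero>\<^bsub>R\<^esub>" unfolding sum0 using kR \<tau>K(2)[OF gX] by simp
        finally show ?thesis .
      qed
      define J where "J = {x \<in> I. d x \<noteq> \<zero>\<^bsub>R\<^esub>}"
      have "d g = \<zero>\<^bsub>R\<^esub>" using cR[OF g] \<tau>K(2)[OF gX] by (simp add: d_def R.minus_eq R.r_neg)
      then have "J \<subset> I" using g by (auto simp: J_def)
      have "d h \<noteq> \<zero>\<^bsub>R\<^esub>"
      proof
        assume "d h = \<zero>\<^bsub>R\<^esub>"
        then have "\<tau> h \<ominus>\<^bsub>R\<^esub> \<tau> g = \<zero>\<^bsub>R\<^esub>"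
          using K_domain[of "c h" "\<tau> h \<ominus>\<^bsub>R\<^esub> \<tau> g"] cR[OF h(1)] \<tau>K(2)[OF hX] \<tau>K(2)[OF gX] by (simp add: d_def)
        then show False using ne \<tau>K(2)[OF hX] \<tau>K(2)[OF gX] by (simp add: R.r_right_minus_eq)
      qed
      then have "J \<noteq> {}" using h by (auto simp: J_def)
      have "finsum R (\<lambda>x. d x \<cdot> x) J = finsum R (\<lambda>x. d x \<cdot> x) I"
        by (rule R.add.finprod_mono_neutral_cong_left) (use fin dK IR in \<open>auto simp: J_def\<close>)
      moreover have "finsum R (\<lambda>x. d x \<cdot> x) J \<noteq> \<zero>\<^bsub>R\<^esub>"
        by (rule less.hyps)
           (use \<open>J \<subset> I\<close> \<open>J \<noteq> {}\<close> fin IX dK sep in \<open>auto simp: J_def psubset_card_mono intro: finite_subset\<close>)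
      ultimately show False using dsum by simp
    qed
  qed
qed

text \<open>
  Let \<open>H\<close> be a complement of \<open>F\<close>. The operator \<open>D\<close>, the sum of \<open>H\<close>, is nonzero by independence, and
  any vector in its image is fixed by \<open>H\<close>. For such a \<open>v \<noteq> 0\<close> the line \<open>K v\<close> is invariant under
  \<open>X = F H\<close>, because \<open>F \<subseteq> K\<close> and \<open>H\<close> normalises \<open>K\<close>; by irreducibility it is everything. An
  element \<open>f h\<close> then acts through the automorphism induced by \<open>h\<close> followed by multiplication by
  \<open>f\<close>.
\<close>

lemma field_case_semilinear:
  "semilinear W X (\<lambda>x. x)"
proof -
  obtain H where H: "X.complements H F"
    using abelian_normal_complement[OF XT F(1)] F(2) by auto
  have Hsub: "subgroup H XG" and HF: "H \<inter> F = {\<one>\<^bsub>R\<^esub>}"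
    and dec: "\<And>x. x \<in> X \<Longrightarrow> \<exists>f\<in>F. \<exists>h\<in>H. x = f \<cdot> h" using H by (auto simp: X.complements_def)
  have HX: "H \<subseteq> X" using subgroup.subset[OF Hsub] by simp
  have HR: "h \<in> carrier R" if "h \<in> H" for h using HX X_R that by auto
  have finH: "finite H" using HX X.fin finite_subset by auto
  have H1: "\<one>\<^bsub>R\<^esub> \<in> H" using subgroup.one_closed[OF Hsub] by simp
  define D where "D = finsum R (\<lambda>h. h) H"
  have D: "D \<in> carrier R" unfolding D_def using HR by (auto intro: R.finsum_closed)
  have "finsum R (\<lambda>h. \<one>\<^bsub>R\<^esub> \<cdot> h) H \<noteq> \<zero>\<^bsub>R\<^esub>"
  proof (rule dedekind_independence[OF finH])
    fix g h assume gh: "g \<in> H" "h \<in> H" "g \<noteq> h"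
    show "inv\<^bsub>XG\<^esub> g \<cdot> h \<notin> F"
    proof
      assume a: "inv\<^bsub>XG\<^esub> g \<cdot> h \<in> F"
      have "inv\<^bsub>XG\<^esub> g \<cdot> h \<in> H" using subgroup.m_closed[OF Hsub subgroup.m_inv_closed[OF Hsub gh(1)] gh(2)] by simp
      then have "inv\<^bsub>XG\<^esub> g \<cdot> h = \<one>\<^bsub>R\<^esub>" using a HF by auto
      then have "g \<cdot> (inv\<^bsub>XG\<^esub> g \<cdot> h) = g" using HR gh by simp
      moreover have "g \<in> X" "h \<in> X" using gh HX by auto
      ultimately show False using gh X_inv[of g] X_R[of "inv\<^bsub>XG\<^esub> g"] HR by (simp add: R.m_assoc[symmetric])
    qed
  qed (use H1 HX R_one_not_zero K_neg_add(4) in auto)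
  moreover have "finsum R (\<lambda>h. \<one>\<^bsub>R\<^esub> \<cdot> h) H = D"
    unfolding D_def by (rule R.finsum_cong') (use HR in auto)
  ultimately have "D \<noteq> \<zero>\<^bsub>R\<^esub>" by simp
  then have "\<not> (\<forall>w\<in>carrier W. D w = \<zero>\<^bsub>R\<^esub> w)"
    using End_eqI[of D W "\<zero>\<^bsub>R\<^esub>"] D R.zero_closed by blast
  then obtain w where w: "w \<in> carrier W" "D w \<noteq> \<one>\<^bsub>W\<^esub>"
    using End_apply(4)[of _ W] by auto
  define v where "v = D w"
  have vW: "v \<in> carrier W" using End_closed[OF D w(1)] by (simp add: v_def)
  have hv: "h v = v" if h: "h \<in> H" for h
  proof -
    have "h \<cdot> D = finsum R (\<lambda>g. h \<cdot> g) H"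
      unfolding D_def by (rule R.finsum_rdistr) (use finH HR h in auto)
    also have "\<dots> = finsum R (\<lambda>g. g) ((\<lambda>g. h \<cdot> g) ` H)"
    proof (rule R.add.finprod_reindex[symmetric, of "\<lambda>g. g"])
      show "(\<lambda>g. g) \<in> (\<cdot>) h ` H \<rightarrow> carrier R" using HR h by auto
      have "inj_on ((\<otimes>\<^bsub>XG\<^esub>) h) H" using X.inj_on_cmult[of h] HX h by (auto intro: inj_on_subset)
      then show "inj_on ((\<cdot>) h) H" by simp
    qed
    also have "(\<lambda>g. h \<cdot> g) ` H = H"
      using X.subgroup_mult_id[OF Hsub] subgroup.m_closed[OF Hsub h] X.inj_on_cmult[of h] HX h finH
      by (intro endo_inj_surj) (auto intro: inj_on_subset)
    finally have "h \<cdot> D = D" by (simp add: D_def)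
    then show ?thesis unfolding v_def using End_apply(1)[OF w(1)] by metis
  qed
  obtain \<zeta> where z: "\<zeta> \<in> K" "\<zeta> \<noteq> \<zero>\<^bsub>R\<^esub>" and gen: "\<And>k. k \<in> K \<Longrightarrow> k \<noteq> \<zero>\<^bsub>R\<^esub> \<Longrightarrow> \<exists>i::nat. k = \<zeta> [^]\<^bsub>R\<^esub> i"
    using K_cyclic by blast
  have zR: "\<zeta> \<in> carrier R" using K_R[OF z(1)] .
  have zpK: "\<zeta> [^]\<^bsub>R\<^esub> (i::nat) \<in> K" for i by (induction i) (use K_neg_add z in auto)
  have X_nz: "x \<noteq> \<zero>\<^bsub>R\<^esub>" if x: "x \<in> X" for x
    using X_not_zero[OF x, of "\<one>\<^bsub>R\<^esub>"] X_R[OF x] R_one_not_zero by auto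
  have act: "\<exists>\<rho> u. \<forall>i::nat. x ((\<zeta> [^]\<^bsub>R\<^esub> i) v) = (\<zeta> [^]\<^bsub>R\<^esub> (\<rho> * i + u)) v" if x: "x \<in> X" for x
  proof -
    obtain f h where fh: "f \<in> F" "h \<in> H" "x = f \<cdot> h" using dec[OF x] by blast
    have hX: "h \<in> X" using fh HX by auto
    have fX: "f \<in> X" using fh F_X by auto
    note r = zR X_R[OF hX] X_R[OF fX]
    obtain l where l: "l \<in> K" "h \<cdot> \<zeta> = l \<cdot> h" using conj_mem[OF hX z(1)] by blast
    have lR: "l \<in> carrier R" using K_R[OF l(1)] .
    have "l \<noteq> \<zero>\<^bsub>R\<^esub>"
    proof
      assume "l = \<zero>\<^bsub>R\<^esub>"
      then have "h \<cdot> \<zeta> = \<zero>\<^bsub>R\<^esub>" using l r by simp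
      then have "inv\<^bsub>XG\<^esub> h \<cdot> (h \<cdot> \<zeta>) = \<zero>\<^bsub>R\<^esub>" using X_R[OF X_inv(1)[OF hX]] by simp
      then show False using z r X_R[OF X_inv(1)[OF hX]] X_inv(3)[OF hX] by (simp add: R.m_assoc[symmetric])
    qed
    then obtain \<rho> :: nat where \<rho>: "l = \<zeta> [^]\<^bsub>R\<^esub> \<rho>" using gen[OF l(1)] by blast
    obtain u :: nat where u: "f = \<zeta> [^]\<^bsub>R\<^esub> u" using gen[of f] fh F_K X_nz[OF fX] by auto
    have hz: "h \<cdot> \<zeta> [^]\<^bsub>R\<^esub> (i::nat) = \<zeta> [^]\<^bsub>R\<^esub> (\<rho> * i) \<cdot> h" for i
    proof (induction i)
      case (Suc i)
      have "h \<cdot> \<zeta> [^]\<^bsub>R\<^esub> Suc i = (h \<cdot> \<zeta> [^]\<^bsub>R\<^esub> i) \<cdot> \<zeta>" using r by (simp add: R.m_assoc)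
      also have "\<dots> = \<zeta> [^]\<^bsub>R\<^esub> (\<rho> * i) \<cdot> (l \<cdot> h)" unfolding Suc using r l(2) by (simp add: R.m_assoc)
      also have "\<dots> = \<zeta> [^]\<^bsub>R\<^esub> (\<rho> * i) \<cdot> \<zeta> [^]\<^bsub>R\<^esub> \<rho> \<cdot> h" using r \<rho> by (simp add: R.m_assoc)
      also have "\<zeta> [^]\<^bsub>R\<^esub> (\<rho> * i) \<cdot> \<zeta> [^]\<^bsub>R\<^esub> \<rho> = \<zeta> [^]\<^bsub>R\<^esub> (\<rho> * Suc i)" using r by (simp add: R.nat_pow_mult add.commute)
      finally show ?case .
    qed (use r in simp)
    have "x ((\<zeta> [^]\<^bsub>R\<^esub> i) v) = (\<zeta> [^]\<^bsub>R\<^esub> (\<rho> * i + u)) v" for i :: nat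
    proof -
      have "x ((\<zeta> [^]\<^bsub>R\<^esub> i) v) = (f \<cdot> (h \<cdot> \<zeta> [^]\<^bsub>R\<^esub> i)) v"
        using vW r End_closed[of "\<zeta> [^]\<^bsub>R\<^esub> i" W v] by (simp add: fh(3) End_apply)
      also have "f \<cdot> (h \<cdot> \<zeta> [^]\<^bsub>R\<^esub> i) = \<zeta> [^]\<^bsub>R\<^esub> (\<rho> * i + u) \<cdot> h"
        unfolding hz u using r by (simp add: R.m_assoc[symmetric] R.nat_pow_mult add.commute)
      also have "(\<zeta> [^]\<^bsub>R\<^esub> (\<rho> * i + u) \<cdot> h) v = (\<zeta> [^]\<^bsub>R\<^esub> (\<rho> * i + u)) v"
        using vW hv[OF fh(2)] by (simp add: End_apply)
      finally show ?thesis .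
    qed
    then show ?thesis by blast
  qed
  have KvE: "{k v |k. k \<in> K} = insert \<one>\<^bsub>W\<^esub> (range (\<lambda>i::nat. (\<zeta> [^]\<^bsub>R\<^esub> i) v))"
  proof
    show "{k v |k. k \<in> K} \<subseteq> insert \<one>\<^bsub>W\<^esub> (range (\<lambda>i::nat. (\<zeta> [^]\<^bsub>R\<^esub> i) v))"
    proof clarify
      fix k assume k: "k \<in> K" "k v \<notin> range (\<lambda>i::nat. (\<zeta> [^]\<^bsub>R\<^esub> i) v)"
      then have "k = \<zero>\<^bsub>R\<^esub>" using gen[of k] by auto
      then show "k v = \<one>\<^bsub>W\<^esub>" using End_apply(4)[OF vW] by simp
    qed
    have "\<one>\<^bsub>W\<^esub> = \<zero>\<^bsub>R\<^esub> v" using End_apply(4)[OF vW] by simp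
    then show "insert \<one>\<^bsub>W\<^esub> (range (\<lambda>i::nat. (\<zeta> [^]\<^bsub>R\<^esub> i) v)) \<subseteq> {k v |k. k \<in> K}"
      using zpK K_neg_add(5) by blast
  qed
  have "invariant {k v |k. k \<in> K}"
    unfolding invariant_def
  proof (intro conjI ballI subring_orbit_subgroup[OF K_subring vW])
    fix x assume x: "x \<in> X"
    have "x \<one>\<^bsub>W\<^esub> = \<one>\<^bsub>W\<^esub>" using End_one[OF X_R[OF x]] .
    then show "x ` {k v |k. k \<in> K} \<subseteq> {k v |k. k \<in> K}" unfolding KvE using act[OF x] by auto
  qed
  moreover have "v \<in> {k v |k. k \<in> K}" 
    by (rule CollectI, rule exI[of _ "\<one>\<^bsub>R\<^esub>"]) (use K_neg_add(4) End_apply(3)[OF vW] in simp)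
  ultimately have "carrier W = {k v |k. k \<in> K}" using irreducible w(2) by (auto simp: v_def)
  then show ?thesis unfolding semilinear_def using KvE act vW zR by (intro bexI[of _ \<zeta>] bexI[of _ v]) auto
qed

end

section \<open>Reducing an arbitrary module\<close>

lemma (in group) subgroup_card_dvd: "subgroup H G \<Longrightarrow> \<exists>m. card (carrier G) = m * card H"
  using lagrange[of H] by (metis order_def)

text \<open>
  If \<open>G = H V\<close> then the index of \<open>H \<inter> V\<close> in \<open>H\<close> equals that of \<open>V\<close> in \<open>G\<close>; only the bound on
  \<open>H \<inter> V\<close> from above is proved, by mapping \<open>(h v, z)\<close> to \<open>(h z, inv z v)\<close>.
\<close>

lemma (in group) card_Int_le:
  assumes "finite (carrier G)" "subgroup H G" "subgroup V G" and dec: "\<And>w. w \<in> carrier G \<Longrightarrow> \<exists>h\<in>H. \<exists>v\<in>V. w = h \<otimes> v"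
  shows "card (carrier G) * card (H \<inter> V) \<le> card H * card V"
proof -
  interpret H: subgroup H G by fact
  interpret V: subgroup V G by fact
  obtain a b where ab: "\<And>w. w \<in> carrier G \<Longrightarrow> a w \<in> H \<and> b w \<in> V \<and> w = a w \<otimes> b w" using dec by metis
  define f where "f = (\<lambda>(w, z). (a w \<otimes> z, inv z \<otimes> b w))"
  have inj: "inj_on f (carrier G \<times> (H \<inter> V))"
  proof (rule inj_onI, clarify)
    fix w z w' z' assume *: "w \<in> carrier G" "z \<in> H" "z \<in> V" "w' \<in> carrier G" "z' \<in> H" "z' \<in> V" "f (w, z) = f (w', z')"
    have prod: "(a w \<otimes> z) \<otimes> (inv z \<otimes> b w) = w" if w: "w \<in> carrier G" and z: "z \<in> H" for w z
    proof -
      have c: "a w \<in> carrier G" "b w \<in> carrier G" "z \<in> carrier G" using ab[OF w] z by auto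
      then have "(a w \<otimes> z) \<otimes> (inv z \<otimes> b w) = a w \<otimes> b w" by (simp add: m_assoc)
      then show ?thesis using ab[OF w] by simp
    qed
    have e: "a w \<otimes> z = a w' \<otimes> z'" "inv z \<otimes> b w = inv z' \<otimes> b w'" using * by (auto simp: f_def)
    then have "w = w'" using prod[of w z] prod[of w' z'] * by metis
    moreover have "z = z'" using e(1) \<open>w = w'\<close> ab[of w'] * by auto
    ultimately show "w = w' \<and> z = z'" by simp
  qed
  have "f ` (carrier G \<times> (H \<inter> V)) \<subseteq> H \<times> V"
    using ab by (auto simp: f_def)
  then have "card (carrier G \<times> (H \<inter> V)) \<le> card (H \<times> V)"
    using inj assms(1) H.subset V.subset by (intro card_inj_on_le) (auto intro: finite_subset)
  then show ?thesis by (simp add: card_cartesian_product)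
qed

context linear_tower begin

lemma X_image_carrier: "x \<in> X \<Longrightarrow> x ` carrier W = carrier W"
  using X_inv_apply[of x] X_inv(1)[of x] End_closed[OF X_R] by (force simp: image_iff)

text \<open>
  If \<open>K\<close> is not a field, take a maximal ideal \<open>M\<close> of \<open>K\<close> and \<open>U = M W\<close>. The conjugates of \<open>M\<close> under
  \<open>X\<close> are pairwise comaximal, so by the Chinese remainder theorem the intersection of the distinct
  conjugates of \<open>U\<close> has index \<open>c\<close> to the power of their number, where \<open>c\<close> is the index of \<open>U\<close>. That
  number is the index \<open>t\<close> of the stabiliser \<open>S\<close> of \<open>U\<close>, whence \<open>c ^ t \<le> card (carrier W)\<close>.

  The proof does not form quotient rings. Ideals are replaced by the subgroups that the images of their
  elements generate in \<open>W\<close>.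
\<close>

lemma bicommutant_reduction:
  assumes k0: "k0 \<in> K" "k0 \<noteq> \<zero>\<^bsub>R\<^esub>" "k0 ` carrier W \<noteq> carrier W"
  shows "\<exists>U S t c. subgroup U W \<and> U \<noteq> {\<one>\<^bsub>W\<^esub>} \<and> U \<noteq> carrier W \<and> subgroup S XG \<and> (\<forall>s\<in>S. s ` U \<subseteq> U) \<and>
     card X = t * card S \<and> card (carrier W) = c * card U \<and> c ^ t \<le> card (carrier W)"
proof -
  let ?C = "carrier W"
  define gen where "gen J = generate W (\<Union>k\<in>J. k ` ?C)" for J
  have imgC: "k ` ?C \<subseteq> ?C" if "k \<in> K" for k using End_closed[OF K_R[OF that]] by auto
  have imgsub: "subgroup (k ` ?C) W" if "k \<in> K" for k
    using End_img_subgroup[OF K_R[OF that] W.subgroup_self] .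
  have gensub: "subgroup (gen J) W" if "J \<subseteq> K" for J
    unfolding gen_def by (rule W.generate_is_subgroup) (use imgC that in blast)
  have genle: "gen J \<subseteq> V" if "subgroup V W" "\<And>k. k \<in> J \<Longrightarrow> k ` ?C \<subseteq> V" for J V
    unfolding gen_def by (rule W.generate_subgroup_incl[OF _ that(1)]) (use that(2) in auto)
  have genincl: "k ` ?C \<subseteq> gen J" if "k \<in> J" for k J
    using that by (auto simp: gen_def intro: generate.incl)
  define \<U> where "\<U> = {gen J |J. J \<subseteq> K \<and> gen J \<noteq> ?C}"
  have "finite \<U>"
    by (rule finite_subset[of _ "gen ` Pow K"]) (use finite_K in \<open>auto simp: \<U>_def\<close>)
  have g0: "gen {k0} = k0 ` ?C"
    using genle[OF imgsub[OF k0(1)], of "{k0}"] genincl[of k0 "{k0}"] by auto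
  have "gen {k0} \<in> \<U>" unfolding \<U>_def by (rule CollectI, rule exI[of _ "{k0}"]) (use k0 g0 in simp)
  then obtain U where U: "U \<in> \<U>" "gen {k0} \<subseteq> U" and max: "\<And>V. V \<in> \<U> \<Longrightarrow> U \<subseteq> V \<Longrightarrow> U = V"
    using finite_has_maximal2[OF \<open>finite \<U>\<close>, of "gen {k0}"] by metis
  obtain J where J: "J \<subseteq> K" "U = gen J" and UC: "U \<noteq> ?C" using U by (auto simp: \<U>_def)
  have Usub: "subgroup U W" using gensub J by simp
  have U1: "U \<noteq> {\<one>\<^bsub>W\<^esub>}"
  proof
    assume "U = {\<one>\<^bsub>W\<^esub>}"
    then have "k0 w = \<one>\<^bsub>W\<^esub>" if "w \<in> ?C" for w using U(2) g0 that by auto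
    then have "k0 = \<zero>\<^bsub>R\<^esub>" using End_eqI[OF K_R[OF k0(1)] R.zero_closed] End_apply(4)[of _ W] by simp
    then show False using k0 by simp
  qed
  \<comment> \<open>An element of \<open>K\<close> outside the maximal ideal generates the unit ideal together with it.\<close>
  have prime: "k ` ?C \<subseteq> U \<or> (\<forall>y\<in>?C. \<exists>a\<in>U. \<exists>w\<in>?C. y = a \<otimes>\<^bsub>W\<^esub> k w)" if k: "k \<in> K" for k
  proof (cases "gen (insert k J) = ?C")
    case True
    have "subgroup (U <#>\<^bsub>W\<^esub> k ` ?C) W" using W.mult_subgroups[OF Usub imgsub[OF k]] .
    moreover have "l ` ?C \<subseteq> U <#>\<^bsub>W\<^esub> k ` ?C" if "l \<in> insert k J" for l
      using that W.set_mult_incl[OF Usub imgsub[OF k]] genincl[of l J] J by auto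
    ultimately have "?C \<subseteq> U <#>\<^bsub>W\<^esub> k ` ?C" using genle True by metis
    then show ?thesis unfolding set_mult_def by blast
  next
    case False
    then have "gen (insert k J) \<in> \<U>" unfolding \<U>_def using J k by blast
    moreover have "U \<subseteq> gen (insert k J)" unfolding J(2)
      by (rule genle) (use gensub[of "insert k J"] J k genincl[of _ "insert k J"] in auto)
    ultimately have "U = gen (insert k J)" by (rule max)
    then show ?thesis using genincl[of k "insert k J"] by auto
  qed
  have Kinv: "k ` U \<subseteq> U" if k: "k \<in> K" for k
  proof -
    have kR: "k \<in> carrier R" by (rule K_R[OF k])
    have "k ` gen J = generate W (k ` (\<Union>l\<in>J. l ` ?C))"
      unfolding gen_def using group_hom.generate_img[OF End_group_hom[OF kR], of "\<Union>l\<in>J. l ` ?C"] imgC J by blast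
    also have "\<dots> \<subseteq> U"
    proof (rule W.generate_subgroup_incl[OF _ Usub], clarify)
      fix l w assume l: "l \<in> J" and w: "w \<in> ?C"
      have lK: "l \<in> K" using l J by auto
      have "k (l w) = l (k w)" using K_comm[OF k lK] End_apply(1)[OF w] by metis
      also have "\<dots> \<in> U" using genincl[OF l] End_closed[OF kR w] J by auto
      finally show "k (l w) \<in> U" .
    qed
    finally show ?thesis using J by simp
  qed
  have xsub: "subgroup (x ` U) W" if "x \<in> X" for x using End_img_subgroup[OF X_R[OF that] Usub] .
  have UsC: "U \<subseteq> ?C" using subgroup.subset[OF Usub] .
  have inv_eval: "inv\<^bsub>XG\<^esub> x \<cdot> k \<cdot> x \<in> K" "w \<in> ?C \<Longrightarrow> k (x w) = x ((inv\<^bsub>XG\<^esub> x \<cdot> k \<cdot> x) w)"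
    if x: "x \<in> X" and k: "k \<in> K" for x k w
  proof -
    note xi = X_inv[OF x]
    have "inv\<^bsub>XG\<^esub> (inv\<^bsub>XG\<^esub> x) = x" using X.inv_inv[of x] x by simp
    then show "inv\<^bsub>XG\<^esub> x \<cdot> k \<cdot> x \<in> K" using K_conj[OF xi(1) k] by simp
    show "k (x w) = x ((inv\<^bsub>XG\<^esub> x \<cdot> k \<cdot> x) w)" if w: "w \<in> ?C"
    proof -
      have xw: "x w \<in> ?C" using End_closed[OF X_R[OF x] w] .
      have kxw: "k (x w) \<in> ?C" using End_closed[OF K_R[OF k] xw] .
      have "(inv\<^bsub>XG\<^esub> x \<cdot> k \<cdot> x) w = (inv\<^bsub>XG\<^esub> x) (k (x w))" using w xw by (simp add: End_apply)
      then show ?thesis using X_inv_apply(1)[OF x kxw] by simp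
    qed
  qed
  have xKinv: "k ` (x ` U) \<subseteq> x ` U" if x: "x \<in> X" and k: "k \<in> K" for x k
    using inv_eval[OF x k] Kinv[OF inv_eval(1)[OF x k]] UsC by (auto simp: subset_iff)
  have xprime: "k ` ?C \<subseteq> x ` U \<or> (\<forall>y\<in>?C. \<exists>a\<in>x ` U. \<exists>w\<in>?C. y = a \<otimes>\<^bsub>W\<^esub> k w)" if x: "x \<in> X" and k: "k \<in> K" for x k
  proof -
    define l where "l = inv\<^bsub>XG\<^esub> x \<cdot> k \<cdot> x"
    have lK: "l \<in> K" and lx: "\<And>w. w \<in> ?C \<Longrightarrow> k (x w) = x (l w)" using inv_eval[OF x k] by (auto simp: l_def)
    have kim: "k ` ?C = x ` (l ` ?C)"
    proof -
      have "k ` ?C = k ` (x ` ?C)" using X_image_carrier[OF x] by simp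
      also have "\<dots> = x ` (l ` ?C)" using lx by (auto simp: image_image)
      finally show ?thesis .
    qed
    from prime[OF lK] show ?thesis
    proof
      assume "l ` ?C \<subseteq> U"
      then show ?thesis using kim by auto
    next
      assume a: "\<forall>y\<in>?C. \<exists>a\<in>U. \<exists>w\<in>?C. y = a \<otimes>\<^bsub>W\<^esub> l w"
      have "\<exists>a\<in>x ` U. \<exists>w\<in>?C. y = a \<otimes>\<^bsub>W\<^esub> k w" if y: "y \<in> ?C" for y
      proof -
        obtain z where z: "z \<in> ?C" "y = x z" using X_image_carrier[OF x] y by (metis imageE)
        obtain b w where bw: "b \<in> U" "w \<in> ?C" "z = b \<otimes>\<^bsub>W\<^esub> l w" using a z by blast
        have "y = x b \<otimes>\<^bsub>W\<^esub> x (l w)"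
          unfolding z(2) bw(3) by (rule End_mult[OF X_R[OF x]]) (use bw UsC End_closed[OF K_R[OF lK]] in auto)
        then show ?thesis using bw(1) lx[OF bw(2)] End_closed[OF X_R[OF x] bw(2)]
          by (intro bexI[of _ "x b"] bexI[of _ "x w"]) auto
      qed
      then show ?thesis by blast
    qed
  qed
  have finC: "finite V" if "subgroup V W" for V using finW subgroup.subset[OF that] finite_subset by blast
  have cardx: "card (x ` U) = card U" if x: "x \<in> X" for x
  proof (rule card_image, rule inj_onI)
    fix a b assume "a \<in> U" "b \<in> U" "x a = x b"
    then show "a = b" using X_inv_apply(2)[OF x, of a] X_inv_apply(2)[OF x, of b] UsC by auto
  qed
  have xsep: "\<exists>k\<in>K. k ` ?C \<subseteq> x ` U \<and> \<not> k ` ?C \<subseteq> y ` U" if x: "x \<in> X" and y: "y \<in> X" and ne: "x ` U \<noteq> y ` U" for x y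
  proof (rule ccontr)
    assume "\<not> ?thesis"
    then have sub: "\<And>k. k \<in> K \<Longrightarrow> k ` ?C \<subseteq> x ` U \<Longrightarrow> k ` ?C \<subseteq> y ` U" by blast
    have xi: "inv\<^bsub>XG\<^esub> x \<in> X" using X_inv[OF x] by auto
    have "x ` U \<subseteq> y ` U"
    proof -
      have "U \<subseteq> (inv\<^bsub>XG\<^esub> x) ` (y ` U)"
        unfolding J(2)
      proof (rule genle)
        show "subgroup ((inv\<^bsub>XG\<^esub> x) ` y ` gen J) W" using End_img_subgroup[OF X_R[OF xi] xsub[OF y]] J(2) by simp
        fix l assume l: "l \<in> J"
        have lK: "l \<in> K" using l J by auto
        have "\<exists>k\<in>K. \<forall>w\<in>?C. k (x w) = x (l w)"
        proof -
          have "inv\<^bsub>XG\<^esub> (inv\<^bsub>XG\<^esub> x) = x" using X.inv_inv[of x] x by simp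
          then have "x \<cdot> l \<cdot> inv\<^bsub>XG\<^esub> x \<in> K" using K_conj[OF x lK] by simp
          moreover have "(x \<cdot> l \<cdot> inv\<^bsub>XG\<^esub> x) (x w) = x (l w)" if w: "w \<in> ?C" for w
            using w End_closed[OF X_R[OF x] w] End_closed[OF X_R[OF xi]] X_inv_apply(2)[OF x w] by (simp add: End_apply)
          ultimately show ?thesis by blast
        qed
        then obtain k where k: "k \<in> K" "\<And>w. w \<in> ?C \<Longrightarrow> k (x w) = x (l w)" by blast
        have kim: "k ` ?C = x ` (l ` ?C)"
        proof -
          have "k ` ?C = k ` (x ` ?C)" using X_image_carrier[OF x] by simp
          also have "\<dots> = x ` (l ` ?C)" using k by (auto simp: image_image)
          finally show ?thesis .
        qed
        have "l ` ?C \<subseteq> U" using genincl[OF l] J by simp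
        then have "x ` (l ` ?C) \<subseteq> y ` U" using sub[OF k(1)] kim by auto
        then have "(inv\<^bsub>XG\<^esub> x) ` (x ` (l ` ?C)) \<subseteq> (inv\<^bsub>XG\<^esub> x) ` (y ` U)" by (rule image_mono)
        moreover have "(inv\<^bsub>XG\<^esub> x) ` (x ` (l ` ?C)) = l ` ?C"
        proof -
          have "(inv\<^bsub>XG\<^esub> x) (x (l w)) = l w" if "w \<in> ?C" for w using X_inv_apply(2)[OF x] imgC[OF lK] that by auto
          then show ?thesis by (simp add: image_image cong: image_cong)
        qed
        ultimately show "l ` ?C \<subseteq> (inv\<^bsub>XG\<^esub> x) ` y ` gen J" using J(2) by simp
      qed
      then have "x ` U \<subseteq> x ` ((inv\<^bsub>XG\<^esub> x) ` (y ` U))" by (rule image_mono)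
      also have "\<dots> \<subseteq> y ` U"
      proof
        fix a assume "a \<in> x ` ((inv\<^bsub>XG\<^esub> x) ` (y ` U))"
        then obtain b where "b \<in> y ` U" "a = x ((inv\<^bsub>XG\<^esub> x) b)" by auto
        then show "a \<in> y ` U" using X_inv_apply(1)[OF x, of b] subgroup.subset[OF xsub[OF y]] by auto
      qed
      finally show ?thesis .
    qed
    then have "x ` U = y ` U" using card_subset_eq[OF finC[OF xsub[OF y]]] cardx x y by simp
    then show False using ne by simp
  qed
  define \<O> where "\<O> = (\<lambda>x. x ` U) ` X"
  have finO: "finite \<O>" using X.fin by (simp add: \<O>_def)
  have Osub: "subgroup V W" if "V \<in> \<O>" for V using that xsub by (auto simp: \<O>_def)
  have OK: "\<And>k. k \<in> K \<Longrightarrow> k ` V \<subseteq> V" if "V \<in> \<O>" for V using that xKinv unfolding \<O>_def by blast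
  have Ocard: "card V = card U" if "V \<in> \<O>" for V using that cardx by (auto simp: \<O>_def)
  have Oprime: "k ` ?C \<subseteq> V \<or> (\<forall>y\<in>?C. \<exists>a\<in>V. \<exists>w\<in>?C. y = a \<otimes>\<^bsub>W\<^esub> k w)" if V: "V \<in> \<O>" and k: "k \<in> K" for V k
  proof -
    obtain x where x: "x \<in> X" "V = x ` U" using V by (auto simp: \<O>_def)
    show ?thesis unfolding x(2) by (rule xprime[OF x(1) k])
  qed
  have Osep: "\<exists>k\<in>K. k ` ?C \<subseteq> Y \<and> \<not> k ` ?C \<subseteq> V" if "Y \<in> \<O>" "V \<in> \<O>" "Y \<noteq> V" for V Y
    using that xsep unfolding \<O>_def by blast
  \<comment> \<open>Comaximality of one conjugate with the product of the others: an element of \<open>K\<close> that maps \<open>W\<close> into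
    all members of \<open>\<J>\<close>, but not into \<open>V\<close>, is a product of elements doing this for one member each.\<close>
  have sepall: "\<exists>k\<in>K. k ` ?C \<subseteq> ?C \<inter> \<Inter>\<J> \<and> \<not> k ` ?C \<subseteq> V"
    if V: "V \<in> \<O>" "V \<noteq> ?C" and "finite \<J>" "\<J> \<subseteq> \<O> - {V}" for \<J> V
    using that(3,4)
  proof (induction \<J> rule: finite_induct)
    case empty
    have "(\<one>\<^bsub>R\<^esub>) ` ?C = ?C" using End_apply(3)[of _ W] by force
    then show ?case using K_neg_add(4) V subgroup.subset[OF Osub[OF V(1)]] by (intro bexI[of _ "\<one>\<^bsub>R\<^esub>"]) auto
  next
    case (insert Y \<J>)
    then obtain k where k: "k \<in> K" "k ` ?C \<subseteq> ?C \<inter> \<Inter>\<J>" "\<not> k ` ?C \<subseteq> V" by auto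
    obtain l where l: "l \<in> K" "l ` ?C \<subseteq> Y" "\<not> l ` ?C \<subseteq> V" using Osep[of Y V] insert.prems V by auto
    have kl: "(k \<cdot> l) w = k (l w)" "(k \<cdot> l) w = l (k w)" if "w \<in> ?C" for w
      using End_apply(1)[OF that] K_comm[OF k(1) l(1)] by metis+
    have "(k \<cdot> l) ` ?C \<subseteq> ?C \<inter> \<Inter>(insert Y \<J>)"
    proof (intro image_subsetI)
      fix w assume w: "w \<in> ?C"
      have "l w \<in> ?C" "k w \<in> ?C" using imgC k l w by auto
      then have "k (l w) \<in> ?C \<inter> \<Inter>\<J>" "l (k w) \<in> Y" using k l by auto
      then show "(k \<cdot> l) w \<in> ?C \<inter> \<Inter>(insert Y \<J>)" using kl[OF w] by auto
    qed
    moreover have "\<not> (k \<cdot> l) ` ?C \<subseteq> V"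
    proof
      assume s: "(k \<cdot> l) ` ?C \<subseteq> V"
      have "k y \<in> V" if y: "y \<in> ?C" for y
      proof -
        obtain a w where aw: "a \<in> V" "w \<in> ?C" "y = a \<otimes>\<^bsub>W\<^esub> l w" using Oprime[OF V(1) l(1)] l(3) y by blast
        have "k y = k a \<otimes>\<^bsub>W\<^esub> k (l w)"
          unfolding aw(3) by (rule End_mult[OF K_R[OF k(1)]]) (use aw subgroup.subset[OF Osub[OF V(1)]] imgC[OF l(1)] in auto)
        moreover have "k a \<in> V" using OK[OF V(1) k(1)] aw by auto
        moreover have "k (l w) \<in> V" using s kl(1)[OF aw(2)] aw(2) by force
        ultimately show ?thesis using subgroup.m_closed[OF Osub[OF V(1)]] by simp
      qed
      then show False using k(3) by auto
    qed
    ultimately show ?case using K_neg_add(3)[OF k(1) l(1)] by blast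
  qed
  have OneC: "V \<noteq> ?C" if "V \<in> \<O>" for V
  proof
    assume "V = ?C"
    then have "card U = card ?C" using Ocard[OF that] by simp
    then show False using card_subset_eq[OF finW UsC] UC by simp
  qed
  have count: "subgroup (?C \<inter> \<Inter>\<J>) W \<and> card ?C ^ card \<J> * card (?C \<inter> \<Inter>\<J>) \<le> card ?C * card U ^ card \<J>"
    if "finite \<J>" "\<J> \<subseteq> \<O>" for \<J>
    using that
  proof (induction \<J> rule: finite_induct)
    case empty
    then show ?case by (simp add: W.subgroup_self)
  next
    case (insert V \<J>)
    have V: "V \<in> \<O>" and IH: "subgroup (?C \<inter> \<Inter>\<J>) W" "card ?C ^ card \<J> * card (?C \<inter> \<Inter>\<J>) \<le> card ?C * card U ^ card \<J>"
      using insert by auto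
    let ?Y = "?C \<inter> \<Inter>\<J>"
    have eq: "?C \<inter> \<Inter>(insert V \<J>) = ?Y \<inter> V" by auto
    have VY: "\<J> \<subseteq> \<O> - {V}" using insert by auto
    obtain k where k: "k \<in> K" "k ` ?C \<subseteq> ?Y" "\<not> k ` ?C \<subseteq> V" using sepall[OF V OneC[OF V] insert.hyps(1) VY] by blast
    have dec: "\<exists>h\<in>?Y. \<exists>v\<in>V. w = h \<otimes>\<^bsub>W\<^esub> v" if w: "w \<in> ?C" for w
    proof -
      obtain a u where au: "a \<in> V" "u \<in> ?C" "w = a \<otimes>\<^bsub>W\<^esub> k u" using Oprime[OF V k(1)] k(3) w by blast
      have "k u \<in> ?Y" using k au by auto
      moreover have "w = k u \<otimes>\<^bsub>W\<^esub> a" using au \<open>k u \<in> ?Y\<close> subgroup.subset[OF Osub[OF V]] by (simp add: W.m_comm subset_iff)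
      ultimately show ?thesis using au(1) by blast
    qed
    have "card ?C * card (?Y \<inter> V) \<le> card ?Y * card U"
      using W.card_Int_le[OF finW IH(1) Osub[OF V] dec] Ocard[OF V] by simp
    then have "card ?C ^ card \<J> * (card ?C * card (?Y \<inter> V)) \<le> (card ?C ^ card \<J> * card ?Y) * card U"
      by (simp add: mult.assoc)
    also have "\<dots> \<le> card ?C * card U ^ card \<J> * card U" using IH(2) by (rule mult_right_mono) simp
    finally have "card ?C ^ Suc (card \<J>) * card (?Y \<inter> V) \<le> card ?C * card U ^ Suc (card \<J>)"
      by (simp add: mult_ac)
    moreover have "subgroup (?Y \<inter> V) W" using W.subgroups_Inter_pair[OF IH(1) Osub[OF V]] by simp
    ultimately show ?case unfolding eq using insert.hyps by simp
  qed
  define S where "S = {x \<in> X. x ` U = U}"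
  have comp: "(x \<cdot> y) ` U = x ` (y ` U)" for x y
    unfolding image_image by (rule image_cong[OF refl]) (use UsC in \<open>auto simp: End_apply\<close>)
  have one_img: "\<one>\<^bsub>R\<^esub> ` U = U"
  proof -
    have "\<one>\<^bsub>R\<^esub> ` U = (\<lambda>u. u) ` U" by (rule image_cong[OF refl]) (use UsC in \<open>auto simp: End_apply\<close>)
    then show ?thesis by simp
  qed
  have Ssub: "subgroup S XG"
  proof (rule X.subgroupI)
    show "S \<noteq> {}" using one_img X.one_closed by (auto simp: S_def)
    show "inv\<^bsub>XG\<^esub> x \<in> S" if "x \<in> S" for x
    proof -
      have x: "x \<in> X" "x ` U = U" using that by (auto simp: S_def)
      have "(inv\<^bsub>XG\<^esub> x) ` U = (inv\<^bsub>XG\<^esub> x) ` (x ` U)" using x by simp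
      also have "\<dots> = U" using comp[symmetric] X_inv(3)[OF x(1)] one_img by simp
      finally show ?thesis using X_inv(1)[OF x(1)] by (simp add: S_def)
    qed
    show "x \<otimes>\<^bsub>XG\<^esub> y \<in> S" if "x \<in> S" "y \<in> S" for x y
      using that X.m_closed[of x y] comp by (simp add: S_def)
  qed (auto simp: S_def)
  obtain t where t: "card X = t * card S" using X.subgroup_card_dvd[OF Ssub] by auto
  obtain c where c: "card ?C = c * card U" using W.subgroup_card_dvd[OF Usub] by auto
  have finS: "finite S" using X.fin by (simp add: S_def)
  have Spos: "card S > 0" using finS subgroup.one_closed[OF Ssub] by (auto simp: card_gt_0_iff)
  have "card X \<le> card \<O> * card S"
  proof -
    have fiber: "card {x \<in> X. x ` U = V} \<le> card S" for V
    proof (cases "{x \<in> X. x ` U = V} = {}")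
      case False
      then obtain y where y: "y \<in> X" "y ` U = V" by auto
      have "inj_on (\<lambda>x. inv\<^bsub>XG\<^esub> y \<cdot> x) X"
        using X.inj_on_cmult[of "inv\<^bsub>XG\<^esub> y"] X_inv(1)[OF y(1)] by simp
      then have "inj_on (\<lambda>x. inv\<^bsub>XG\<^esub> y \<cdot> x) {x \<in> X. x ` U = V}" by (rule inj_on_subset) auto
      moreover have "(\<lambda>x. inv\<^bsub>XG\<^esub> y \<cdot> x) ` {x \<in> X. x ` U = V} \<subseteq> S"
      proof clarify
        fix x assume x: "x \<in> X" "V = x ` U"
        have "(inv\<^bsub>XG\<^esub> y \<cdot> x) ` U = (inv\<^bsub>XG\<^esub> y) ` (y ` U)" using comp x y by simp
        also have "\<dots> = U" using comp[symmetric] X_inv(3)[OF y(1)] one_img by simp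
        finally show "inv\<^bsub>XG\<^esub> y \<cdot> x \<in> S" using X.m_closed[of "inv\<^bsub>XG\<^esub> y" x] X_inv(1)[OF y(1)] x by (simp add: S_def)
      qed
      ultimately show ?thesis using finS card_inj_on_le by blast
    next
      case True
      then show ?thesis by (metis card.empty le0)
    qed
    have "X = (\<Union>V\<in>\<O>. {x \<in> X. x ` U = V})" by (auto simp: \<O>_def)
    then have "card X = card (\<Union>V\<in>\<O>. {x \<in> X. x ` U = V})" by (rule arg_cong)
    also have "\<dots> \<le> (\<Sum>V\<in>\<O>. card {x \<in> X. x ` U = V})" by (rule card_UN_le[OF finO])
    also have "\<dots> \<le> (\<Sum>V\<in>\<O>. card S)" by (rule sum_mono) (rule fiber)
    finally show ?thesis by simp
  qed
  then have tO: "t \<le> card \<O>" unfolding t using Spos by simp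
  have Cpos: "card ?C > 0" using finW W.one_closed by (auto simp: card_gt_0_iff)
  have Upos: "card U > 0" and cpos: "c > 0" using c Cpos by (auto intro: Nat.gr0I)
  have "c ^ t \<le> c ^ card \<O>" using tO cpos by (intro power_increasing) auto
  also have "c ^ card \<O> \<le> card ?C"
  proof -
    have "subgroup (?C \<inter> \<Inter>\<O>) W" "card ?C ^ card \<O> * card (?C \<inter> \<Inter>\<O>) \<le> card ?C * card U ^ card \<O>"
      using count[OF finO] by auto
    moreover have "card (?C \<inter> \<Inter>\<O>) \<ge> 1"
      using finC[OF \<open>subgroup (?C \<inter> \<Inter>\<O>) W\<close>] subgroup.one_closed[OF \<open>subgroup (?C \<inter> \<Inter>\<O>) W\<close>]
      by (metis One_nat_def Suc_leI card_gt_0_iff empty_iff)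
    ultimately have "card ?C ^ card \<O> \<le> card ?C * card U ^ card \<O>"
      using mult_le_mono2[of 1 "card (?C \<inter> \<Inter>\<O>)" "card ?C ^ card \<O>"] by linarith
    then have "c ^ card \<O> * card U ^ card \<O> \<le> card ?C * card U ^ card \<O>"
      using arg_cong[OF c, of "\<lambda>n. n ^ card \<O>"] by (simp only: power_mult_distrib)
    then show ?thesis using Upos by simp
  qed
  finally have "c ^ t \<le> card ?C" .
  then show ?thesis using Usub U1 UC Ssub t c unfolding S_def by blast
qed

text \<open>
  A proper invariant subgroup gives the first alternative with \<open>S = X\<close> and \<open>t = 1\<close>.
\<close>

lemma reduction_or_semilinear:
  assumes nontrivial: "carrier W \<noteq> {\<one>\<^bsub>W\<^esub>}"
  shows "(\<exists>U S t c. subgroup U W \<and> U \<noteq> {\<one>\<^bsub>W\<^esub>} \<and> U \<noteq> carrier W \<and> subgroup S XG \<and> (\<forall>s\<in>S. s ` U \<subseteq> U) \<and>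
     card X = t * card S \<and> card (carrier W) = c * card U \<and> c ^ t \<le> card (carrier W)) \<or>
    semilinear W X (\<lambda>x. x)"
proof (cases "\<forall>U. invariant U \<longrightarrow> U = {\<one>\<^bsub>W\<^esub>} \<or> U = carrier W")
  case irr: True
  show ?thesis
  proof (cases "\<exists>k\<in>K. k \<noteq> \<zero>\<^bsub>R\<^esub> \<and> k ` carrier W \<noteq> carrier W")
    case True
    then show ?thesis using bicommutant_reduction by blast
  next
    case False
    then interpret linear_tower_field W X p Q
      by unfold_locales (use nontrivial irr in auto)
    show ?thesis using field_case_semilinear by blast
  qed
next
  case False
  then obtain U where U: "subgroup U W" "\<forall>x\<in>X. x ` U \<subseteq> U" "U \<noteq> {\<one>\<^bsub>W\<^esub>}" "U \<noteq> carrier W" by (auto simp: invariant_def)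
  obtain c where c: "card (carrier W) = c * card U" using W.subgroup_card_dvd[OF U(1)] by auto
  have "card U > 0" using subgroup.one_closed[OF U(1)] finite_subset[OF subgroup.subset[OF U(1)] finW] by (auto simp: card_gt_0_iff)
  then have "c ^ 1 \<le> card (carrier W)" using c by simp
  moreover have "subgroup X XG" using X.subgroup_self by simp
  moreover have "card X = 1 * card X" by simp
  ultimately show ?thesis using U c by blast
qed

end

lemma (in group_hom) card_preimage:
  assumes fin: "finite (carrier G)" and S: "S \<subseteq> h ` carrier G"
  shows "card {g \<in> carrier G. h g \<in> S} = card S * card (kernel G H h)"
proof -
  have finS: "finite S" using S fin finite_subset by blast
  have fib: "card {g \<in> carrier G. h g = y} = card (kernel G H h)" if y: "y \<in> S" for y
  proof -
    obtain x where x: "x \<in> carrier G" "y = h x" using S y by blast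
    have "bij_betw (\<lambda>k. x \<otimes> k) (kernel G H h) {g \<in> carrier G. h g = y}"
      by (rule bij_betw_byWitness[where f' = "\<lambda>g. inv x \<otimes> g"])
         (use x in \<open>auto simp: kernel_def m_assoc[symmetric]\<close>)
    then show ?thesis by (simp add: bij_betw_same_card)
  qed
  have "{g \<in> carrier G. h g \<in> S} = (\<Union>y\<in>S. {g \<in> carrier G. h g = y})" by auto
  then have "card {g \<in> carrier G. h g \<in> S} = card (\<Union>y\<in>S. {g \<in> carrier G. h g = y})" by simp
  also have "\<dots> = (\<Sum>y\<in>S. card {g \<in> carrier G. h g = y})"
    by (rule card_UN_disjoint) (use finS fin in auto)
  also have "\<dots> = card S * card (kernel G H h)" using fib by simp
  finally show ?thesis .
qed

lemma semilinearI:
  assumes "\<zeta> \<in> carrier (End W)" "v \<in> carrier W"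
    "carrier W = insert \<one>\<^bsub>W\<^esub> (range (\<lambda>i::nat. (\<zeta> [^]\<^bsub>End W\<^esub> i) v))"
    "\<And>g. g \<in> S \<Longrightarrow> \<exists>\<rho> u. \<forall>i::nat. act g ((\<zeta> [^]\<^bsub>End W\<^esub> i) v) = (\<zeta> [^]\<^bsub>End W\<^esub> (\<rho> * i + u)) v"
  shows "semilinear W S act"
  unfolding semilinear_def
  by (rule bexI[OF _ assms(1)], rule bexI[OF _ assms(2)], rule conjI[OF assms(3)], rule ballI, rule assms(4))

text \<open>
  The same for an action that may have a kernel: a quotient of a prime tower is a prime tower, and
  indices of subgroups do not change on passing to preimages.
\<close>

lemma reduction_or_semilinear_action:
  fixes M :: "('m, 'a) monoid_scheme" and W :: "('w, 'b) monoid_scheme"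
  assumes M: "prime_tower_group M p Q" and W: "comm_group W" and finW: "finite (carrier W)"
    and nontrivial: "carrier W \<noteq> {\<one>\<^bsub>W\<^esub>}"
    and act: "\<And>g. g \<in> carrier M \<Longrightarrow> act g \<in> hom W W"
      "\<And>g h w. g \<in> carrier M \<Longrightarrow> h \<in> carrier M \<Longrightarrow> w \<in> carrier W \<Longrightarrow> act (g \<otimes>\<^bsub>M\<^esub> h) w = act g (act h w)"
      "\<And>w. w \<in> carrier W \<Longrightarrow> act \<one>\<^bsub>M\<^esub> w = w"
  shows "(\<exists>U S t c. subgroup U W \<and> U \<noteq> {\<one>\<^bsub>W\<^esub>} \<and> U \<noteq> carrier W \<and> subgroup S M \<and> (\<forall>s\<in>S. act s ` U \<subseteq> U) \<and>
     card (carrier M) = t * card S \<and> card (carrier W) = c * card U \<and> c ^ t \<le> card (carrier W)) \<or>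
    semilinear W (carrier M) act"
proof -
  interpret M: prime_tower_group M p Q by fact
  interpret W: comm_group W by fact
  interpret R: ring "End W" by (rule W.End_ring)
  define ext where "ext g = restrict (act g) (carrier W)" for g
  have extR: "ext g \<in> carrier (End W)" if "g \<in> carrier M" for g
    using act(1)[OF that] by (auto simp: End_mem ext_def hom_def)
  have actc: "act g w \<in> carrier W" if "g \<in> carrier M" "w \<in> carrier W" for g w
    using act(1)[OF that(1)] that(2) by (auto simp: hom_def)
  have extm: "ext (g \<otimes>\<^bsub>M\<^esub> h) = ext g \<otimes>\<^bsub>End W\<^esub> ext h" if "g \<in> carrier M" "h \<in> carrier M" for g h
    by (rule End_eqI[where W = W]) (use that extR act(2) actc in \<open>auto simp: End_apply ext_def\<close>)
  have ext1: "ext \<one>\<^bsub>M\<^esub> = \<one>\<^bsub>End W\<^esub>"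
    by (rule End_eqI[where W = W]) (use extR act(3) in \<open>auto simp: End_apply ext_def\<close>)
  have extU: "ext g \<in> Units (End W)" if g: "g \<in> carrier M" for g
    using extR[OF g] extR[of "inv\<^bsub>M\<^esub> g"] g extm[of g "inv\<^bsub>M\<^esub> g"] extm[of "inv\<^bsub>M\<^esub> g" g] ext1
    by (auto simp: Units_def intro!: bexI[of _ "ext (inv\<^bsub>M\<^esub> g)"])
  interpret U: group "units_of (End W)" by (rule R.units_group)
  interpret e: group_hom M "units_of (End W)" ext
    by unfold_locales (use extU extm in \<open>auto simp: hom_def units_of_def\<close>)
  define X where "X = ext ` carrier M"
  let ?XG = "\<lparr>carrier = X, monoid.mult = monoid.mult (End W), one = \<one>\<^bsub>End W\<^esub>\<rparr>"
  have XG: "?XG = (units_of (End W))\<lparr>carrier := X\<rparr>" by (simp add: units_of_def)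
  have "group ?XG" unfolding XG
    using subgroup.subgroup_is_group[OF e.img_is_subgroup U.is_group] by (simp add: X_def)
  then interpret eX: group_hom M ?XG ext
    by (intro group_hom.intro group_hom_axioms.intro M.is_group) (use extm in \<open>auto simp: hom_def X_def\<close>)
  have "prime_tower_group ?XG p (\<lambda>i. ext ` Q i)"
    by (rule M.prime_tower_group_image[OF eX.group_hom_axioms]) (simp add: X_def)
  then interpret linear_tower W X p "\<lambda>i. ext ` Q i"
    by (intro linear_tower.intro linear_tower_axioms.intro W finW) (use extR in \<open>auto simp: X_def\<close>)
  have ext_eval: "ext g w = act g w" if "w \<in> carrier W" for g w using that by (simp add: ext_def)
  from reduction_or_semilinear[OF nontrivial] show ?thesis
  proof
    assume "semilinear W X (\<lambda>x. x)"
    then obtain \<zeta> v where z: "\<zeta> \<in> carrier R" and v: "v \<in> carrier W"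
      and gen: "carrier W = insert \<one>\<^bsub>W\<^esub> (range (\<lambda>i::nat. (\<zeta> [^]\<^bsub>R\<^esub> i) v))"
      and X: "\<forall>x\<in>X. \<exists>\<rho> u. \<forall>i::nat. x ((\<zeta> [^]\<^bsub>R\<^esub> i) v) = (\<zeta> [^]\<^bsub>R\<^esub> (\<rho> * i + u)) v"
      unfolding semilinear_def by blast
    have zv: "(\<zeta> [^]\<^bsub>R\<^esub> (i::nat)) v \<in> carrier W" for i using z v by (simp add: End_closed)
    have act_v: "\<exists>\<rho> u. \<forall>i::nat. act g ((\<zeta> [^]\<^bsub>R\<^esub> i) v) = (\<zeta> [^]\<^bsub>R\<^esub> (\<rho> * i + u)) v" if "g \<in> carrier M" for g
    proof -
      have "ext g \<in> X" using that by (simp add: X_def)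
      then show ?thesis using X ext_eval[OF zv] by metis
    qed
    have "semilinear W (carrier M) act" by (rule semilinearI[OF z v gen act_v])
    then show ?thesis by (rule disjI2)
  next
    assume "\<exists>U S t c. subgroup U W \<and> U \<noteq> {\<one>\<^bsub>W\<^esub>} \<and> U \<noteq> carrier W \<and> subgroup S XG \<and> (\<forall>s\<in>S. s ` U \<subseteq> U) \<and>
     card X = t * card S \<and> card (carrier W) = c * card U \<and> c ^ t \<le> card (carrier W)"
    then obtain U S t c where *: "subgroup U W" "U \<noteq> {\<one>\<^bsub>W\<^esub>}" "U \<noteq> carrier W" "subgroup S XG" "\<forall>s\<in>S. s ` U \<subseteq> U"
     "card X = t * card S" "card (carrier W) = c * card U" "c ^ t \<le> card (carrier W)"
      by - (elim exE conjE, rule that)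
    define S' where "S' = {g \<in> carrier M. ext g \<in> S}"
    have SX: "S \<subseteq> X" using subgroup.subset[OF *(4)] by simp
    have S': "subgroup S' M"
    proof (rule M.subgroupI)
      show "S' \<noteq> {}" using ext1 subgroup.one_closed[OF *(4)] by (auto simp: S'_def)
      show "inv\<^bsub>M\<^esub> g \<in> S'" if "g \<in> S'" for g
        using that subgroup.m_inv_closed[OF *(4), of "ext g"] eX.hom_inv[of g] by (simp add: S'_def)
      show "g \<otimes>\<^bsub>M\<^esub> h \<in> S'" if "g \<in> S'" "h \<in> S'" for g h
        using that subgroup.m_closed[OF *(4), of "ext g" "ext h"] extm by (simp add: S'_def)
    qed (auto simp: S'_def)
    have "card (carrier M) = card X * card (kernel M XG ext)"
      using eX.card_preimage[OF M.fin, of X] by (simp add: X_def Collect_conj_eq cong: conj_cong)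
    moreover have "card S' = card S * card (kernel M XG ext)"
      unfolding S'_def using eX.card_preimage[OF M.fin, of S] SX by (simp add: X_def)
    ultimately have cardM: "card (carrier M) = t * card S'" using *(6) by simp
    have actU: "act s ` U \<subseteq> U" if s: "s \<in> S'" for s
    proof -
      have "ext s \<in> S" using s by (simp add: S'_def)
      then have "ext s ` U \<subseteq> U" using *(5) by blast
      then show ?thesis using ext_eval subgroup.subset[OF *(1)] by (auto simp: subset_iff)
    qed
    show ?thesis
      by (rule disjI1, rule exI[of _ U], rule exI[of _ S'], rule exI[of _ t], rule exI[of _ c])
         (use *(1-3,7,8) S' cardM actU in simp)
  qed
qed

section \<open>Descent to a semilinear line\<close>

context prime_tower_group begin

text \<open>
  Apply the reduction to \<open>A / U\<close> and repeat it with the smaller group and the larger subgroup of \<open>A\<close>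
  that it provides. The bound survives: if the first step gives indices \<open>t1\<close> and \<open>c1\<close> with
  \<open>c1 ^ t1\<close> at most the order of \<open>A / U\<close>, and the later steps give \<open>c2 ^ t2 \<le> c1\<close>, then
  \<open>c2 ^ (t1 * t2)\<close> is at most the order of \<open>A / U\<close>. This is why the claim is relative to \<open>U\<close>.
\<close>

lemma semilinear_descent:
  assumes A: "subgroup A G" and comm: "\<And>a b. a \<in> A \<Longrightarrow> b \<in> A \<Longrightarrow> a \<otimes> b = b \<otimes> a"
    and M: "subgroup M G" and MA: "\<And>m a. m \<in> M \<Longrightarrow> a \<in> A \<Longrightarrow> m \<otimes> a \<otimes> inv m \<in> A"
    and "subgroup S G" "S \<subseteq> M" "subgroup U G" "U \<subseteq> A" "U \<noteq> A"
    and "\<And>s u. s \<in> S \<Longrightarrow> u \<in> U \<Longrightarrow> s \<otimes> u \<otimes> inv s \<in> U"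
  shows "\<exists>S' U' t c. subgroup S' G \<and> S' \<subseteq> S \<and> subgroup U' G \<and> U' \<subseteq> A \<and> U' \<noteq> A \<and>
     (\<forall>s\<in>S'. \<forall>u\<in>U'. s \<otimes> u \<otimes> inv s \<in> U') \<and> card S = t * card S' \<and> card A = c * card U' \<and>
     c ^ t * card U \<le> card A \<and>
     semilinear (G\<lparr>carrier := A\<rparr> Mod U') S' (\<lambda>s C. (\<lambda>a. s \<otimes> a \<otimes> inv s) ` C)"
  using assms(5-10)
proof (induction "card A - card U" arbitrary: S U rule: less_induct)
  case less
  note S = less.prems(1,2) and U = less.prems(3-5) and inv = less.prems(6)
  interpret A: subgroup A G by fact
  interpret U: subgroup U G by fact
  interpret S: subgroup S G by fact
  let ?A = "G\<lparr>carrier := A\<rparr>"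
  interpret CA: comm_group ?A
    using A.subgroup_is_group[OF is_group] comm by (intro group.group_comm_groupI) auto
  have UA: "subgroup U ?A" using subgroup_incl[OF U.subgroup_axioms A U(2)] .
  define W where "W = ?A Mod U"
  interpret UN: normal U ?A using CA.subgroup_imp_normal[OF UA] .
  interpret W: comm_group W unfolding W_def by (rule CA.abelian_FactGroup[OF UA])
  define q where "q a = U #> a" for a
  have Wc: "carrier W = q ` A" by (simp add: W_def carrier_FactGroup q_def[abs_def])
  interpret q: group_hom ?A W q
  proof unfold_locales
    show "q \<in> hom ?A W" using UN.r_coset_hom_Mod by (simp add: W_def q_def[abs_def])
  qed
  have finA: "finite A" using fin A.subset finite_subset by blast
  have finW: "finite (carrier W)" using Wc finA by simp
  have one: "\<one>\<^bsub>W\<^esub> = U" by (simp add: W_def)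
  have ker: "kernel ?A W q = U"
  proof
    show "kernel ?A W q \<subseteq> U" using rcos_self[OF _ U.subgroup_axioms] A.subset by (auto simp: kernel_def one q_def)
    show "U \<subseteq> kernel ?A W q" using U(2) U.rcos_const[OF is_group] by (auto simp: kernel_def one q_def)
  qed
  have cardW: "card A = card (carrier W) * card U"
    using q.card_preimage[of "carrier W"] finA ker by (simp add: Wc Collect_conj_eq cong: conj_cong)
  have nontrivial: "carrier W \<noteq> {\<one>\<^bsub>W\<^esub>}"
  proof
    assume "carrier W = {\<one>\<^bsub>W\<^esub>}"
    then have "A \<subseteq> kernel ?A W q" using q.hom_closed by (auto simp: kernel_def)
    then show False using ker U by auto
  qed
  define cj where "cj s a = s \<otimes> a \<otimes> inv s" for s a
  define act where "act s C = cj s ` C" for s C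
  have cjA: "cj s a \<in> A" if "s \<in> S" "a \<in> A" for s a using MA that S by (auto simp: cj_def)
  have cjm: "cj s (a \<otimes> b) = cj s a \<otimes> cj s b" if "s \<in> carrier G" "a \<in> carrier G" "b \<in> carrier G" for s a b
    using that by (simp add: cj_def m_assoc)
  have cjc: "cj (s \<otimes> r) a = cj s (cj r a)" if "s \<in> carrier G" "r \<in> carrier G" "a \<in> carrier G" for s r a
    using that by (simp add: cj_def m_assoc inv_mult_group)
  have cjU: "cj s ` U = U" if s: "s \<in> S" for s
  proof
    show "cj s ` U \<subseteq> U" using inv s by (auto simp: cj_def)
    show "U \<subseteq> cj s ` U"
    proof
      fix u assume u: "u \<in> U"
      have "cj (inv s) u \<in> U" using inv[of "inv s" u] u s by (simp add: cj_def)
      moreover have "cj s (cj (inv s) u) = u" using s u by (simp add: cj_def m_assoc)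
      ultimately show "u \<in> cj s ` U" by (metis imageI)
    qed
  qed
  have actq: "act s (q a) = q (cj s a)" if s: "s \<in> S" and a: "a \<in> A" for s a
  proof -
    have "act s (q a) = (\<lambda>u. cj s (u \<otimes> a)) ` U"
      by (auto simp: act_def q_def r_coset_def)
    also have "\<dots> = (\<lambda>u. cj s u \<otimes> cj s a) ` U"
      by (rule image_cong[OF refl]) (use s a in \<open>simp add: cjm\<close>)
    also have "\<dots> = (\<lambda>u. u \<otimes> cj s a) ` (cj s ` U)" by (simp add: image_image)
    also have "\<dots> = q (cj s a)" by (auto simp: cjU[OF s] q_def r_coset_def)
    finally show ?thesis .
  qed
  have tS: "prime_tower_group (G\<lparr>carrier := S\<rparr>) p (\<lambda>i. S \<inter> Q i)" by (rule prime_tower_group_subgroup[OF S(1)])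
  have act_hom: "act s \<in> hom W W" if s: "s \<in> carrier (G\<lparr>carrier := S\<rparr>)" for s
  proof (rule homI)
    have s: "s \<in> S" using s by simp
    show "act s C \<in> carrier W" if "C \<in> carrier W" for C using that actq[OF s] cjA[OF s] by (auto simp: Wc)
    fix C D assume "C \<in> carrier W" "D \<in> carrier W"
    then obtain a b where ab: "a \<in> A" "b \<in> A" "C = q a" "D = q b" by (auto simp: Wc)
    have "C \<otimes>\<^bsub>W\<^esub> D = q (a \<otimes> b)" using q.hom_mult[of a b] ab by simp
    then have "act s (C \<otimes>\<^bsub>W\<^esub> D) = q (cj s a \<otimes> cj s b)" using actq[OF s, of "a \<otimes> b"] cjm[of s a b] ab s by simp
    also have "\<dots> = act s C \<otimes>\<^bsub>W\<^esub> act s D" using q.hom_mult[of "cj s a" "cj s b"] ab cjA[OF s] actq[OF s] by simp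
    finally show "act s (C \<otimes>\<^bsub>W\<^esub> D) = act s C \<otimes>\<^bsub>W\<^esub> act s D" .
  qed
  have act_mult: "act (s \<otimes>\<^bsub>G\<lparr>carrier := S\<rparr>\<^esub> r) C = act s (act r C)"
    if s: "s \<in> carrier (G\<lparr>carrier := S\<rparr>)" and r: "r \<in> carrier (G\<lparr>carrier := S\<rparr>)" and C: "C \<in> carrier W" for s r C
  proof -
    obtain a where a: "a \<in> A" "C = q a" using C by (auto simp: Wc)
    show ?thesis using actq[of "s \<otimes> r" a] actq[of s "cj r a"] actq[of r a] cjA[of r a] cjc[of s r a] a s r by simp
  qed
  have act_one: "act \<one>\<^bsub>G\<lparr>carrier := S\<rparr>\<^esub> C = C" if C: "C \<in> carrier W" for C
  proof -
    obtain a where a: "a \<in> A" "C = q a" using C by (auto simp: Wc)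
    then show ?thesis using actq[of \<one> a] by (simp add: cj_def)
  qed
  from reduction_or_semilinear_action[OF tS W.comm_group_axioms finW nontrivial act_hom act_mult act_one]
  show ?case
  proof
    assume "semilinear W (carrier (G\<lparr>carrier := S\<rparr>)) act"
    then have "semilinear (?A Mod U) S (\<lambda>s C. (\<lambda>a. s \<otimes> a \<otimes> inv s) ` C)"
      by (simp add: W_def act_def[abs_def] cj_def[abs_def])
    moreover have "card S = 1 * card S" by simp
    ultimately show ?thesis using S(1) U inv U.subgroup_axioms cardW
      by (intro exI[of _ S] exI[of _ U] exI[of _ 1] exI[of _ "card (carrier W)"]) auto
  next
    assume "\<exists>V S1 t c. subgroup V W \<and> V \<noteq> {\<one>\<^bsub>W\<^esub>} \<and> V \<noteq> carrier W \<and> subgroup S1 (G\<lparr>carrier := S\<rparr>) \<and> (\<forall>s\<in>S1. act s ` V \<subseteq> V) \<and>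
     card (carrier (G\<lparr>carrier := S\<rparr>)) = t * card S1 \<and> card (carrier W) = c * card V \<and> c ^ t \<le> card (carrier W)"
    then obtain V S1 t1 c1 where V: "subgroup V W" "V \<noteq> {\<one>\<^bsub>W\<^esub>}" "V \<noteq> carrier W"
      and S1: "subgroup S1 (G\<lparr>carrier := S\<rparr>)" "\<forall>s\<in>S1. act s ` V \<subseteq> V" "card (carrier (G\<lparr>carrier := S\<rparr>)) = t1 * card S1"
      and c1: "card (carrier W) = c1 * card V" "c1 ^ t1 \<le> card (carrier W)"
      by - (elim exE conjE, rule that)
    have S1G: "subgroup S1 G" "S1 \<subseteq> S" using incl_subgroup[OF S(1) S1(1)] subgroup.subset[OF S1(1)] by auto
    define U1 where "U1 = {a \<in> A. q a \<in> V}"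
    have VW: "V \<subseteq> carrier W" by (rule subgroup.subset[OF V(1)])
    have U1sub: "subgroup U1 G"
    proof (rule subgroupI)
      show "U1 \<subseteq> carrier G" using A.subset by (auto simp: U1_def)
      show "U1 \<noteq> {}" using q.hom_one subgroup.one_closed[OF V(1)] A.one_closed by (auto simp: U1_def intro!: exI[of _ \<one>])
      show "inv a \<in> U1" if "a \<in> U1" for a
        using that q.hom_inv[of a] subgroup.m_inv_closed[OF V(1), of "q a"] by (simp add: U1_def m_inv_consistent[OF A])
      show "a \<otimes> b \<in> U1" if "a \<in> U1" "b \<in> U1" for a b
        using that q.hom_mult[of a b] subgroup.m_closed[OF V(1), of "q a" "q b"] by (simp add: U1_def)
    qed
    have cardU1: "card U1 = card V * card U"
      using q.card_preimage[of V] finA VW ker by (simp add: U1_def Wc)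
    have "U1 \<noteq> A"
    proof
      assume "U1 = A"
      then have "carrier W \<subseteq> V" by (auto simp: Wc U1_def)
      then show False using V VW by auto
    qed
    have finV: "finite V" using VW finW finite_subset by blast
    have "card V > 0" using finV subgroup.one_closed[OF V(1)] by (auto simp: card_gt_0_iff)
    moreover have "card V \<noteq> 1" using V(2) subgroup.one_closed[OF V(1)] by (metis card_1_singletonE singletonD)
    ultimately have V2: "card V > 1" by linarith
    have Upos: "card U > 0" using finA U(2) U.one_closed by (metis card_gt_0_iff empty_iff finite_subset)
    have ltU: "card U < card U1" using V2 Upos by (simp add: cardU1)
    have U1A: "U1 \<subseteq> A" by (auto simp: U1_def)
    have leA: "card U1 \<le> card A" using U1A finA by (rule card_mono[rotated])
    have lt: "card A - card U1 < card A - card U" using ltU leA by linarith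
    have inv1: "s \<otimes> u \<otimes> inv s \<in> U1" if s: "s \<in> S1" and u: "u \<in> U1" for s u
    proof -
      have sS: "s \<in> S" and uA: "u \<in> A" and qu: "q u \<in> V" using S1G s u by (auto simp: U1_def)
      have "act s (q u) \<in> V" using S1(2) s qu by auto
      then have "q (cj s u) \<in> V" using actq[OF sS uA] by simp
      then show ?thesis using cjA[OF sS uA] by (simp add: U1_def cj_def)
    qed
    obtain S' U' t2 c2 where IH: "subgroup S' G" "S' \<subseteq> S1" "subgroup U' G" "U' \<subseteq> A" "U' \<noteq> A"
      "\<forall>s\<in>S'. \<forall>u\<in>U'. s \<otimes> u \<otimes> inv s \<in> U'" "card S1 = t2 * card S'" "card A = c2 * card U'"
      "c2 ^ t2 * card U1 \<le> card A"
      "semilinear (?A Mod U') S' (\<lambda>s C. (\<lambda>a. s \<otimes> a \<otimes> inv s) ` C)"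
      using less.hyps[OF lt S1G(1) _ U1sub U1A \<open>U1 \<noteq> A\<close> inv1] S1G(2) S(2) by blast
    have "card A = c1 * card U1" using cardW c1 cardU1 by simp
    then have "c2 ^ t2 \<le> c1" using IH(9) ltU by simp
    then have "(c2 ^ t2) ^ t1 \<le> c1 ^ t1" by (rule power_mono) simp
    then have "c2 ^ (t1 * t2) \<le> card (carrier W)" using c1(2) by (simp add: power_mult[symmetric] mult.commute)
    then have "c2 ^ (t1 * t2) * card U \<le> card A" unfolding cardW by (rule mult_right_mono) simp
    moreover have "card S = (t1 * t2) * card S'" using S1(3) IH(7) by (simp add: mult.assoc)
    ultimately show ?thesis using IH S1G(2)
      by (intro exI[of _ S'] exI[of _ U'] exI[of _ "t1 * t2"] exI[of _ c2]) auto
  qed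
qed

end

section \<open>Affine actions with prescribed coordinates\<close>

lemma (in group) finite_submonoid_is_all:
  assumes fin: "finite (carrier G)" and gen: "generate G R = carrier G" and R: "R \<subseteq> E" and E: "E \<subseteq> carrier G"
    and one: "\<one> \<in> E" and mult: "\<And>g h. g \<in> E \<Longrightarrow> h \<in> E \<Longrightarrow> g \<otimes> h \<in> E"
  shows "E = carrier G"
proof -
  have pw: "g [^] (n::nat) \<in> E" if "g \<in> E" for g n
    by (induction n) (use one mult that in auto)
  have "inv g \<in> E" if g: "g \<in> E" for g
  proof -
    have gc: "g \<in> carrier G" using g E by auto
    have "order G > 0" using fin by (simp add: order_gt_0_iff_finite)
    then obtain k where k: "order G = Suc k" by (metis Suc_pred)
    have "g [^] k \<otimes> g = \<one>" using pow_order_eq_1[OF gc] k by simp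
    then have "inv g = g [^] k" using inv_equality gc by simp
    then show ?thesis using pw[OF g] by simp
  qed
  then have "subgroup E G" using E one mult by (intro subgroupI) auto
  then have "generate G R \<subseteq> E" using generate_subgroup_incl[OF R] by blast
  then show ?thesis using gen E by auto
qed

lemma hom_generate_subset:
  assumes "group G" "group H" "h \<in> hom G H" "S \<subseteq> carrier G" "subgroup D H" "h ` S \<subseteq> D"
  shows "h ` generate G S \<subseteq> D"
proof -
  interpret h: group_hom G H h using assms by (simp add: group_hom_def group_hom_axioms_def)
  have "h ` generate G S = generate H (h ` S)" using h.generate_img[OF assms(4)] by simp
  then show ?thesis using h.H.generate_subgroup_incl[OF assms(6,5)] by simp
qed

text \<open>
  \<open>T\<close> acts on \<open>W\<close> by the affine maps \<open>w \<mapsto> \<pi> g \<otimes> lin g w\<close>, transitively because \<open>\<pi>\<close> is onto; \<open>\<pi> g\<close> is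
  the image of the origin. It follows that \<open>lin\<close> is multiplicative on \<open>W\<close>.
\<close>

definition affine_action ::
    "('a, 'b) monoid_scheme \<Rightarrow> ('w, 'c) monoid_scheme \<Rightarrow> ('a \<Rightarrow> 'w) \<Rightarrow> ('a \<Rightarrow> 'w \<Rightarrow> 'w) \<Rightarrow> bool" where
  "affine_action T W \<pi> lin \<longleftrightarrow> comm_group W \<and> finite (carrier W) \<and> \<pi> ` carrier T = carrier W \<and>
     (\<forall>g\<in>carrier T. lin g \<in> hom W W) \<and>
     (\<forall>g\<in>carrier T. \<forall>h\<in>carrier T. \<pi> (g \<otimes>\<^bsub>T\<^esub> h) = \<pi> g \<otimes>\<^bsub>W\<^esub> lin g (\<pi> h))"

text \<open>
  \<open>L\<close> is the stabiliser of the origin for an affine action of \<open>T\<close> on an elementary abelian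
  \<open>r\<close>-group of order \<open>n\<close>; in the semilinear case the linear parts are moreover one-dimensional
  semilinear.
\<close>

abbreviation "affine_kernel T n L W \<pi> lin r \<equiv> Factorial_Ring.prime (r::nat) \<and> affine_action T W \<pi> lin \<and>
  (\<forall>w\<in>carrier W. w [^]\<^bsub>W\<^esub> r = \<one>\<^bsub>W\<^esub>) \<and> card (carrier W) = n \<and> L = {g \<in> carrier T. \<pi> g = \<one>\<^bsub>W\<^esub>}"

abbreviation "semilinear_kernel T n L W \<pi> lin r \<equiv> Factorial_Ring.prime (r::nat) \<and> affine_action T W \<pi> lin \<and>
  (\<forall>w\<in>carrier W. w [^]\<^bsub>W\<^esub> r = \<one>\<^bsub>W\<^esub>) \<and> card (carrier W) = n \<and> L = {g \<in> carrier T. \<pi> g = \<one>\<^bsub>W\<^esub>} \<and>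
  semilinear W (carrier T) lin"

lemma affine_actionD:
  assumes "affine_action T W \<pi> lin"
  shows "comm_group W" "finite (carrier W)" "\<pi> ` carrier T = carrier W" "g \<in> carrier T \<Longrightarrow> lin g \<in> hom W W"
    "g \<in> carrier T \<Longrightarrow> h \<in> carrier T \<Longrightarrow> \<pi> (g \<otimes>\<^bsub>T\<^esub> h) = \<pi> g \<otimes>\<^bsub>W\<^esub> lin g (\<pi> h)"
    "g \<in> carrier T \<Longrightarrow> \<pi> g \<in> carrier W"
  using assms unfolding affine_action_def by blast+

lemma affine_action_one:
  assumes T: "group T" and a: "affine_action T W \<pi> lin"
  shows "\<pi> \<one>\<^bsub>T\<^esub> = \<one>\<^bsub>W\<^esub>"
proof -
  interpret T: group T by fact
  interpret W: comm_group W by (rule affine_actionD(1)[OF a])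
  have "\<one>\<^bsub>W\<^esub> \<in> \<pi> ` carrier T" using affine_actionD(3)[OF a] W.one_closed by simp
  then obtain g where g: "g \<in> carrier T" "\<pi> g = \<one>\<^bsub>W\<^esub>" by (metis imageE)
  have l: "lin \<one>\<^bsub>T\<^esub> \<one>\<^bsub>W\<^esub> = \<one>\<^bsub>W\<^esub>"
    using hom_one[OF affine_actionD(4)[OF a, of "\<one>\<^bsub>T\<^esub>"] W.is_group W.is_group] by simp
  have "\<pi> (\<one>\<^bsub>T\<^esub> \<otimes>\<^bsub>T\<^esub> g) = \<pi> \<one>\<^bsub>T\<^esub> \<otimes>\<^bsub>W\<^esub> lin \<one>\<^bsub>T\<^esub> (\<pi> g)"
    by (rule affine_actionD(5)[OF a]) (use g in auto)
  then have "\<one>\<^bsub>W\<^esub> = \<pi> \<one>\<^bsub>T\<^esub> \<otimes>\<^bsub>W\<^esub> \<one>\<^bsub>W\<^esub>" using g l by simp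
  then show ?thesis using affine_actionD(6)[OF a, of "\<one>\<^bsub>T\<^esub>"] by simp
qed

lemma affine_action_card:
  assumes T: "group T" and fin: "finite (carrier T)" and a: "affine_action T W \<pi> lin"
  shows "card (carrier T) = card (carrier W) * card {g \<in> carrier T. \<pi> g = \<one>\<^bsub>W\<^esub>}"
proof -
  interpret T: group T by fact
  interpret W: comm_group W by (rule affine_actionD(1)[OF a])
  let ?L = "{g \<in> carrier T. \<pi> g = \<one>\<^bsub>W\<^esub>}"
  note mult = affine_actionD(5)[OF a] and one = affine_action_one[OF T a]
  have fib: "card {g \<in> carrier T. \<pi> g = w} = card ?L" if w: "w \<in> carrier W" for w
  proof -
    obtain x where x: "x \<in> carrier T" "\<pi> x = w" using affine_actionD(3)[OF a] w by (metis imageE)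
    have 1: "\<pi> (x \<otimes>\<^bsub>T\<^esub> k) = w" if "k \<in> ?L" for k
      using that mult[OF x(1)] x hom_one[OF affine_actionD(4)[OF a x(1)] W.is_group W.is_group] w by simp
    have 2: "\<pi> (inv\<^bsub>T\<^esub> x \<otimes>\<^bsub>T\<^esub> g) = \<one>\<^bsub>W\<^esub>" if "g \<in> carrier T" "\<pi> g = w" for g
      using mult[of "inv\<^bsub>T\<^esub> x" g] mult[of "inv\<^bsub>T\<^esub> x" x] that x one by simp
    have "bij_betw (\<lambda>k. x \<otimes>\<^bsub>T\<^esub> k) ?L {g \<in> carrier T. \<pi> g = w}"
    proof (rule bij_betw_byWitness[where f' = "\<lambda>g. inv\<^bsub>T\<^esub> x \<otimes>\<^bsub>T\<^esub> g"])
      show "(\<otimes>\<^bsub>T\<^esub>) x ` ?L \<subseteq> {g \<in> carrier T. \<pi> g = w}" using 1 x by auto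
      show "(\<otimes>\<^bsub>T\<^esub>) (inv\<^bsub>T\<^esub> x) ` {g \<in> carrier T. \<pi> g = w} \<subseteq> ?L" using 2 x by auto
    qed (use x in auto)
    then show ?thesis by (simp add: bij_betw_same_card)
  qed
  have "carrier T = (\<Union>w\<in>carrier W. {g \<in> carrier T. \<pi> g = w})" using affine_actionD(6)[OF a] by auto
  then have "card (carrier T) = card (\<Union>w\<in>carrier W. {g \<in> carrier T. \<pi> g = w})" by (rule arg_cong)
  also have "\<dots> = (\<Sum>w\<in>carrier W. card {g \<in> carrier T. \<pi> g = w})"
    by (rule card_UN_disjoint) (use affine_actionD(2)[OF a] fin in auto)
  also have "\<dots> = (\<Sum>w\<in>carrier W. card ?L)" by (rule sum.cong[OF refl fib])
  also have "\<dots> = card (carrier W) * card ?L" by simp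
  finally show ?thesis .
qed

text \<open>
  \<open>D\<close> is meant as the graph of a homomorphism \<open>W \<rightarrow> W'\<close> compatible with the two actions, but it is given
  only as a subgroup of the product that is stable under the generators. Stability propagates from the generators to \<open>T\<close>, so that \<open>D\<close>
  contains all pairs \<open>(\<pi> g, \<pi>' g)\<close> and projects onto \<open>W\<close>; being no larger than \<open>W\<close>, it is the graph of a
  function.
\<close>

lemma affine_kernel_subset:
  assumes T: "group T" and fin: "finite (carrier T)" and R: "R \<subseteq> carrier T" and gen: "generate T R = carrier T"
    and a: "affine_action T W \<pi> lin" and a': "affine_action T W' \<pi>' lin'"
    and D: "subgroup D (W \<times>\<times> W')" and cD: "card D \<le> card (carrier W)"
    and piD: "\<And>r. r \<in> R \<Longrightarrow> (\<pi> r, \<pi>' r) \<in> D"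
    and linD: "\<And>r x y. r \<in> R \<Longrightarrow> (x, y) \<in> D \<Longrightarrow> (lin r x, lin' r y) \<in> D"
    and g: "g \<in> carrier T" "\<pi> g = \<one>\<^bsub>W\<^esub>"
  shows "\<pi>' g = \<one>\<^bsub>W'\<^esub>"
proof -
  interpret T: group T by fact
  interpret W: comm_group W by (rule affine_actionD(1)[OF a])
  interpret W': comm_group W' by (rule affine_actionD(1)[OF a'])
  define E where "E = {g \<in> carrier T. \<forall>k\<in>carrier T. (\<pi> k, \<pi>' k) \<in> D \<longrightarrow> (\<pi> (g \<otimes>\<^bsub>T\<^esub> k), \<pi>' (g \<otimes>\<^bsub>T\<^esub> k)) \<in> D}"
  have "E = carrier T"
  proof (rule T.finite_submonoid_is_all[OF fin gen])
    show "R \<subseteq> E"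
    proof
      fix r assume r: "r \<in> R"
      have rT: "r \<in> carrier T" using r R by auto
      have "(\<pi> (r \<otimes>\<^bsub>T\<^esub> k), \<pi>' (r \<otimes>\<^bsub>T\<^esub> k)) \<in> D" if k: "k \<in> carrier T" and kD: "(\<pi> k, \<pi>' k) \<in> D" for k
      proof -
        have "(\<pi> r, \<pi>' r) \<otimes>\<^bsub>W \<times>\<times> W'\<^esub> (lin r (\<pi> k), lin' r (\<pi>' k)) \<in> D"
          using subgroup.m_closed[OF D piD[OF r] linD[OF r kD]] .
        then show ?thesis using affine_actionD(5)[OF a rT k] affine_actionD(5)[OF a' rT k] by simp
      qed
      then show "r \<in> E" using rT by (simp add: E_def)
    qed
    show "g \<otimes>\<^bsub>T\<^esub> h \<in> E" if "g \<in> E" "h \<in> E" for g h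
      using that by (simp add: E_def T.m_assoc)
  qed (auto simp: E_def)
  then have gD: "(\<pi> g, \<pi>' g) \<in> D" if "g \<in> carrier T" for g
  proof -
    have "(\<pi> \<one>\<^bsub>T\<^esub>, \<pi>' \<one>\<^bsub>T\<^esub>) \<in> D"
      using subgroup.one_closed[OF D] affine_action_one[OF T a] affine_action_one[OF T a'] by simp
    moreover have "g \<in> E" using that \<open>E = carrier T\<close> by simp
    ultimately have "(\<pi> (g \<otimes>\<^bsub>T\<^esub> \<one>\<^bsub>T\<^esub>), \<pi>' (g \<otimes>\<^bsub>T\<^esub> \<one>\<^bsub>T\<^esub>)) \<in> D"
      unfolding E_def using T.one_closed by blast
    then show ?thesis using that by simp
  qed
  have DW: "D \<subseteq> carrier W \<times> carrier W'" using subgroup.subset[OF D] by simp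
  have finD: "finite D" using DW affine_actionD(2)[OF a] affine_actionD(2)[OF a'] finite_subset by blast
  have "fst ` D = carrier W"
  proof
    show "fst ` D \<subseteq> carrier W" using DW by auto
    show "carrier W \<subseteq> fst ` D"
    proof
      fix w assume "w \<in> carrier W"
      then obtain h where "h \<in> carrier T" "\<pi> h = w" using affine_actionD(3)[OF a] by (metis imageE)
      then show "w \<in> fst ` D" using gD[of h] by force
    qed
  qed
  moreover have "card (fst ` D) \<le> card D" using finD by (rule card_image_le)
  ultimately have "inj_on fst D" using cD finD by (intro eq_card_imp_inj_on) auto
  moreover have "(\<one>\<^bsub>W\<^esub>, \<pi>' g) \<in> D" using gD[OF g(1)] g(2) by simp
  moreover have "(\<one>\<^bsub>W\<^esub>, \<one>\<^bsub>W'\<^esub>) \<in> D" using subgroup.one_closed[OF D] by simp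
  ultimately have "(\<one>\<^bsub>W\<^esub>, \<pi>' g) = (\<one>\<^bsub>W\<^esub>, \<one>\<^bsub>W'\<^esub>)" by (intro inj_onD[of fst D]) auto
  then show ?thesis by simp
qed

context comm_group begin

text \<open>
  The inductive step for spans in elementary abelian groups, which are used here as vector spaces
  without a scalar field.
\<close>

lemma generate_insert_exponent:
  assumes S: "S \<subseteq> carrier G" and x: "x \<in> carrier G" "x [^] p = \<one>" and p: "p > (0::nat)"
  shows "generate G (insert x S) = (\<lambda>(h, j). h \<otimes> x [^] j) ` (generate G S \<times> {..<p})" (is "?L = ?R")
proof
  let ?H = "generate G S"
  interpret H: subgroup ?H G by (rule generate_is_subgroup[OF S])
  have red: "x [^] (j::nat) = x [^] (j mod p)" for j
  proof -
    have "x [^] (p * (j div p) + j mod p) = x [^] (p * (j div p)) \<otimes> x [^] (j mod p)"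
      by (rule nat_pow_mult[OF x(1), symmetric])
    also have "x [^] (p * (j div p)) = (x [^] p) [^] (j div p)" by (rule nat_pow_pow[OF x(1), symmetric])
    finally show ?thesis using x by simp
  qed
  have mem: "h \<otimes> x [^] (j::nat) \<in> ?R" if "h \<in> ?H" for h j
    using that p by (subst red) (auto intro!: image_eqI[of _ _ "(h, j mod p)"])
  have "subgroup ?R G"
  proof (rule subgroupI)
    show "?R \<subseteq> carrier G" using x by auto
    show "?R \<noteq> {}" using mem[OF H.one_closed, of 0] by blast
    fix a assume "a \<in> ?R"
    then obtain h j where a: "h \<in> ?H" "j < p" "a = h \<otimes> x [^] j" by auto
    have hc: "h \<in> carrier G" using a by simp
    have "x [^] (p - j) \<otimes> x [^] j = \<one>" using x a by (simp add: nat_pow_mult)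
    then have "inv (x [^] j) = x [^] (p - j)" using x by (intro inv_equality) auto
    then have "inv a = inv h \<otimes> x [^] (p - j)" using a hc x by (simp add: inv_mult)
    then show "inv a \<in> ?R" using mem[of "inv h"] a by simp
    fix b assume "b \<in> ?R"
    then obtain k i where b: "k \<in> ?H" "i < p" "b = k \<otimes> x [^] i" by auto
    have "a \<otimes> b = (h \<otimes> k) \<otimes> x [^] (j + i)" using a b hc x by (simp add: nat_pow_mult[symmetric] m_ac)
    then show "a \<otimes> b \<in> ?R" using mem[of "h \<otimes> k"] a b by simp
  qed
  moreover have "insert x S \<subseteq> ?R"
  proof (rule insert_subsetI)
    show "x \<in> ?R" using mem[of \<one> 1] x by simp
    show "S \<subseteq> ?R"
    proof
      fix s assume s: "s \<in> S"
      have "s \<otimes> x [^] (0::nat) \<in> ?R" by (rule mem) (rule generate.incl[OF s])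
      moreover have "s \<otimes> x [^] (0::nat) = s" using s S by auto
      ultimately show "s \<in> ?R" by (simp only:)
    qed
  qed
  ultimately show "?L \<subseteq> ?R" by (rule generate_subgroup_incl[rotated])
  have I: "subgroup ?L G" using S x by (intro generate_is_subgroup) auto
  have HL: "?H \<subseteq> ?L" by (rule mono_generate) auto
  have xL: "x \<in> ?L" by (rule generate.incl) simp
  show "?R \<subseteq> ?L"
  proof clarify
    fix h j assume h: "h \<in> ?H"
    have "x [^] (j::nat) \<in> ?L" using subgroup_int_pow_closed[OF I xL, of "int j"] by (simp add: int_pow_int)
    then show "h \<otimes> x [^] j \<in> ?L" using h HL subgroup.m_closed[OF I] by auto
  qed
qed

lemma card_generate_le:
  assumes w: "\<And>i. w i \<in> carrier G" and exp: "\<And>i. w i [^] p = \<one>" and p: "p > (0::nat)"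
  shows "finite (generate G (w ` {..<e}))" "card (generate G (w ` {..<e})) \<le> p ^ e"
proof (induction e)
  case 0
  show "finite (generate G (w ` {..<0}))" "card (generate G (w ` {..<0})) \<le> p ^ 0"
    by (simp_all add: generate_empty)
next
  case (Suc e)
  have ws: "w ` {..<e} \<subseteq> carrier G" using w by auto
  have e: "generate G (w ` {..<Suc e}) = (\<lambda>(h, j). h \<otimes> w e [^] j) ` (generate G (w ` {..<e}) \<times> {..<p})"
    using generate_insert_exponent[OF ws w exp p, of e] by (simp add: lessThan_Suc)
  show "finite (generate G (w ` {..<Suc e}))" unfolding e using Suc by simp
  have "card (generate G (w ` {..<Suc e})) \<le> card (generate G (w ` {..<e}) \<times> {..<p})"
    unfolding e using Suc by (intro card_image_le) simp
  also have "\<dots> \<le> p ^ Suc e" using Suc by (simp add: card_cartesian_product)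
  finally show "card (generate G (w ` {..<Suc e})) \<le> p ^ Suc e" .
qed

lemma card_generate_eq:
  assumes w: "\<And>i. w i \<in> carrier G" and exp: "\<And>i. w i [^] p = \<one>" and p: "Factorial_Ring.prime (p::nat)"
    and indep: "\<And>i. i < e \<Longrightarrow> w i \<notin> generate G (w ` {..<i})"
  shows "card (generate G (w ` {..<e})) = p ^ e"
  using indep
proof (induction e)
  case 0
  show ?case by (simp add: generate_empty)
next
  case (Suc e)
  have p0: "p > 0" using p by (simp add: prime_gt_0_nat)
  let ?H = "generate G (w ` {..<e})"
  interpret H: subgroup ?H G using w by (intro generate_is_subgroup) auto
  have ws: "w ` {..<e} \<subseteq> carrier G" using w by auto
  have e: "generate G (w ` {..<Suc e}) = (\<lambda>(h, j). h \<otimes> w e [^] j) ` (?H \<times> {..<p})"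
    using generate_insert_exponent[OF ws w exp p0, of e] by (simp add: lessThan_Suc)
  have key: "i = j" if "h \<in> ?H" "k \<in> ?H" "i \<le> j" "j < p" "h \<otimes> w e [^] i = k \<otimes> w e [^] j" for h k i j
  proof (rule ccontr)
    assume "i \<noteq> j"
    then have ij: "0 < j - i" "j - i < p" using that by auto
    have c: "h \<in> carrier G" "k \<in> carrier G" using that by auto
    have "h \<otimes> w e [^] i = (k \<otimes> w e [^] (j - i)) \<otimes> w e [^] i"
      using that c w by (simp add: m_assoc nat_pow_mult)
    then have "h = k \<otimes> w e [^] (j - i)" using c w by simp
    then have "w e [^] (j - i) = inv k \<otimes> h" using c w by (simp add: m_assoc[symmetric])
    then have "w e [^] (j - i) \<in> ?H" using that by simp
    moreover have "coprime (j - i) p"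
    proof -
      have "\<not> p dvd (j - i)" using ij nat_dvd_not_less by blast
      then show ?thesis using prime_imp_coprime[OF p] coprime_commute by blast
    qed
    ultimately have "w e \<in> ?H"
      using subgroup_pow_coprime[OF H.subgroup_axioms w, of e "j - i" p] exp H.one_closed by simp
    then show False using Suc.prems[of e] by simp
  qed
  have "inj_on (\<lambda>(h, j). h \<otimes> w e [^] j) (?H \<times> {..<p})"
  proof (rule inj_onI, clarify)
    fix h i k j assume *: "h \<in> ?H" "i < p" "k \<in> ?H" "j < p" "h \<otimes> w e [^] i = k \<otimes> w e [^] j"
    have "i = j" using key[of h k i j] key[of k h j i] * by (cases "i \<le> j") auto
    then show "h = k \<and> i = j" using * w by (simp add: H.mem_carrier)
  qed
  then have "card (generate G (w ` {..<Suc e})) = card ?H * p" unfolding e by (simp add: card_image card_cartesian_product)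
  then show ?case using Suc by (simp add: mult.commute)
qed

definition lincomb :: "(nat \<Rightarrow> 'a) \<Rightarrow> nat \<Rightarrow> (nat \<Rightarrow> nat) \<Rightarrow> 'a" where
  "lincomb w e z = finprod G (\<lambda>i. w i [^] z i) {..<e}"

lemma lincomb_exists:
  assumes w: "\<And>i. w i \<in> carrier G" and exp: "\<And>i. w i [^] p = \<one>" and p: "p > (0::nat)"
  shows "x \<in> generate G (w ` {..<e}) \<Longrightarrow> \<exists>z \<in> {..<e} \<rightarrow>\<^sub>E {..<p}. x = lincomb w e z"
proof (induction e arbitrary: x)
  case 0
  then show ?case by (simp add: generate_empty lincomb_def)
next
  case (Suc e)
  have ws: "w ` {..<e} \<subseteq> carrier G" using w by auto
  have "generate G (w ` {..<Suc e}) = (\<lambda>(h, j). h \<otimes> w e [^] j) ` (generate G (w ` {..<e}) \<times> {..<p})"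
    using generate_insert_exponent[OF ws w exp p, of e] by (simp add: lessThan_Suc)
  then obtain h j where hj: "h \<in> generate G (w ` {..<e})" "j < p" "x = h \<otimes> w e [^] j" using Suc.prems by auto
  obtain z where z: "z \<in> {..<e} \<rightarrow>\<^sub>E {..<p}" "h = lincomb w e z" using Suc.IH[OF hj(1)] by blast
  let ?z = "z(e := j)"
  have "lincomb w (Suc e) ?z = w e [^] j \<otimes> finprod G (\<lambda>i. w i [^] ?z i) {..<e}"
    unfolding lincomb_def lessThan_Suc by (subst finprod_insert) (use w in auto)
  also have "finprod G (\<lambda>i. w i [^] ?z i) {..<e} = lincomb w e z"
    unfolding lincomb_def by (rule finprod_cong') (use w in auto)
  finally have "x = lincomb w (Suc e) ?z" using hj z w by (simp add: m_comm lincomb_def)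
  moreover have "?z \<in> {..<Suc e} \<rightarrow>\<^sub>E {..<p}"
    using z(1) hj(2) by (auto simp: PiE_def Pi_def extensional_def)
  ultimately show ?case by blast
qed

end

lemma comm_group_DirProd:
  assumes "comm_group G" "comm_group H"
  shows "comm_group (G \<times>\<times> H)"
proof -
  interpret G: comm_group G by fact
  interpret H: comm_group H by fact
  show ?thesis
    by (rule group.group_comm_groupI) (auto simp: DirProd_group G.is_group H.is_group G.m_comm H.m_comm)
qed

lemma DirProd_nat_pow: "(x, y) [^]\<^bsub>G \<times>\<times> H\<^esub> (n::nat) = (x [^]\<^bsub>G\<^esub> n, y [^]\<^bsub>H\<^esub> n)"
  by (induction n) (auto simp: DirProd_def nat_pow_def)

lemma lincomb_pair:
  assumes "comm_group G" "comm_group H" "\<And>i. w i \<in> carrier G" "\<And>i. v i \<in> carrier H"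
    "subgroup D (G \<times>\<times> H)" "\<And>i. i < e \<Longrightarrow> (w i, v i) \<in> D"
  shows "(comm_group.lincomb G w e z, comm_group.lincomb H v e z) \<in> D"
  using assms(6)
proof (induction e)
  interpret G: comm_group G by fact
  interpret H: comm_group H by fact
  {
    case 0
    show ?case using subgroup.one_closed[OF assms(5)] by (simp add: G.lincomb_def H.lincomb_def)
  next
    case (Suc e)
    interpret GH: comm_group "G \<times>\<times> H" by (rule comm_group_DirProd[OF assms(1,2)])
    have pw: "(w e, v e) [^]\<^bsub>G \<times>\<times> H\<^esub> z e \<in> D"
      using GH.subgroup_int_pow_closed[OF assms(5) Suc.prems[of e], of "int (z e)"] by (simp add: int_pow_int)
    have ih: "(G.lincomb w e z, H.lincomb v e z) \<in> D" by (rule Suc.IH, rule Suc.prems) simp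
    have "(w e [^]\<^bsub>G\<^esub> z e \<otimes>\<^bsub>G\<^esub> G.lincomb w e z, v e [^]\<^bsub>H\<^esub> z e \<otimes>\<^bsub>H\<^esub> H.lincomb v e z) \<in> D"
      using subgroup.m_closed[OF assms(5) pw ih] by (simp add: DirProd_nat_pow)
    moreover have "G.lincomb w (Suc e) z = w e [^]\<^bsub>G\<^esub> z e \<otimes>\<^bsub>G\<^esub> G.lincomb w e z"
      unfolding G.lincomb_def lessThan_Suc by (subst G.finprod_insert) (use assms in auto)
    moreover have "H.lincomb v (Suc e) z = v e [^]\<^bsub>H\<^esub> z e \<otimes>\<^bsub>H\<^esub> H.lincomb v e z"
      unfolding H.lincomb_def lessThan_Suc by (subst H.finprod_insert) (use assms in auto)
    ultimately show ?case by simp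
  }
qed

text \<open>
  The elements \<open>w 0, \<dots>, w (e - 1)\<close> form a basis of the elementary abelian \<open>p\<close>-group \<open>W\<close>. The later terms of
  the sequence are arbitrary elements of \<open>W\<close>, so that the full sequence \<open>\<zeta> ^ i v\<close> can serve as a frame.
\<close>

definition framed :: "('w, 'c) monoid_scheme \<Rightarrow> nat \<Rightarrow> nat \<Rightarrow> (nat \<Rightarrow> 'w) \<Rightarrow> bool" where
  "framed W p e w \<longleftrightarrow> p > 0 \<and> (\<forall>i. w i \<in> carrier W \<and> w i [^]\<^bsub>W\<^esub> p = \<one>\<^bsub>W\<^esub>) \<and>
     generate W (w ` {..<e}) = carrier W \<and> card (carrier W) = p ^ e"

text \<open>
  The graph of the isomorphism that carries one basis to the other.
\<close>

definition graph_span :: "('w, 'c) monoid_scheme \<Rightarrow> ('v, 'd) monoid_scheme \<Rightarrow> nat \<Rightarrow> (nat \<Rightarrow> 'w) \<Rightarrow> (nat \<Rightarrow> 'v) \<Rightarrow> ('w \<times> 'v) set" where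
  "graph_span W V e w v = generate (W \<times>\<times> V) ((\<lambda>i. (w i, v i)) ` {..<e})"

lemma graph_span:
  assumes "comm_group W" "comm_group V" "framed W p e w" "framed V p e v"
  shows "subgroup (graph_span W V e w v) (W \<times>\<times> V)" "card (graph_span W V e w v) \<le> card (carrier W)"
    "i < e \<Longrightarrow> (w i, v i) \<in> graph_span W V e w v"
    "(comm_group.lincomb W w e z, comm_group.lincomb V v e z) \<in> graph_span W V e w v"
proof -
  interpret W: comm_group W by fact
  interpret V: comm_group V by fact
  interpret WV: comm_group "W \<times>\<times> V" by (rule comm_group_DirProd[OF assms(1,2)])
  have c: "(w i, v i) \<in> carrier (W \<times>\<times> V)" and ex: "(w i, v i) [^]\<^bsub>W \<times>\<times> V\<^esub> p = \<one>\<^bsub>W \<times>\<times> V\<^esub>" for i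
    using assms(3,4) by (auto simp: framed_def DirProd_nat_pow)
  show sub: "subgroup (graph_span W V e w v) (W \<times>\<times> V)" unfolding graph_span_def
    using c by (intro WV.generate_is_subgroup) auto
  show "card (graph_span W V e w v) \<le> card (carrier W)" unfolding graph_span_def
    using WV.card_generate_le(2)[of "\<lambda>i. (w i, v i)" p e] c ex assms(3) by (simp add: framed_def)
  show mem: "(w i, v i) \<in> graph_span W V e w v" if "i < e" for i
    unfolding graph_span_def using that by (intro generate.incl) auto
  show "(W.lincomb w e z, V.lincomb v e z) \<in> graph_span W V e w v"
    by (rule lincomb_pair[OF assms(1,2) _ _ sub mem]) (use assms(3,4) in \<open>auto simp: framed_def\<close>)
qed

lemma graph_span_map:
  assumes "comm_group W" "comm_group V" "framed W p e w" "framed V p e v"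
    and f: "f \<in> hom W W" and h: "h \<in> hom V V"
    and gens: "\<And>i. i < e \<Longrightarrow> (f (w i), h (v i)) \<in> graph_span W V e w v"
    and xy: "(x, y) \<in> graph_span W V e w v"
  shows "(f x, h y) \<in> graph_span W V e w v"
proof -
  interpret W: comm_group W by fact
  interpret V: comm_group V by fact
  interpret WV: comm_group "W \<times>\<times> V" by (rule comm_group_DirProd[OF assms(1,2)])
  have m: "(\<lambda>(x, y). (f x, h y)) \<in> hom (W \<times>\<times> V) (W \<times>\<times> V)"
    using f h by (auto simp: hom_def)
  have "(\<lambda>(x, y). (f x, h y)) ` graph_span W V e w v \<subseteq> graph_span W V e w v"
    unfolding graph_span_def[of W V e w v, THEN sym] 
    by (subst (1) graph_span_def, rule hom_generate_subset[OF WV.is_group WV.is_group m _ graph_span(1)[OF assms(1-4)]])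
       (use assms(3,4) gens in \<open>auto simp: framed_def\<close>)
  then show ?thesis using xy by force
qed

text \<open>
  The stabiliser of the origin depends only on the coordinates of the translation parts and of the
  matrices of the generators. Comparing the orders of the two stabilisers reduces equality to one
  inclusion.
\<close>

lemma framed_kernel_eq:
  assumes T: "group T" "finite (carrier T)" "R \<subseteq> carrier T" "generate T R = carrier T"
    and a: "affine_action T W \<pi> lin" and a': "affine_action T V \<pi>' lin'"
    and fr: "framed W p e w" "framed V p e v"
    and piD: "\<And>r. r \<in> R \<Longrightarrow> (\<pi> r, \<pi>' r) \<in> graph_span W V e w v"
    and linD: "\<And>r i. r \<in> R \<Longrightarrow> i < e \<Longrightarrow> (lin r (w i), lin' r (v i)) \<in> graph_span W V e w v"
  shows "{g \<in> carrier T. \<pi> g = \<one>\<^bsub>W\<^esub>} = {g \<in> carrier T. \<pi>' g = \<one>\<^bsub>V\<^esub>}" (is "?L = ?L'")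
proof -
  note c = affine_actionD(1)[OF a] affine_actionD(1)[OF a']
  have sub: "?L \<subseteq> ?L'"
  proof clarify
    fix g assume g: "g \<in> carrier T" "\<pi> g = \<one>\<^bsub>W\<^esub>"
    show "\<pi>' g = \<one>\<^bsub>V\<^esub>"
    proof (rule affine_kernel_subset[OF T a a' graph_span(1,2)[OF c fr] piD _ g])
      fix r x y assume r: "r \<in> R" and xy: "(x, y) \<in> graph_span W V e w v"
      have "r \<in> carrier T" using r T(3) by auto
      then show "(lin r x, lin' r y) \<in> graph_span W V e w v"
        using graph_span_map[OF c fr affine_actionD(4)[OF a] affine_actionD(4)[OF a'] linD[OF r] xy] by blast
    qed
  qed
  have "card (carrier W) = card (carrier V)" using fr by (simp add: framed_def)
  moreover have "card (carrier W) > 0" using fr by (simp add: framed_def)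
  ultimately have "card ?L = card ?L'"
    using affine_action_card[OF T(1,2) a] affine_action_card[OF T(1,2) a'] by simp
  then show ?thesis using card_subset_eq[OF _ sub] T(2) by simp
qed

lemma card_le_by_code:
  assumes "finite C" and ex: "\<And>x. x \<in> A \<Longrightarrow> \<exists>y\<in>C. P x y" and inj: "\<And>x x' y. P x y \<Longrightarrow> P x' y \<Longrightarrow> x = x'"
  shows "finite A \<and> card A \<le> card C"
proof -
  obtain f where f: "\<And>x. x \<in> A \<Longrightarrow> f x \<in> C \<and> P x (f x)" using ex by metis
  have i: "inj_on f A"
  proof (rule inj_onI)
    fix x y assume xy: "x \<in> A" "y \<in> A" "f x = f y"
    have "P x (f x)" "P y (f x)" using f[OF xy(1)] f[OF xy(2)] xy(3) by simp_all
    then show "x = y" by (rule inj)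
  qed
  have "f ` A \<subseteq> C" using f by blast
  then show ?thesis using assms(1) i by (metis card_inj_on_le inj_on_finite)
qed

lemma framed_exists:
  assumes W: "comm_group W" and fin: "finite (carrier W)" and p: "Factorial_Ring.prime (p::nat)"
    and exp: "\<And>w. w \<in> carrier W \<Longrightarrow> w [^]\<^bsub>W\<^esub> p = \<one>\<^bsub>W\<^esub>"
  shows "\<exists>e w. framed W p e w"
proof -
  interpret W: comm_group W by fact
  define good where "good e \<longleftrightarrow> (\<exists>w. (\<forall>i. w i \<in> carrier W) \<and> (\<forall>i<e. w i \<notin> generate W (w ` {..<i})))" for e :: nat
  have cardw: "card (generate W (w ` {..<e})) = p ^ e"
    if "\<forall>i. w i \<in> carrier W" "\<forall>i<e. w i \<notin> generate W (w ` {..<i})" for w e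
    by (rule W.card_generate_eq) (use that exp p in auto)
  have bound: "e \<le> card (carrier W)" if ge: "good e" for e
  proof -
    obtain w where w: "\<forall>i. w i \<in> carrier W" "\<forall>i<e. w i \<notin> generate W (w ` {..<i})" using ge unfolding good_def by blast
    have "p ^ e = card (generate W (w ` {..<e}))" using cardw[OF w] by simp
    also have "\<dots> \<le> card (carrier W)" using w fin by (intro card_mono W.generate_incl) auto
    finally have "p ^ e \<le> card (carrier W)" .
    moreover have "e < p ^ e" using prime_gt_1_nat[OF p] by (simp add: power_gt_expt)
    ultimately show ?thesis by simp
  qed
  have "good 0" unfolding good_def by (rule exI[of _ "\<lambda>_. \<one>\<^bsub>W\<^esub>"]) simp
  then obtain e where e: "good e" and max: "\<And>d. good d \<Longrightarrow> d \<le> e"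
    using GreatestI_nat[of good 0 "card (carrier W)"] Greatest_le_nat[of good _ "card (carrier W)"] bound by blast
  obtain w where w: "\<forall>i. w i \<in> carrier W" "\<forall>i<e. w i \<notin> generate W (w ` {..<i})" using e unfolding good_def by blast
  have "carrier W \<subseteq> generate W (w ` {..<e})"
  proof (rule ccontr)
    assume "\<not> ?thesis"
    then obtain x where x: "x \<in> carrier W" "x \<notin> generate W (w ` {..<e})" by blast
    have im: "(w(e := x)) ` {..<i} = w ` {..<i}" if "i \<le> e" for i using that by auto
    have "good (Suc e)" unfolding good_def
    proof (rule exI[of _ "w(e := x)"], intro conjI allI impI)
      show "(w(e := x)) i \<in> carrier W" for i using w x by simp
      show "(w(e := x)) i \<notin> generate W ((w(e := x)) ` {..<i})" if "i < Suc e" for i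
        using that w x by (cases "i = e") (simp_all add: im)
    qed
    then show False using max[of "Suc e"] by simp
  qed
  moreover have "generate W (w ` {..<e}) \<subseteq> carrier W" using w by (intro W.generate_incl) auto
  ultimately have "generate W (w ` {..<e}) = carrier W" by (rule equalityI[rotated])
  then have "framed W p e w" using cardw[OF w] w exp prime_gt_0_nat[OF p] by (simp add: framed_def)
  then show ?thesis by blast
qed

definition coords :: "nat \<Rightarrow> nat \<Rightarrow> (nat \<Rightarrow> nat) set" where
  "coords p e = {..<e} \<rightarrow>\<^sub>E {..<p}"

lemma card_coords: "card (coords p e) = p ^ e" "finite (coords p e)"
  by (simp_all add: coords_def card_PiE finite_PiE)

lemma framed_lincomb:
  assumes "comm_group W" "framed W p e w" "x \<in> carrier W"
  shows "\<exists>z\<in>coords p e. x = comm_group.lincomb W w e z"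
  using comm_group.lincomb_exists[OF assms(1), of w p x e] assms(2,3) by (simp add: framed_def coords_def)

definition prime_power_pairs :: "nat \<Rightarrow> (nat \<times> nat) set" where
  "prime_power_pairs n = {(p, e). Factorial_Ring.prime p \<and> p ^ e = n}"

lemma prime_power_pairs:
  assumes "n \<ge> 2"
  shows "finite (prime_power_pairs n)" "card (prime_power_pairs n) \<le> n ^ 2"
    "(p, e) \<in> prime_power_pairs n \<Longrightarrow> 2 ^ e \<le> n"
proof -
  have key: "p \<in> {1..n}" "e \<in> {..<n}" "2 ^ e \<le> n" if "(p, e) \<in> prime_power_pairs n" for p e
  proof -
    have p: "Factorial_Ring.prime p" "p ^ e = n" using that by (auto simp: prime_power_pairs_def)
    have p2: "p \<ge> 2" using p(1) by (rule prime_ge_2_nat)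
    have e: "e > 0" using p assms by (cases e) auto
    have "p ^ 1 \<le> p ^ e" using p2 e by (intro power_increasing) auto
    then show "p \<in> {1..n}" using p p2 by auto
    have "e < p ^ e" using p2 by (simp add: power_gt_expt)
    then show "e \<in> {..<n}" using p by simp
    show "2 ^ e \<le> n" using power_mono[OF p2, of e] p by simp
  qed
  have sub: "prime_power_pairs n \<subseteq> {1..n} \<times> {..<n}" using key by auto
  then show "finite (prime_power_pairs n)" by (rule finite_subset) simp
  have "card (prime_power_pairs n) \<le> card ({1..n} \<times> {..<n})" using sub by (intro card_mono) auto
  then show "card (prime_power_pairs n) \<le> n ^ 2" by (simp add: card_cartesian_product power2_eq_square)
  show "2 ^ e \<le> n" if "(p, e) \<in> prime_power_pairs n" using key(3)[OF that] .
qed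

text \<open>
  A stabiliser is coded by the pair \<open>(p, e)\<close> with \<open>p ^ e = n\<close> and, for every generator, one vector and
  one \<open>e \<times> e\<close> matrix, that is \<open>e + 1\<close> vectors of \<open>W\<close>. By \<open>framed_kernel_eq\<close> the code determines it.
\<close>

lemma card_affine_kernels_le:
  fixes \<L> :: "'a set set"
  assumes T: "group T" "finite (carrier T)" "R \<subseteq> carrier T" "generate T R = carrier T"
    and n: "n \<ge> 2" and B: "\<And>e. 2 ^ e \<le> n \<Longrightarrow> n ^ (e + 1) \<le> B"
    and L: "\<And>L. L \<in> \<L> \<Longrightarrow> \<exists>(W :: ('w, 'c) monoid_scheme) \<pi> lin (p::nat). affine_kernel T n L W \<pi> lin p"
  shows "finite \<L> \<and> card \<L> \<le> n ^ 2 * B ^ card R"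
proof -
  define P where "P L y \<longleftrightarrow> (case y of ((p, e), c) \<Rightarrow> \<exists>(W :: ('w, 'c) monoid_scheme) \<pi> lin w.
      affine_action T W \<pi> lin \<and> framed W p e w \<and> L = {g \<in> carrier T. \<pi> g = \<one>\<^bsub>W\<^esub>} \<and>
      (\<forall>r\<in>R. \<pi> r = comm_group.lincomb W w e (fst (c r)) \<and>
        (\<forall>i<e. lin r (w i) = comm_group.lincomb W w e (snd (c r) i))))"
    for L :: "'a set" and y :: "(nat \<times> nat) \<times> ('a \<Rightarrow> (nat \<Rightarrow> nat) \<times> (nat \<Rightarrow> nat \<Rightarrow> nat))"
  define C where "C = (SIGMA pe : prime_power_pairs n. R \<rightarrow>\<^sub>E (coords (fst pe) (snd pe) \<times> ({..<snd pe} \<rightarrow>\<^sub>E coords (fst pe) (snd pe))))"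
  have finR: "finite R" using T(2,3) finite_subset by blast
  have finC': "finite (R \<rightarrow>\<^sub>E (coords p e \<times> ({..<e} \<rightarrow>\<^sub>E coords p e)))" for p e
    using finR by (intro finite_PiE finite_cartesian_product card_coords) auto
  have finC: "finite C" unfolding C_def using prime_power_pairs[OF n] finC' by (intro finite_SigmaI) auto
  have cardC: "card C \<le> n ^ 2 * B ^ card R"
  proof -
    have "card C = (\<Sum>pe\<in>prime_power_pairs n. card (R \<rightarrow>\<^sub>E (coords (fst pe) (snd pe) \<times> ({..<snd pe} \<rightarrow>\<^sub>E coords (fst pe) (snd pe)))))"
      unfolding C_def using prime_power_pairs[OF n] finC' by (intro card_SigmaI) auto
    also have "\<dots> \<le> (\<Sum>pe\<in>prime_power_pairs n. B ^ card R)"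
    proof (rule sum_mono)
      fix pe assume pe: "pe \<in> prime_power_pairs n"
      obtain p e where [simp]: "pe = (p, e)" by (cases pe)
      have pn: "p ^ e = n" "2 ^ e \<le> n" using pe prime_power_pairs(3)[OF n, of p e] by (auto simp: prime_power_pairs_def)
      have "card (R \<rightarrow>\<^sub>E (coords p e \<times> ({..<e} \<rightarrow>\<^sub>E coords p e))) = (n * n ^ e) ^ card R"
        using finR pn by (simp add: card_PiE card_cartesian_product card_coords)
      also have "\<dots> \<le> B ^ card R" using B[OF pn(2)] by (intro power_mono) auto
      finally show "card (R \<rightarrow>\<^sub>E (coords (fst pe) (snd pe) \<times> ({..<snd pe} \<rightarrow>\<^sub>E coords (fst pe) (snd pe)))) \<le> B ^ card R"
        by simp
    qed
    also have "\<dots> \<le> n ^ 2 * B ^ card R" using prime_power_pairs(2)[OF n] by simp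
    finally show ?thesis .
  qed
  have "finite \<L> \<and> card \<L> \<le> card C"
  proof (rule card_le_by_code[OF finC, where P = P])
    fix L assume "L \<in> \<L>"
    from L[OF this] obtain W :: "('w, 'c) monoid_scheme" and \<pi> lin and p :: nat where W: "Factorial_Ring.prime p" "affine_action T W \<pi> lin"
      "\<forall>w\<in>carrier W. w [^]\<^bsub>W\<^esub> p = \<one>\<^bsub>W\<^esub>" "card (carrier W) = n" "L = {g \<in> carrier T. \<pi> g = \<one>\<^bsub>W\<^esub>}"
      by - (elim exE conjE, rule that)
    note c = affine_actionD(1)[OF W(2)]
    obtain e w where fr: "framed W p e w" using framed_exists[OF c affine_actionD(2)[OF W(2)] W(1)] W(3) by blast
    have pe: "(p, e) \<in> prime_power_pairs n" using fr W by (simp add: prime_power_pairs_def framed_def)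
    define co where "co x = (SOME z. z \<in> coords p e \<and> x = comm_group.lincomb W w e z)" for x
    have co: "co x \<in> coords p e" "comm_group.lincomb W w e (co x) = x" if "x \<in> carrier W" for x
    proof -
      have "\<exists>z. z \<in> coords p e \<and> x = comm_group.lincomb W w e z" using framed_lincomb[OF c fr that] by blast
      from someI_ex[OF this] show "co x \<in> coords p e" "comm_group.lincomb W w e (co x) = x" by (simp_all add: co_def)
    qed
    define cd where "cd = (\<lambda>r\<in>R. (co (\<pi> r), \<lambda>i\<in>{..<e}. co (lin r (w i))))"
    have piW: "\<pi> r \<in> carrier W" and linW: "lin r (w i) \<in> carrier W" if "r \<in> R" for r i
    proof -
      have r: "r \<in> carrier T" using that T(3) by auto
      show "\<pi> r \<in> carrier W" using affine_actionD(6)[OF W(2) r] .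
      show "lin r (w i) \<in> carrier W" using hom_in_carrier[OF affine_actionD(4)[OF W(2) r]] fr by (simp add: framed_def)
    qed
    have "((p, e), cd) \<in> C"
      using pe co piW linW by (auto simp: C_def cd_def)
    moreover have "P L ((p, e), cd)"
      unfolding P_def prod.case
    proof (rule exI[of _ W], rule exI[of _ \<pi>], rule exI[of _ lin], rule exI[of _ w], intro conjI ballI allI impI)
      show "\<pi> r = comm_group.lincomb W w e (fst (cd r))" if "r \<in> R" for r
        using that co(2)[OF piW[OF that]] by (simp add: cd_def)
      show "lin r (w i) = comm_group.lincomb W w e (snd (cd r) i)" if "r \<in> R" "i < e" for r i
        using that co(2)[OF linW[OF that(1)]] by (simp add: cd_def)
    qed (rule W(2) fr W(5))+
    ultimately show "\<exists>y\<in>C. P L y" by blast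
  next
    fix L L' y assume PL: "P L y" and PL': "P L' y"
    obtain p e c where y: "y = ((p, e), c)" by (metis prod.exhaust)
    obtain W :: "('w, 'c) monoid_scheme" and \<pi> lin w where W: "affine_action T W \<pi> lin" "framed W p e w" "L = {g \<in> carrier T. \<pi> g = \<one>\<^bsub>W\<^esub>}"
      "\<forall>r\<in>R. \<pi> r = comm_group.lincomb W w e (fst (c r)) \<and> (\<forall>i<e. lin r (w i) = comm_group.lincomb W w e (snd (c r) i))"
      using PL unfolding P_def y prod.case by - (elim exE conjE, rule that)
    obtain W' :: "('w, 'c) monoid_scheme" and \<pi>' lin' w' where W': "affine_action T W' \<pi>' lin'" "framed W' p e w'" "L' = {g \<in> carrier T. \<pi>' g = \<one>\<^bsub>W'\<^esub>}"
      "\<forall>r\<in>R. \<pi>' r = comm_group.lincomb W' w' e (fst (c r)) \<and> (\<forall>i<e. lin' r (w' i) = comm_group.lincomb W' w' e (snd (c r) i))"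
      using PL' unfolding P_def y prod.case by - (elim exE conjE, rule that)
    note cg = affine_actionD(1)[OF W(1)] affine_actionD(1)[OF W'(1)]
    show "L = L'" unfolding W(3) W'(3)
    proof (rule framed_kernel_eq[OF T W(1) W'(1) W(2) W'(2)])
      show "(\<pi> r, \<pi>' r) \<in> graph_span W W' e w w'" if "r \<in> R" for r
        using graph_span(4)[OF cg W(2) W'(2), of "fst (c r)"] W(4) W'(4) that by simp
      show "(lin r (w i), lin' r (w' i)) \<in> graph_span W W' e w w'" if "r \<in> R" "i < e" for r i
        using graph_span(4)[OF cg W(2) W'(2), of "snd (c r) i"] W(4) W'(4) that by simp
    qed
  qed
  then show ?thesis using cardC by linarith
qed

section \<open>Semilinear affine actions are few\<close>

text \<open>
  The sequence \<open>s\<close> is an orbit in a set of \<open>q\<close> elements, hence periodic from an index \<open>a \<le> q\<close> on with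
  some period \<open>P \<le> q\<close>. Exponents may be reduced modulo \<open>P\<close> as long as they stay at least \<open>q\<close>, which
  brings them below \<open>2 * q\<close>.
\<close>

lemma affine_exponents_reduce:
  fixes s :: "nat \<Rightarrow> 'w"
  assumes fin: "finite C" and card: "card C = q" and C: "\<And>i. s i \<in> C" and step: "\<And>i. s (Suc i) = \<phi> (s i)"
  shows "\<exists>\<rho>' < 2 * q. \<exists>u' < 2 * q. \<forall>i. s (\<rho> * i + u) = s (\<rho>' * i + u')"
proof -
  have "\<not> inj_on s {..q}"
  proof
    assume "inj_on s {..q}"
    then have "card {..q} \<le> card C" using C fin by (intro card_inj_on_le) auto
    then show False using card by simp
  qed
  then obtain a b where ab: "a < b" "b \<le> q" "s a = s b"
    unfolding inj_on_def by (metis atMost_iff linorder_neqE_nat)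
  define P where "P = b - a"
  have P: "0 < P" "P \<le> q" "a \<le> q" using ab by (auto simp: P_def)
  have per1: "s (k + P) = s k" if "k \<ge> a" for k
    using that
  proof (induction k rule: dec_induct)
    case base
    then show ?case using ab by (simp add: P_def)
  next
    case (step k)
    then show ?case by (simp add: assms(4))
  qed
  have per: "s (k + P * m) = s k" if "k \<ge> a" for k m
  proof (induction m)
    case (Suc m)
    have "s (k + P * Suc m) = s ((k + P * m) + P)" by (simp add: algebra_simps)
    also have "\<dots> = s (k + P * m)" using that by (intro per1) simp
    finally show ?case using Suc by simp
  qed simp
  define red where "red x = (if x < q then x else q + (x - q) mod P)" for x
  have red_lt: "red x < 2 * q" if "q > 0" for x
    using P that mod_less_divisor[OF P(1), of "x - q"] by (auto simp: red_def)
  have q0: "q > 0" using P by linarith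
  have red_eq: "\<exists>m. x = red x + P * m \<and> (m = 0 \<or> red x \<ge> q)" for x
  proof (cases "x < q")
    case True
    then show ?thesis by (intro exI[of _ 0]) (simp add: red_def)
  next
    case False
    have "x = q + (x - q)" using False by simp
    also have "\<dots> = q + ((x - q) mod P + P * ((x - q) div P))" by simp
    finally show ?thesis using False by (intro exI[of _ "(x - q) div P"]) (simp add: red_def)
  qed
  have "s (\<rho> * i + u) = s (red \<rho> * i + red u)" for i
  proof -
    obtain m where m: "\<rho> = red \<rho> + P * m" "m = 0 \<or> red \<rho> \<ge> q" using red_eq by blast
    obtain l where l: "u = red u + P * l" "l = 0 \<or> red u \<ge> q" using red_eq by blast
    have "s (\<rho> * i + u) = s (red \<rho> * i + u)"
    proof (cases "i = 0 \<or> m = 0")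
      case True
      then show ?thesis using m by auto
    next
      case False
      then have "red \<rho> * i \<ge> q" using m(2) by (metis le_trans mult.right_neutral mult_le_mono2 One_nat_def Suc_leI gr0I)
      then have "red \<rho> * i + u \<ge> a" using P by linarith
      moreover have "\<rho> * i + u = (red \<rho> * i + u) + P * (m * i)" by (subst m(1)) (simp add: algebra_simps)
      ultimately show ?thesis using per by metis
    qed
    also have "\<dots> = s (red \<rho> * i + red u)"
    proof (cases "l = 0")
      case True
      then show ?thesis using l by simp
    next
      case False
      then have "red \<rho> * i + red u \<ge> a" using l(2) P by linarith
      moreover have "red \<rho> * i + u = (red \<rho> * i + red u) + P * l" using l(1) by simp
      ultimately show ?thesis using per by metis
    qed
    finally show ?thesis .
  qed
  then show ?thesis using red_lt[OF q0] by blast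
qed

lemma End_pow_Suc:
  assumes "comm_group W" "\<zeta> \<in> carrier (End W)" "v \<in> carrier W"
  shows "(\<zeta> [^]\<^bsub>End W\<^esub> (i::nat)) v \<in> carrier W" "(\<zeta> [^]\<^bsub>End W\<^esub> Suc i) v = \<zeta> ((\<zeta> [^]\<^bsub>End W\<^esub> i) v)"
proof -
  interpret W: comm_group W by fact
  interpret R: ring "End W" by (rule W.End_ring)
  show "(\<zeta> [^]\<^bsub>End W\<^esub> i) v \<in> carrier W" by (rule End_closed[OF R.nat_pow_closed[OF assms(2)] assms(3)])
  show "(\<zeta> [^]\<^bsub>End W\<^esub> Suc i) v = \<zeta> ((\<zeta> [^]\<^bsub>End W\<^esub> i) v)"
    unfolding R.nat_pow_Suc2[OF assms(2)] using assms by (simp add: End_apply)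
qed

text \<open>
  As in linear algebra, the powers of \<open>\<zeta>\<close> applied to \<open>v\<close> form a basis up to the first that depends on
  its predecessors.
\<close>

lemma cyclic_frame:
  assumes W: "comm_group W" and fin: "finite (carrier W)" and p: "Factorial_Ring.prime (p::nat)"
    and exp: "\<And>w. w \<in> carrier W \<Longrightarrow> w [^]\<^bsub>W\<^esub> p = \<one>\<^bsub>W\<^esub>"
    and s: "\<And>i. s i \<in> carrier W" "\<And>i. s (Suc i) = \<zeta> (s i)" and \<zeta>: "\<zeta> \<in> hom W W"
    and all: "carrier W = insert \<one>\<^bsub>W\<^esub> (range s)"
  shows "\<exists>e. framed W p e s"
proof -
  interpret W: comm_group W by fact
  have "\<exists>e. s e \<in> generate W (s ` {..<e})"
  proof (rule ccontr)
    assume "\<not> ?thesis"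
    then have "card (generate W (s ` {..<e})) = p ^ e" for e
      by (intro W.card_generate_eq) (use s exp p in auto)
    moreover have "card (generate W (s ` {..<e})) \<le> card (carrier W)" for e
      using s fin by (intro card_mono W.generate_incl) auto
    ultimately have "p ^ card (carrier W) \<le> card (carrier W)" by metis
    moreover have "card (carrier W) < p ^ card (carrier W)" using prime_gt_1_nat[OF p] by (simp add: power_gt_expt)
    ultimately show False by simp
  qed
  then obtain e where e: "s e \<in> generate W (s ` {..<e})" and least: "\<And>i. i < e \<Longrightarrow> s i \<notin> generate W (s ` {..<i})"
    using exists_least_iff[of "\<lambda>e. s e \<in> generate W (s ` {..<e})"] by blast
  let ?H = "generate W (s ` {..<e})"
  have sub: "s ` {..<e} \<subseteq> carrier W" using s by auto
  have H: "subgroup ?H W" using W.generate_is_subgroup[OF sub] .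
  have "\<zeta> ` ?H \<subseteq> ?H"
  proof (rule hom_generate_subset[OF W.is_group W.is_group \<zeta> sub H], clarify)
    fix i assume "i < e"
    then consider "Suc i = e" | "Suc i < e" by linarith
    then have "s (Suc i) \<in> ?H" by cases (use e in \<open>auto intro: generate.incl\<close>)
    then show "\<zeta> (s i) \<in> ?H" by (simp only: s(2))
  qed
  moreover have "s 0 \<in> ?H" using e by (cases "e = 0") (auto intro: generate.incl)
  ultimately have "s k \<in> ?H" for k by (induction k) (auto simp: s(2))
  then have "carrier W \<subseteq> ?H" using all subgroup.one_closed[OF H] by auto
  then have HW: "?H = carrier W" using subgroup.subset[OF H] by auto
  moreover have "card ?H = p ^ e" by (rule W.card_generate_eq) (use s exp p least in auto)
  ultimately show ?thesis using s exp prime_gt_0_nat[OF p] by (intro exI[of _ e]) (simp add: framed_def)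
qed

text \<open>
  With respect to the frame \<open>\<zeta> ^ i v\<close> an affine action is coded by few numbers: the pair \<open>(p, e)\<close>, the
  coordinates of \<open>\<zeta> ^ e v\<close>, which determine \<open>\<zeta>\<close>, and for each generator the exponents \<open>\<rho>\<close> and \<open>u\<close>
  of its linear part and the exponent of its translation. These contribute the factors \<open>q ^ 2\<close>, \<open>q\<close> and
  \<open>2 * q * (2 * q * (2 * q + 1)) \<le> q ^ 7\<close>.
\<close>

lemma card_semilinear_kernels_le:
  fixes \<L> :: "'a set set"
  assumes T: "group T" "finite (carrier T)" "R \<subseteq> carrier T" "generate T R = carrier T"
    and q: "q \<ge> 2"
    and L: "\<And>L. L \<in> \<L> \<Longrightarrow> \<exists>(W :: ('w, 'c) monoid_scheme) \<pi> lin (p::nat). semilinear_kernel T q L W \<pi> lin p"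
  shows "finite \<L> \<and> card \<L> \<le> q ^ (3 + 7 * card R)"
proof -
  \<comment> \<open>The translation exponent \<open>k = 2 * q\<close> stands for the zero vector, which need not occur among
    the \<open>\<zeta> ^ i v\<close>.\<close>
  define P where "P L y \<longleftrightarrow> (case y of ((p, e), f, c) \<Rightarrow> \<exists>(W :: ('w, 'c) monoid_scheme) \<pi> lin \<zeta> s.
      affine_action T W \<pi> lin \<and> framed W p e s \<and> L = {g \<in> carrier T. \<pi> g = \<one>\<^bsub>W\<^esub>} \<and> \<zeta> \<in> hom W W \<and>
      (\<forall>i. s (Suc i) = \<zeta> (s i)) \<and> s e = comm_group.lincomb W s e f \<and>
      (\<forall>r\<in>R. case c r of (\<rho>, u, k) \<Rightarrow> (\<forall>i. lin r (s i) = s (\<rho> * i + u)) \<and> \<pi> r = (if k = 2 * q then \<one>\<^bsub>W\<^esub> else s k)))"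
    for L :: "'a set" and y :: "(nat \<times> nat) \<times> (nat \<Rightarrow> nat) \<times> ('a \<Rightarrow> nat \<times> nat \<times> nat)"
  define C where "C = (SIGMA pe : prime_power_pairs q. coords (fst pe) (snd pe) \<times> (R \<rightarrow>\<^sub>E ({..<2 * q} \<times> {..<2 * q} \<times> {..2 * q})))"
  have finR: "finite R" using T(2,3) finite_subset by blast
  have finC': "finite (coords p e \<times> (R \<rightarrow>\<^sub>E ({..<2 * q} \<times> {..<2 * q} \<times> {..2 * q})))" for p e
    using finR card_coords by (intro finite_PiE finite_cartesian_product) auto
  have finC: "finite C" unfolding C_def by (rule finite_SigmaI[OF prime_power_pairs(1)[OF q] finC'])
  have cardC: "card C \<le> q ^ (3 + 7 * card R)"
  proof -
    have q2: "2 * q \<le> q ^ 2" using q by (simp add: power2_eq_square)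
    have "Suc (2 * q) \<le> 2 * q ^ 2" using q2 q by linarith
    also have "\<dots> \<le> q ^ 3" using q by (simp add: power2_eq_square power3_eq_cube)
    finally have q3: "Suc (2 * q) \<le> q ^ 3" .
    have q7: "2 * q * (2 * q * Suc (2 * q)) \<le> q ^ 7"
    proof -
      have "2 * q * (2 * q * Suc (2 * q)) \<le> q ^ 2 * (q ^ 2 * q ^ 3)" by (intro mult_mono q2 q3) auto
      also have "\<dots> = q ^ 7" by (simp flip: power_add)
      finally show ?thesis .
    qed
    have "card C = (\<Sum>pe\<in>prime_power_pairs q. card (coords (fst pe) (snd pe) \<times> (R \<rightarrow>\<^sub>E ({..<2 * q} \<times> {..<2 * q} \<times> {..2 * q}))))"
      unfolding C_def by (rule card_SigmaI[OF prime_power_pairs(1)[OF q]]) (intro ballI finC')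
    also have "\<dots> \<le> (\<Sum>pe\<in>prime_power_pairs q. q * (q ^ 7) ^ card R)"
    proof (rule sum_mono)
      fix pe assume pe: "pe \<in> prime_power_pairs q"
      have "card (coords (fst pe) (snd pe) \<times> (R \<rightarrow>\<^sub>E ({..<2 * q} \<times> {..<2 * q} \<times> {..2 * q}))) = q * (2 * q * (2 * q * Suc (2 * q))) ^ card R"
        using finR pe by (auto simp: card_PiE card_cartesian_product card_coords prime_power_pairs_def)
      also have "\<dots> \<le> q * (q ^ 7) ^ card R" using q7 by (intro mult_left_mono power_mono) auto
      finally show "card (coords (fst pe) (snd pe) \<times> (R \<rightarrow>\<^sub>E ({..<2 * q} \<times> {..<2 * q} \<times> {..2 * q}))) \<le> q * (q ^ 7) ^ card R" .
    qed
    also have "\<dots> \<le> q ^ 2 * (q * (q ^ 7) ^ card R)" using prime_power_pairs(2)[OF q] by (simp add: mult_right_mono)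
    also have "\<dots> = q ^ (3 + 7 * card R)" by (simp add: power_add power_mult power2_eq_square power3_eq_cube)
    finally show ?thesis .
  qed
  have "finite \<L> \<and> card \<L> \<le> card C"
  proof (rule card_le_by_code[OF finC, where P = P])
    fix L assume "L \<in> \<L>"
    from L[OF this] obtain W :: "('w, 'c) monoid_scheme" and \<pi> lin and p :: nat where W: "Factorial_Ring.prime p" "affine_action T W \<pi> lin"
      "\<forall>w\<in>carrier W. w [^]\<^bsub>W\<^esub> p = \<one>\<^bsub>W\<^esub>" "card (carrier W) = q" "L = {g \<in> carrier T. \<pi> g = \<one>\<^bsub>W\<^esub>}"
      "semilinear W (carrier T) lin"
      by - (elim exE conjE, rule that)
    note c = affine_actionD(1)[OF W(2)] and fin = affine_actionD(2)[OF W(2)]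
    from W(6) obtain \<zeta> v where z: "\<zeta> \<in> carrier (End W)" and v: "v \<in> carrier W"
      and gen: "carrier W = insert \<one>\<^bsub>W\<^esub> (range (\<lambda>i::nat. (\<zeta> [^]\<^bsub>End W\<^esub> i) v))"
      and lin: "\<forall>g\<in>carrier T. \<exists>\<rho> u. \<forall>i::nat. lin g ((\<zeta> [^]\<^bsub>End W\<^esub> i) v) = (\<zeta> [^]\<^bsub>End W\<^esub> (\<rho> * i + u)) v"
      unfolding semilinear_def by - (elim bexE conjE, rule that)
    define s where "s i = (\<zeta> [^]\<^bsub>End W\<^esub> (i::nat)) v" for i
    have sW: "s i \<in> carrier W" and sS: "s (Suc i) = \<zeta> (s i)" for i using End_pow_Suc[OF c z v] by (simp_all add: s_def)
    have all: "carrier W = insert \<one>\<^bsub>W\<^esub> (range s)" unfolding s_def[abs_def] by (rule gen)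
    have zh: "\<zeta> \<in> hom W W" using z by (simp add: End_mem)
    obtain e where fr: "framed W p e s" using cyclic_frame[OF c fin W(1) _ sW sS zh all] W(3) by blast
    have pe: "(p, e) \<in> prime_power_pairs q" using fr W by (simp add: prime_power_pairs_def framed_def)
    obtain f where f: "f \<in> coords p e" "s e = comm_group.lincomb W s e f" using framed_lincomb[OF c fr sW] by blast
    have red: "\<exists>\<rho>' < 2 * q. \<exists>u' < 2 * q. \<forall>i. s (\<rho> * i + u) = s (\<rho>' * i + u')" for \<rho> u
      by (rule affine_exponents_reduce[where s = s and \<phi> = \<zeta> and C = "carrier W"]) (rule fin W(4) sW sS)+
    have "\<exists>y. y \<in> {..<2 * q} \<times> {..<2 * q} \<times> {..2 * q} \<and> (case y of (\<rho>, u, k) \<Rightarrow>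
       (\<forall>i. lin r (s i) = s (\<rho> * i + u)) \<and> \<pi> r = (if k = 2 * q then \<one>\<^bsub>W\<^esub> else s k))" if r: "r \<in> R" for r
    proof -
      have rT: "r \<in> carrier T" using r T(3) by auto
      obtain \<rho> u where ru: "\<And>i. lin r (s i) = s (\<rho> * i + u)" using lin rT unfolding s_def by blast
      obtain \<rho>' u' where ru': "\<rho>' < 2 * q" "u' < 2 * q" "\<And>i. s (\<rho> * i + u) = s (\<rho>' * i + u')"
        using red by metis
      have "\<exists>k\<le>2 * q. \<pi> r = (if k = 2 * q then \<one>\<^bsub>W\<^esub> else s k)"
      proof (cases "\<pi> r = \<one>\<^bsub>W\<^esub>")
        case True
        then show ?thesis by (intro exI[of _ "2 * q"]) simp
      next
        case False
        then obtain k where k: "\<pi> r = s k" using affine_actionD(6)[OF W(2) rT] all by blast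
        obtain \<rho>'' k' where k': "k' < 2 * q" "\<And>i. s (0 * i + k) = s (\<rho>'' * i + k')"
          using red by metis
        have "s k = s k'" using k'(2)[of 0] by simp
        then show ?thesis using k k'(1) by (intro exI[of _ k']) simp
      qed
      then obtain k where k: "k \<le> 2 * q" "\<pi> r = (if k = 2 * q then \<one>\<^bsub>W\<^esub> else s k)" by blast
      show ?thesis
      proof (rule exI[of _ "(\<rho>', u', k)"], unfold prod.case, intro conjI allI)
        show "lin r (s i) = s (\<rho>' * i + u')" for i using ru[of i] ru'(3)[of i] by (rule trans)
      qed (use ru' k in auto)
    qed
    note ex_code = this
    define c0 where "c0 r = (SOME y. y \<in> {..<2 * q} \<times> {..<2 * q} \<times> {..2 * q} \<and> (case y of (\<rho>, u, k) \<Rightarrow>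
       (\<forall>i. lin r (s i) = s (\<rho> * i + u)) \<and> \<pi> r = (if k = 2 * q then \<one>\<^bsub>W\<^esub> else s k)))" for r
    have c0: "c0 r \<in> {..<2 * q} \<times> {..<2 * q} \<times> {..2 * q} \<and> (case c0 r of (\<rho>, u, k) \<Rightarrow>
       (\<forall>i. lin r (s i) = s (\<rho> * i + u)) \<and> \<pi> r = (if k = 2 * q then \<one>\<^bsub>W\<^esub> else s k))" if "r \<in> R" for r
      unfolding c0_def by (rule someI_ex[OF ex_code[OF that]])
    define cd where "cd = restrict c0 R"
    have cdR: "cd \<in> R \<rightarrow>\<^sub>E ({..<2 * q} \<times> {..<2 * q} \<times> {..2 * q})"
      unfolding cd_def using c0 by (intro restrict_PiE_iff[THEN iffD2] ballI) blast
    have "((p, e), f, cd) \<in> C" unfolding C_def by (intro SigmaI pe) (simp_all add: f(1) cdR)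
    moreover have "P L ((p, e), f, cd)"
      unfolding P_def prod.case
    proof (rule exI[of _ W], rule exI[of _ \<pi>], rule exI[of _ lin], rule exI[of _ \<zeta>], rule exI[of _ s], intro conjI ballI allI)
      show "case cd r of (\<rho>, u, k) \<Rightarrow> (\<forall>i. lin r (s i) = s (\<rho> * i + u)) \<and> \<pi> r = (if k = 2 * q then \<one>\<^bsub>W\<^esub> else s k)" if "r \<in> R" for r
        using c0[OF that] that by (simp add: cd_def)
    qed (rule W(2) fr W(5) zh sS f(2))+
    ultimately show "\<exists>y\<in>C. P L y" by blast
  next
    fix L L' y assume PL: "P L y" and PL': "P L' y"
    obtain p e f c where y: "y = ((p, e), f, c)" by (metis prod.exhaust)
    obtain W :: "('w, 'c) monoid_scheme" and \<pi> lin \<zeta> s where W: "affine_action T W \<pi> lin" "framed W p e s" "L = {g \<in> carrier T. \<pi> g = \<one>\<^bsub>W\<^esub>}"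
      "\<zeta> \<in> hom W W" "\<forall>i. s (Suc i) = \<zeta> (s i)" "s e = comm_group.lincomb W s e f"
      "\<forall>r\<in>R. case c r of (\<rho>, u, k) \<Rightarrow> (\<forall>i. lin r (s i) = s (\<rho> * i + u)) \<and> \<pi> r = (if k = 2 * q then \<one>\<^bsub>W\<^esub> else s k)"
      using PL unfolding P_def y prod.case by - (elim exE conjE, rule that)
    obtain W' :: "('w, 'c) monoid_scheme" and \<pi>' lin' \<zeta>' s' where W': "affine_action T W' \<pi>' lin'" "framed W' p e s'" "L' = {g \<in> carrier T. \<pi>' g = \<one>\<^bsub>W'\<^esub>}"
      "\<zeta>' \<in> hom W' W'" "\<forall>i. s' (Suc i) = \<zeta>' (s' i)" "s' e = comm_group.lincomb W' s' e f"
      "\<forall>r\<in>R. case c r of (\<rho>, u, k) \<Rightarrow> (\<forall>i. lin' r (s' i) = s' (\<rho> * i + u)) \<and> \<pi>' r = (if k = 2 * q then \<one>\<^bsub>W'\<^esub> else s' k)"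
      using PL' unfolding P_def y prod.case by - (elim exE conjE, rule that)
    note cg = affine_actionD(1)[OF W(1)] affine_actionD(1)[OF W'(1)]
    let ?D = "graph_span W W' e s s'"
    have se: "(s e, s' e) \<in> ?D" unfolding W(6) W'(6) by (rule graph_span(4)[OF cg W(2) W'(2)])
    have sD: "(s i, s' i) \<in> ?D" for i
    proof (induction i)
      case 0
      show ?case
      proof (cases "e = 0")
        case True
        then show ?thesis using se by simp
      next
        case False
        then show ?thesis using graph_span(3)[OF cg W(2) W'(2), of 0] by simp
      qed
    next
      case (Suc i)
      have "(\<zeta> (s i), \<zeta>' (s' i)) \<in> ?D"
      proof (rule graph_span_map[OF cg W(2) W'(2) W(4) W'(4) _ Suc])
        fix j assume "j < e"
        then consider "Suc j < e" | "Suc j = e" by linarith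
        then have "(s (Suc j), s' (Suc j)) \<in> ?D"
          by cases (use graph_span(3)[OF cg W(2) W'(2)] se in auto)
        then show "(\<zeta> (s j), \<zeta>' (s' j)) \<in> ?D" using W(5) W'(5) by simp
      qed
      then show ?case using W(5) W'(5) by simp
    qed
    show "L = L'" unfolding W(3) W'(3)
    proof (rule framed_kernel_eq[OF T W(1) W'(1) W(2) W'(2)])
      fix r assume r: "r \<in> R"
      obtain \<rho> u k where ck: "c r = (\<rho>, u, k)" by (metis prod.exhaust)
      have 1: "\<forall>i. lin r (s i) = s (\<rho> * i + u)" "\<pi> r = (if k = 2 * q then \<one>\<^bsub>W\<^esub> else s k)"
        using bspec[OF W(7) r] unfolding ck prod.case by simp_all
      have 2: "\<forall>i. lin' r (s' i) = s' (\<rho> * i + u)" "\<pi>' r = (if k = 2 * q then \<one>\<^bsub>W'\<^esub> else s' k)"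
        using bspec[OF W'(7) r] unfolding ck prod.case by simp_all
      show "(\<pi> r, \<pi>' r) \<in> ?D"
        using subgroup.one_closed[OF graph_span(1)[OF cg W(2) W'(2)]] sD[of k] by (simp add: 1(2) 2(2))
      show "(lin r (s i), lin' r (s' i)) \<in> ?D" for i using sD[of "\<rho> * i + u"] 1(1) 2(1) by simp
    qed
  qed
  then show ?thesis using cardC by linarith
qed

section \<open>Subgroups of given index\<close>

text \<open>
  The Schreier elements \<open>rep C \<otimes> g \<otimes> inv (rep (C #> g))\<close> with \<open>g\<close> among the generators. The element
  for a product is the product of the elements for the factors, so those for generators generate all of
  them, and choosing \<open>\<one>\<close> as the representative of \<open>L\<close> itself makes every \<open>g \<in> L\<close> one of them.
\<close>

lemma (in group) schreier_generators:
  assumes fin: "finite (carrier G)" and R: "R \<subseteq> carrier G" "generate G R = carrier G"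
    and L: "subgroup L G" and n: "card (carrier G) = n * card L"
  shows "\<exists>R'\<subseteq>L. generate (G\<lparr>carrier := L\<rparr>) R' = L \<and> card R' \<le> n * card R"
proof -
  interpret L: subgroup L G by fact
  define rep where "rep C = (if C = L then \<one> else SOME y. y \<in> C)" for C
  have rep: "rep C \<in> C" "rep C \<in> carrier G" if C: "C \<in> rcosets L" for C
  proof -
    have "C \<noteq> {}" using L.rcosets_non_empty[OF C] .
    then show r: "rep C \<in> C" using L.one_closed by (simp add: rep_def some_in_eq)
    then show "rep C \<in> carrier G" using L.rcosets_carrier[OF is_group C] by auto
  qed
  have Crep: "C = L #> rep C" if C: "C \<in> rcosets L" for C
  proof -
    obtain x where x: "x \<in> carrier G" "C = L #> x" using C unfolding RCOSETS_def by blast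
    show ?thesis using repr_independence[of "rep C" L x] rep[OF C] x L.subgroup_axioms by simp
  qed
  have Cmem: "L #> g \<in> rcosets L" if "g \<in> carrier G" for g using rcosetsI[OF L.subset that] .
  define s where "s C g = rep C \<otimes> g \<otimes> inv (rep (C #> g))" for C g
  have Cg: "C #> g \<in> rcosets L" if C: "C \<in> rcosets L" and g: "g \<in> carrier G" for C g
  proof -
    have "C #> g = L #> (rep C \<otimes> g)" using coset_mult_assoc[OF L.subset rep(2)[OF C] g] Crep[OF C] by simp
    then show ?thesis using Cmem rep(2)[OF C] g by simp
  qed
  have Cgh: "C #> g #> h = C #> (g \<otimes> h)" if C: "C \<in> rcosets L" and g: "g \<in> carrier G" "h \<in> carrier G" for C g h
    using coset_mult_assoc[OF L.rcosets_carrier[OF is_group C] g] .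
  have sL: "s C g \<in> L" if C: "C \<in> rcosets L" and g: "g \<in> carrier G" for C g
  proof -
    have "rep C \<otimes> g \<in> C #> g" using rep[OF C] by (auto simp: r_coset_def)
    then have "rep C \<otimes> g \<in> L #> rep (C #> g)" using Crep[OF Cg[OF C g]] by simp
    then obtain l where l: "l \<in> L" "rep C \<otimes> g = l \<otimes> rep (C #> g)" by (auto simp: r_coset_def)
    have "s C g = l" unfolding s_def l(2) using l(1) rep(2)[OF Cg[OF C g]] by (simp add: m_assoc)
    then show ?thesis using l by simp
  qed
  define R' where "R' = (\<lambda>(C, r). s C r) ` ((rcosets L) \<times> R)"
  have R'L: "R' \<subseteq> L" using sL R(1) by (auto simp: R'_def)
  have finc: "finite (rcosets L)" "finite R" using fin R(1) finite_subset cosets_finite by (auto simp: RCOSETS_def)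
  have finL: "finite L" using fin L.subset finite_subset by blast
  have "card L > 0" using finL L.one_closed card_gt_0_iff by blast
  then have "card (rcosets L) = n" using lagrange[OF L] n by (simp add: order_def)
  then have cardR': "card R' \<le> n * card R"
    unfolding R'_def using card_image_le[of "(rcosets L) \<times> R" "\<lambda>(C, r). s C r"] finc by (simp add: card_cartesian_product)
  define H where "H = generate G R'"
  have R'G: "R' \<subseteq> carrier G" using R'L L.subset by auto
  have H: "subgroup H G" unfolding H_def by (rule generate_is_subgroup[OF R'G])
  have HL: "H \<subseteq> L" unfolding H_def by (rule generate_subgroup_incl[OF R'L L])
  define E where "E = {g \<in> carrier G. \<forall>C\<in>rcosets L. s C g \<in> H}"
  have smult: "s C (g \<otimes> h) = s C g \<otimes> s (C #> g) h" if C: "C \<in> rcosets L" and g: "g \<in> carrier G" and h: "h \<in> carrier G" for C g h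
    unfolding s_def Cgh[OF C g h] using rep(2)[OF C] rep(2)[OF Cg[OF C g]] rep(2)[OF Cg[OF Cg[OF C g] h]] g h
    by (simp add: m_assoc Cgh[OF C g h])
  have "E = carrier G"
  proof (rule finite_submonoid_is_all[OF fin R(2)])
    show "R \<subseteq> E"
    proof
      fix r assume r: "r \<in> R"
      have "s C r \<in> H" if "C \<in> rcosets L" for C
        unfolding H_def by (rule generate.incl) (use that r in \<open>auto simp: R'_def\<close>)
      then show "r \<in> E" using r R(1) by (auto simp: E_def)
    qed
    show "\<one> \<in> E"
    proof -
      have "s C \<one> = \<one>" if C: "C \<in> rcosets L" for C
        using rep(2)[OF C] L.rcosets_carrier[OF is_group C] by (simp add: s_def)
      then show ?thesis using subgroup.one_closed[OF H] by (simp add: E_def)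
    qed
    show "g \<otimes> h \<in> E" if g: "g \<in> E" and h: "h \<in> E" for g h
    proof -
      have gh: "g \<in> carrier G" "h \<in> carrier G" using g h by (auto simp: E_def)
      have "s C (g \<otimes> h) \<in> H" if C: "C \<in> rcosets L" for C
        using smult[OF C gh] g h C Cg[OF C gh(1)] subgroup.m_closed[OF H] by (simp add: E_def)
      then show ?thesis using gh by (simp add: E_def)
    qed
  qed (auto simp: E_def)
  have "L \<subseteq> H"
  proof
    fix g assume g: "g \<in> L"
    have LL: "L \<in> rcosets L" using L.subgroup_in_rcosets[OF is_group] .
    have gE: "g \<in> E" using \<open>E = carrier G\<close> g by auto
    have "L #> g = L" using L.rcos_const[OF is_group g] .
    then have "s L g = g" using g by (simp add: s_def rep_def)
    then show "g \<in> H" using gE LL unfolding E_def by force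
  qed
  then have "H = L" using HL by simp
  then have "generate (G\<lparr>carrier := L\<rparr>) R' = L" using generate_consistent[OF R'L L] by (simp add: H_def)
  then show ?thesis using R'L cardR' by blast
qed

lemma (in normal) conj_r_coset:
  assumes g: "g \<in> carrier G" and x: "x \<in> carrier G"
  shows "(\<lambda>y. g \<otimes> y \<otimes> inv g) ` (H #> x) = H #> (g \<otimes> x \<otimes> inv g)"
proof
  show "(\<lambda>y. g \<otimes> y \<otimes> inv g) ` (H #> x) \<subseteq> H #> (g \<otimes> x \<otimes> inv g)"
  proof (rule image_subsetI)
    fix y assume "y \<in> H #> x"
    then obtain h where h: "h \<in> H" "y = h \<otimes> x" by (auto simp: r_coset_def)
    have "g \<otimes> y \<otimes> inv g = (g \<otimes> h \<otimes> inv g) \<otimes> (g \<otimes> x \<otimes> inv g)" using h g x by (simp add: m_assoc)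
    then show "g \<otimes> y \<otimes> inv g \<in> H #> (g \<otimes> x \<otimes> inv g)" using inv_op_closed2[OF g h(1)] by (auto simp: r_coset_def)
  qed
  show "H #> (g \<otimes> x \<otimes> inv g) \<subseteq> (\<lambda>y. g \<otimes> y \<otimes> inv g) ` (H #> x)"
  proof
    fix z assume "z \<in> H #> (g \<otimes> x \<otimes> inv g)"
    then obtain h where h: "h \<in> H" "z = h \<otimes> (g \<otimes> x \<otimes> inv g)" by (auto simp: r_coset_def)
    have "z = g \<otimes> ((inv g \<otimes> h \<otimes> g) \<otimes> x) \<otimes> inv g" using h g x by (simp add: m_assoc)
    moreover have "(inv g \<otimes> h \<otimes> g) \<otimes> x \<in> H #> x" using inv_op_closed1[OF g h(1)] by (auto simp: r_coset_def)
    ultimately show "z \<in> (\<lambda>y. g \<otimes> y \<otimes> inv g) ` (H #> x)" by blast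
  qed
qed

text \<open>
  If \<open>G = V T\<close> and \<open>V / (V \<inter> T)\<close> is abelian, then \<open>G\<close> acts on \<open>V / (V \<inter> T)\<close>, identified with \<open>G / T\<close>: here
  \<open>V\<close> acts by translations and \<open>T\<close> by conjugation, and \<open>T\<close> is the stabiliser of the origin.
\<close>

lemma (in group) affine_of_supplement:
  assumes fin: "finite (carrier G)" and V: "V \<lhd> G" and T: "subgroup T G"
    and dec: "\<And>g. g \<in> carrier G \<Longrightarrow> \<exists>v\<in>V. \<exists>t\<in>T. g = v \<otimes> t"
    and comm: "\<And>v w. v \<in> V \<Longrightarrow> w \<in> V \<Longrightarrow> v \<otimes> w \<otimes> inv v \<otimes> inv w \<in> T"
  shows "\<exists>\<pi>. affine_action G (G\<lparr>carrier := V\<rparr> Mod (V \<inter> T)) \<pi> (\<lambda>g C. (\<lambda>x. g \<otimes> x \<otimes> inv g) ` C) \<and>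
     T = {g \<in> carrier G. \<pi> g = \<one>\<^bsub>G\<lparr>carrier := V\<rparr> Mod (V \<inter> T)\<^esub>}"
proof -
  interpret V: normal V G by fact
  interpret T: subgroup T G by fact
  define B where "B = V \<inter> T"
  have BV: "B \<subseteq> V" and BT: "B \<subseteq> T" by (auto simp: B_def)
  have B: "B \<lhd> G"
    unfolding normal_inv_iff
  proof (intro conjI ballI)
    show "subgroup B G" unfolding B_def using subgroups_Inter_pair[OF V.subgroup_axioms T] .
    fix g b assume g: "g \<in> carrier G" and b: "b \<in> B"
    obtain v t where vt: "v \<in> V" "t \<in> T" "g = v \<otimes> t" using dec[OF g] by blast
    have bc: "b \<in> carrier G" using b BV by auto
    define c where "c = t \<otimes> b \<otimes> inv t"
    have cV: "c \<in> V" unfolding c_def by (rule V.inv_op_closed2) (use vt b BV in auto)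
    have cT: "c \<in> T" unfolding c_def using vt b BT by auto
    have "g \<otimes> b \<otimes> inv g = (v \<otimes> c \<otimes> inv v \<otimes> inv c) \<otimes> c"
      using vt bc cV by (simp add: c_def m_assoc inv_mult_group)
    moreover have "(v \<otimes> c \<otimes> inv v \<otimes> inv c) \<otimes> c \<in> T" using comm[OF vt(1) cV] cT by simp
    moreover have "g \<otimes> b \<otimes> inv g \<in> V" by (rule V.inv_op_closed2[OF g]) (use b BV in auto)
    ultimately show "g \<otimes> b \<otimes> inv g \<in> B" by (simp add: B_def)
  qed
  interpret B: normal B G by (rule B)
  let ?V = "G\<lparr>carrier := V\<rparr>"
  interpret VG: group ?V by (rule V.subgroup_is_group[OF is_group])
  have BinV: "B \<lhd> ?V" using normal_restrict_supergroup[OF V.subgroup_axioms B BV] .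
  interpret BV: normal B ?V by (rule BinV)
  define W where "W = ?V Mod B"
  define q where "q x = B #> x" for x
  have Wc: "carrier W = q ` V" by (simp add: W_def carrier_FactGroup q_def[abs_def])
  have qm: "q x \<otimes>\<^bsub>W\<^esub> q y = q (x \<otimes> y)" if "x \<in> V" "y \<in> V" for x y
    using BV.rcos_sum[of x y] that by (simp add: W_def q_def)
  have W1: "\<one>\<^bsub>W\<^esub> = B" by (simp add: W_def)
  have qB: "q x = B \<longleftrightarrow> x \<in> B" if "x \<in> V" for x
    using B.rcos_const[OF is_group, of x] rcos_self[OF _ B.subgroup_axioms, of x] that by (auto simp: q_def)
  have qcomm: "q (x \<otimes> y) = q (y \<otimes> x)" if xy: "x \<in> V" "y \<in> V" for x y
  proof -
    have "x \<otimes> y \<otimes> inv x \<otimes> inv y \<in> B" using comm[OF xy] xy by (simp add: B_def)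
    moreover have "x \<otimes> y = (x \<otimes> y \<otimes> inv x \<otimes> inv y) \<otimes> (y \<otimes> x)" using xy by (simp add: m_assoc)
    ultimately have "x \<otimes> y \<in> B #> (y \<otimes> x)" by (auto simp: r_coset_def)
    then show ?thesis unfolding q_def using repr_independence[of "x \<otimes> y" B "y \<otimes> x"] xy B.subgroup_axioms by simp
  qed
  have W: "comm_group W"
  proof (rule group.group_comm_groupI)
    show "group W" unfolding W_def by (rule BV.factorgroup_is_group)
    fix C D assume "C \<in> carrier W" "D \<in> carrier W"
    then obtain x y where xy: "x \<in> V" "y \<in> V" "C = q x" "D = q y" by (auto simp: Wc)
    show "C \<otimes>\<^bsub>W\<^esub> D = D \<otimes>\<^bsub>W\<^esub> C" using qm qcomm xy by simp
  qed
  define cf where "cf g = (SOME v. v \<in> V \<and> (\<exists>t\<in>T. g = v \<otimes> t))" for g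
  define \<pi> where "\<pi> g = q (cf g)" for g
  have pi: "\<pi> (v \<otimes> t) = q v" if v: "v \<in> V" and t: "t \<in> T" for v t
  proof -
    have "\<exists>w. w \<in> V \<and> (\<exists>t'\<in>T. v \<otimes> t = w \<otimes> t')" using v t by blast
    from someI_ex[OF this] obtain t' where w: "cf (v \<otimes> t) \<in> V" "t' \<in> T" "v \<otimes> t = cf (v \<otimes> t) \<otimes> t'" by (auto simp: cf_def)
    let ?w = "cf (v \<otimes> t)"
    have cc: "v \<in> carrier G" "t \<in> carrier G" "t' \<in> carrier G" "?w \<in> carrier G" using v t w by auto
    have "v = ?w \<otimes> t' \<otimes> inv t" using w(3) cc by (metis inv_solve_right m_closed)
    then have e: "inv ?w \<otimes> v = t' \<otimes> inv t" using cc by (metis inv_solve_left m_assoc inv_closed m_closed)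
    have "inv ?w \<otimes> v \<in> V" using w v by simp
    moreover have "inv ?w \<otimes> v \<in> T" unfolding e using w t by simp
    ultimately have b: "inv ?w \<otimes> v \<in> B" by (simp add: B_def)
    have "q v = q (?w \<otimes> (inv ?w \<otimes> v))" using cc by simp
    also have "\<dots> = q ?w \<otimes>\<^bsub>W\<^esub> q (inv ?w \<otimes> v)" using qm[of ?w "inv ?w \<otimes> v"] w v by simp
    also have "q (inv ?w \<otimes> v) = \<one>\<^bsub>W\<^esub>" using qB b BV by (auto simp: W1)
    also have "q ?w \<otimes>\<^bsub>W\<^esub> \<one>\<^bsub>W\<^esub> = q ?w" using comm_groupE(5)[OF W] w(1) comm_group.axioms[OF W] by (simp add: Wc group.is_monoid monoid.r_one)
    finally show ?thesis by (simp add: \<pi>_def)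
  qed
  define lin where "lin g C = (\<lambda>x. g \<otimes> x \<otimes> inv g) ` C" for g C
  have linq: "lin g (q x) = q (g \<otimes> x \<otimes> inv g)" if "g \<in> carrier G" "x \<in> V" for g x
    unfolding lin_def q_def by (rule B.conj_r_coset) (use that in auto)
  have cV: "g \<otimes> x \<otimes> inv g \<in> V" if "g \<in> carrier G" "x \<in> V" for g x using V.inv_op_closed2[OF that] .
  have "affine_action G W \<pi> lin"
    unfolding affine_action_def
  proof (intro conjI ballI)
    show "comm_group W" by (rule W)
    show "finite (carrier W)" unfolding Wc using fin V.subset by (intro finite_imageI) (auto intro: finite_subset)
    show "\<pi> ` carrier G = carrier W"
    proof
      show "\<pi> ` carrier G \<subseteq> carrier W"
      proof (rule image_subsetI)
        fix g assume "g \<in> carrier G"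
        then obtain v t where "v \<in> V" "t \<in> T" "g = v \<otimes> t" using dec by blast
        then show "\<pi> g \<in> carrier W" using pi by (simp add: Wc)
      qed
      show "carrier W \<subseteq> \<pi> ` carrier G"
      proof
        fix C assume "C \<in> carrier W"
        then obtain v where v: "v \<in> V" "C = q v" by (auto simp: Wc)
        then have "\<pi> v = C" using pi[OF v(1) T.one_closed] by simp
        then show "C \<in> \<pi> ` carrier G" using v by auto
      qed
    qed
    show "lin g \<in> hom W W" if g: "g \<in> carrier G" for g
    proof (rule homI)
      show "lin g C \<in> carrier W" if "C \<in> carrier W" for C using that linq[OF g] cV[OF g] by (auto simp: Wc)
      fix C D assume "C \<in> carrier W" "D \<in> carrier W"
      then obtain x y where xy: "x \<in> V" "y \<in> V" "C = q x" "D = q y" by (auto simp: Wc)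
      have "g \<otimes> (x \<otimes> y) \<otimes> inv g = (g \<otimes> x \<otimes> inv g) \<otimes> (g \<otimes> y \<otimes> inv g)" using xy g by (simp add: m_assoc)
      then show "lin g (C \<otimes>\<^bsub>W\<^esub> D) = lin g C \<otimes>\<^bsub>W\<^esub> lin g D" using xy linq[OF g] cV[OF g] qm by simp
    qed
    show "\<pi> (g \<otimes> h) = \<pi> g \<otimes>\<^bsub>W\<^esub> lin g (\<pi> h)" if g: "g \<in> carrier G" and h: "h \<in> carrier G" for g h
    proof -
      obtain v t where vt: "v \<in> V" "t \<in> T" "g = v \<otimes> t" using dec[OF g] by blast
      obtain w s where ws: "w \<in> V" "s \<in> T" "h = w \<otimes> s" using dec[OF h] by blast
      define x where "x = t \<otimes> w \<otimes> inv t"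
      have x: "x \<in> V" unfolding x_def by (rule cV) (use vt ws in auto)
      have "g \<otimes> h = (v \<otimes> x) \<otimes> (t \<otimes> s)" using vt ws by (simp add: x_def m_assoc)
      then have "\<pi> (g \<otimes> h) = q (v \<otimes> x)" using pi[of "v \<otimes> x" "t \<otimes> s"] vt ws x by simp
      also have "v \<otimes> x = (v \<otimes> x \<otimes> inv v) \<otimes> v" using vt x by (simp add: m_assoc)
      also have "q ((v \<otimes> x \<otimes> inv v) \<otimes> v) = q (v \<otimes> (v \<otimes> x \<otimes> inv v))" by (rule qcomm) (use vt x in auto)
      also have "v \<otimes> x \<otimes> inv v = g \<otimes> w \<otimes> inv g" using vt ws by (simp add: x_def m_assoc inv_mult_group)
      also have "q (v \<otimes> (g \<otimes> w \<otimes> inv g)) = q v \<otimes>\<^bsub>W\<^esub> q (g \<otimes> w \<otimes> inv g)" using qm[of v "g \<otimes> w \<otimes> inv g"] vt cV[OF g ws(1)] by simp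
      also have "\<dots> = \<pi> g \<otimes>\<^bsub>W\<^esub> lin g (\<pi> h)" using pi[OF vt(1,2)] pi[OF ws(1,2)] linq[OF g ws(1)] vt ws by simp
      finally show ?thesis .
    qed
  qed
  moreover have "T = {g \<in> carrier G. \<pi> g = \<one>\<^bsub>W\<^esub>}"
  proof
    show "T \<subseteq> {g \<in> carrier G. \<pi> g = \<one>\<^bsub>W\<^esub>}"
    proof
      fix t assume t: "t \<in> T"
      have "\<pi> (\<one> \<otimes> t) = q \<one>" using pi[OF V.one_closed t] .
      then show "t \<in> {g \<in> carrier G. \<pi> g = \<one>\<^bsub>W\<^esub>}" using t qB[OF V.one_closed] B.one_closed by (simp add: W1)
    qed
    show "{g \<in> carrier G. \<pi> g = \<one>\<^bsub>W\<^esub>} \<subseteq> T"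
    proof clarify
      fix g assume g: "g \<in> carrier G" "\<pi> g = \<one>\<^bsub>W\<^esub>"
      obtain v t where vt: "v \<in> V" "t \<in> T" "g = v \<otimes> t" using dec[OF g(1)] by blast
      then have "v \<in> B" using pi g(2) qB by (simp add: W1)
      then show "g \<in> T" using vt BT by auto
    qed
  qed
  ultimately show ?thesis unfolding W_def B_def lin_def[abs_def] by blast
qed

text \<open>
  Let \<open>i\<close> be the last index with \<open>Q i L = G\<close>. The subgroup \<open>Q (i + 1) L\<close> is proper and is supplemented by \<open>Q i\<close>.
\<close>

lemma (in prime_tower_group) proper_subgroup_affine:
  assumes L: "subgroup L G" "L \<noteq> carrier G"
  shows "\<exists>T. subgroup T G \<and> L \<subseteq> T \<and> T \<noteq> carrier G \<and>
     (\<exists>(W :: 'a set monoid) \<pi> lin (r::nat). Factorial_Ring.prime r \<and> affine_action G W \<pi> lin \<and>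
       (\<forall>w\<in>carrier W. w [^]\<^bsub>W\<^esub> r = \<one>\<^bsub>W\<^esub>) \<and> T = {g \<in> carrier G. \<pi> g = \<one>\<^bsub>W\<^esub>})"
proof -
  interpret L: subgroup L G by fact
  obtain n where n: "Q n = {\<one>}" using prime_tower_last[OF tower] .
  have QnL: "Q n <#> L \<noteq> carrier G" using L L.subset by (simp add: n set_mult_def)
  define m where "m = (LEAST m. Q m <#> L \<noteq> carrier G)"
  have m: "Q m <#> L \<noteq> carrier G" unfolding m_def by (rule LeastI[of _ n]) (rule QnL)
  have "Q 0 <#> L = carrier G"
    using set_mult_incl(1)[OF subgroup_self L(1)] setmult_subset_G[OF order_refl L.subset] by (simp add: Q_0)
  then have "m \<noteq> 0" using m by metis
  then obtain i where i: "m = Suc i" by (cases m) auto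
  have Qi: "Q i <#> L = carrier G" using not_less_Least[of i "\<lambda>m. Q m <#> L \<noteq> carrier G"] i m_def by auto
  define T where "T = Q (Suc i) <#> L"
  have T: "subgroup T G" unfolding T_def by (rule mult_norm_subgroup[OF Q_normal L(1)])
  have LT: "L \<subseteq> T" "Q (Suc i) \<subseteq> T" using set_mult_incl[OF Q_subgroup L(1)] by (auto simp: T_def)
  have TG: "T \<noteq> carrier G" using m i by (simp add: T_def)
  have dec: "\<exists>v\<in>Q i. \<exists>t\<in>T. g = v \<otimes> t" if "g \<in> carrier G" for g
  proof -
    have "g \<in> Q i <#> L" using that Qi by simp
    then obtain v t where "v \<in> Q i" "t \<in> L" "g = v \<otimes> t" unfolding set_mult_def by blast
    then show ?thesis using LT by blast
  qed
  have comm: "v \<otimes> w \<otimes> inv v \<otimes> inv w \<in> T" if "v \<in> Q i" "w \<in> Q i" for v w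
    using Q_comm[OF that] LT by auto
  let ?W = "G\<lparr>carrier := Q i\<rparr> Mod (Q i \<inter> T)"
  obtain \<pi> where pi: "affine_action G ?W \<pi> (\<lambda>g C. (\<lambda>x. g \<otimes> x \<otimes> inv g) ` C)" "T = {g \<in> carrier G. \<pi> g = \<one>\<^bsub>?W\<^esub>}"
    using affine_of_supplement[OF fin Q_normal T dec comm] by blast
  interpret Qi: subgroup "Q i" G by (rule Q_subgroup)
  interpret QG: group "G\<lparr>carrier := Q i\<rparr>" by (rule Qi.subgroup_is_group[OF is_group])
  have BinV: "Q i \<inter> T \<lhd> G\<lparr>carrier := Q i\<rparr>"
    unfolding QG.normal_inv_iff
  proof (intro conjI ballI)
    show "subgroup (Q i \<inter> T) (G\<lparr>carrier := Q i\<rparr>)"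
      using subgroup_incl[OF subgroups_Inter_pair[OF Q_subgroup T] Q_subgroup] by simp
    fix x h assume xh: "x \<in> carrier (G\<lparr>carrier := Q i\<rparr>)" "h \<in> Q i \<inter> T"
    have "(x \<otimes> h \<otimes> inv x \<otimes> inv h) \<otimes> h \<in> T" using comm[of x h] xh subgroup.m_closed[OF T] by simp
    moreover have "(x \<otimes> h \<otimes> inv x \<otimes> inv h) \<otimes> h = x \<otimes> h \<otimes> inv x" using xh by (simp add: m_assoc)
    ultimately show "x \<otimes>\<^bsub>G\<lparr>carrier := Q i\<rparr>\<^esub> h \<otimes>\<^bsub>G\<lparr>carrier := Q i\<rparr>\<^esub> inv\<^bsub>G\<lparr>carrier := Q i\<rparr>\<^esub> x \<in> Q i \<inter> T"
      using xh by (simp add: m_inv_consistent[OF Q_subgroup])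
  qed
  interpret BV: normal "Q i \<inter> T" "G\<lparr>carrier := Q i\<rparr>" by (rule BinV)
  have exp: "C [^]\<^bsub>?W\<^esub> p i = \<one>\<^bsub>?W\<^esub>" if C: "C \<in> carrier ?W" for C
  proof -
    obtain v where v: "v \<in> Q i" "C = (Q i \<inter> T) #> v" using C by (auto simp: carrier_FactGroup)
    have "v [^] p i \<in> Q i \<inter> T" using Q_pow[OF v(1)] LT Q_Suc[of i] by auto
    then have "(Q i \<inter> T) #> (v [^] p i) = Q i \<inter> T"
      using subgroup.rcos_const[OF subgroups_Inter_pair[OF Q_subgroup T] is_group] by simp
    then show ?thesis using BV.FactGroup_pow[of v "p i"] v by (simp add: nat_pow_def)
  qed
  have "Factorial_Ring.prime (p i) \<and> affine_action G ?W \<pi> (\<lambda>g C. (\<lambda>x. g \<otimes> x \<otimes> inv g) ` C) \<and>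
       (\<forall>w\<in>carrier ?W. w [^]\<^bsub>?W\<^esub> p i = \<one>\<^bsub>?W\<^esub>) \<and> T = {g \<in> carrier G. \<pi> g = \<one>\<^bsub>?W\<^esub>}"
    using pr[of i] pi(1) exp pi(2) by (intro conjI ballI)
  then show ?thesis using T LT TG by blast
qed

text \<open>
  Since \<open>e \<le> log 2 n\<close>, the left-hand side is at most about \<open>2 ^ (log 2 n) ^ 2\<close>.
\<close>

lemma power_log_bound: "2 ^ e \<le> n \<Longrightarrow> n ^ (e + 1) \<le> 2 ^ (4 * n)" for n :: nat
proof -
  assume e: "2 ^ e \<le> n"
  then have "1 \<le> n" by (metis le_trans one_le_numeral one_le_power)
  then obtain j where j: "2 ^ j \<le> n" "n < 2 ^ (j + 1)" using ex_power_ivl1[of 2 n] by auto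
  have "(2::nat) ^ e < 2 ^ (j + 1)" using e j by linarith
  then have "e < j + 1" by (rule power_less_imp_less_exp[rotated]) simp
  have sq: "(k + 1) * (k + 1) \<le> 4 * 2 ^ k" for k :: nat
  proof (induction k)
    case (Suc k)
    have "k + 1 \<le> 2 ^ k" by (induction k) auto
    then show ?case using Suc by (simp add: algebra_simps)
  qed simp
  have "n ^ (e + 1) \<le> n ^ (j + 1)" using \<open>1 \<le> n\<close> \<open>e < j + 1\<close> by (intro power_increasing) auto
  also have "\<dots> \<le> (2 ^ (j + 1)) ^ (j + 1)" using j by (intro power_mono) auto
  also have "\<dots> = 2 ^ ((j + 1) * (j + 1))" by (simp only: power_mult)
  also have "\<dots> \<le> 2 ^ (4 * n)"
  proof (intro power_increasing)
    show "(j + 1) * (j + 1) \<le> 4 * n" using sq[of j] j(1) by linarith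
  qed simp
  finally show ?thesis .
qed

lemma sum_half_powers: "1 \<le> m \<Longrightarrow> m \<le> E \<Longrightarrow> (\<Sum>n = 2..m. 2 ^ (E - n)) + 2 ^ (E - m) \<le> (2::nat) ^ E"
proof (induction m rule: dec_induct)
  case base
  then show ?case by simp
next
  case (step m)
  have "E - m = Suc (E - Suc m)" using step.prems by simp
  then have "(2::nat) ^ (E - m) = 2 * 2 ^ (E - Suc m)" by (metis power_Suc)
  then show ?case using step by simp
qed

text \<open>
  Every proper subgroup lies in an affine stabiliser \<open>T\<close> of some index \<open>n \<ge> 2\<close>. There are at most
  \<open>2 ^ (8 * n * d)\<close> of these, and \<open>T\<close> is generated by \<open>n * d\<close> elements, so by induction it has at most
  \<open>2 ^ (18 * (n * d) * (m div n - 1)) = 2 ^ (18 * d * (m - n))\<close> subgroups of index \<open>m div n\<close>. The growth of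
  the number of generators is compensated exactly by the smaller index.

  The constant 18 comes from summing over \<open>n\<close> with weights \<open>2 ^ - n\<close>: a constant \<open>b\<close> in its place has to
  satisfy \<open>8 * n * d + n \<le> b * d * (n - 1)\<close>, and the case \<open>n = 2\<close>, \<open>d = 1\<close> forces \<open>b \<ge> 18\<close>.
\<close>

lemma card_subgroups_of_index_le:
  assumes "prime_tower_group (G :: ('a, 'b) monoid_scheme) p Q" "R \<subseteq> carrier G" "generate G R = carrier G"
    "card R \<le> d" "d \<ge> 1" "m \<ge> 1"
  shows "card {L. subgroup L G \<and> card (carrier G) = m * card L} \<le> 2 ^ (18 * d * (m - 1))"
  using assms
proof (induction m arbitrary: G Q R d rule: less_induct)
  case (less m)
  interpret prime_tower_group G p Q by (rule less.prems(1))
  note R = less.prems(2,3) and d = less.prems(4,5)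
  let ?S = "{L. subgroup L G \<and> card (carrier G) = m * card L}"
  have pos: "card L > 0" if L: "subgroup L G" for L
    using finite_subset[OF subgroup.subset[OF L] fin] subgroup.one_closed[OF L] by (auto simp: card_gt_0_iff)
  show ?case
  proof (cases "m = 1")
    case True
    have "?S \<subseteq> {carrier G}"
    proof clarify
      fix L assume L: "subgroup L G" "card (carrier G) = m * card L"
      show "L = carrier G" by (rule card_subset_eq[OF fin subgroup.subset[OF L(1)]]) (use L(2) True in simp)
    qed
    then have "card ?S \<le> card {carrier G}" by (intro card_mono) auto
    then show ?thesis using True by simp
  next
    case False
    then have m2: "m \<ge> 2" using less.prems by simp
    define \<T> where "\<T> n = {T. subgroup T G \<and> card (carrier G) = n * card T \<and>
       (\<exists>(W :: 'a set monoid) \<pi> lin (r::nat). Factorial_Ring.prime r \<and> affine_action G W \<pi> lin \<and>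
       (\<forall>w\<in>carrier W. w [^]\<^bsub>W\<^esub> r = \<one>\<^bsub>W\<^esub>) \<and> T = {g \<in> carrier G. \<pi> g = \<one>\<^bsub>W\<^esub>})}" for n
    define \<S> where "\<S> n T = {L. subgroup L (G\<lparr>carrier := T\<rparr>) \<and> card T = (m div n) * card L}" for n T
    have cardT: "finite (\<T> n) \<and> card (\<T> n) \<le> 2 ^ (8 * n * d)" if n: "n \<ge> 2" for n
    proof -
      have "finite (\<T> n) \<and> card (\<T> n) \<le> n ^ 2 * (2 ^ (4 * n)) ^ card R"
      proof (rule card_affine_kernels_le[OF is_group fin R n power_log_bound, where ?'w = "'a set" and ?'c = unit])
        fix T assume "T \<in> \<T> n"
        then obtain W :: "'a set monoid" and \<pi> lin and r :: nat where T: "subgroup T G" "card (carrier G) = n * card T"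
          and W: "Factorial_Ring.prime r" "affine_action G W \<pi> lin"
          "\<forall>w\<in>carrier W. w [^]\<^bsub>W\<^esub> r = \<one>\<^bsub>W\<^esub>" "T = {g \<in> carrier G. \<pi> g = \<one>\<^bsub>W\<^esub>}"
          unfolding \<T>_def mem_Collect_eq by - (elim exE conjE, rule that)
        have "card (carrier W) * card T = n * card T" using affine_action_card[OF is_group fin W(2)] T(2) unfolding W(4)[symmetric] by linarith
        then have "card (carrier W) = n" using pos[OF T(1)] by simp
        then show "\<exists>(W :: 'a set monoid) \<pi> lin (p::nat). affine_kernel G n T W \<pi> lin p"
          using W by blast
      qed
      moreover have "n ^ 2 * (2 ^ (4 * n)) ^ card R \<le> 2 ^ (8 * n * d)"
      proof -
        have "n \<le> 2 ^ n" by (rule less_imp_le) (simp add: power_gt_expt)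
        then have "n ^ 2 \<le> (2 ^ n) ^ 2" by (rule power_mono) simp
        then have "n ^ 2 * (2 ^ (4 * n)) ^ card R \<le> (2 ^ n) ^ 2 * (2 ^ (4 * n)) ^ card R" by (rule mult_right_mono) simp
        also have "\<dots> = 2 ^ (n * 2 + 4 * n * card R)" by (simp only: power_mult power_add)
        also have "\<dots> \<le> 2 ^ (8 * n * d)"
        proof (rule power_increasing)
          have "n * card R \<le> n * d" "n \<le> n * d" using d by auto
          then show "n * 2 + 4 * n * card R \<le> 8 * n * d" by linarith
        qed simp
        finally show ?thesis .
      qed
      ultimately show ?thesis by linarith
    qed
    have sub: "?S \<subseteq> (\<Union>n\<in>{2..m}. \<Union>T\<in>{T \<in> \<T> n. n dvd m}. \<S> n T)"
    proof
      fix L assume "L \<in> ?S"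
      then have L: "subgroup L G" "card (carrier G) = m * card L" by auto
      have "L \<noteq> carrier G" using L(2) m2 pos[OF L(1)] by auto
      then obtain T where T: "subgroup T G" "L \<subseteq> T" "T \<noteq> carrier G" and
        W: "\<exists>(W :: 'a set monoid) \<pi> lin (r::nat). Factorial_Ring.prime r \<and> affine_action G W \<pi> lin \<and>
         (\<forall>w\<in>carrier W. w [^]\<^bsub>W\<^esub> r = \<one>\<^bsub>W\<^esub>) \<and> T = {g \<in> carrier G. \<pi> g = \<one>\<^bsub>W\<^esub>}"
        using proper_subgroup_affine[OF L(1)] by blast
      obtain n where n: "card (carrier G) = n * card T" using subgroup_card_dvd[OF T(1)] by blast
      interpret TG: group "G\<lparr>carrier := T\<rparr>" by (rule subgroup.subgroup_is_group[OF T(1) is_group])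
      have LT: "subgroup L (G\<lparr>carrier := T\<rparr>)" by (rule subgroup_incl[OF L(1) T(1,2)])
      obtain k where k: "card T = k * card L" using TG.subgroup_card_dvd[OF LT] by auto
      have mnk: "m = n * k" using L(2) n k pos[OF L(1)] by simp
      have n2: "n \<ge> 2"
      proof -
        have "n \<noteq> 0" "n \<noteq> 1" using mnk m2 n T(3) card_subset_eq[OF fin subgroup.subset[OF T(1)]] by auto
        then show ?thesis by simp
      qed
      have "k \<ge> 1" using mnk m2 by (cases k) auto
      then have "n \<le> m" using mnk by simp
      moreover have "T \<in> \<T> n" using T n W by (simp add: \<T>_def)
      moreover have "L \<in> \<S> n T" using LT k mnk n2 by (simp add: \<S>_def)
      ultimately show "L \<in> (\<Union>n\<in>{2..m}. \<Union>T\<in>{T \<in> \<T> n. n dvd m}. \<S> n T)"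
        using n2 mnk by (intro UN_I[of n] UN_I[of T]) auto
    qed
    have cS: "card (\<S> n T) \<le> 2 ^ (18 * d * (m - n))" if T: "T \<in> \<T> n" and n: "n \<in> {2..m}" "n dvd m" for n T
    proof -
      have Tsub: "subgroup T G" and Tn: "card (carrier G) = n * card T" using T by (auto simp: \<T>_def)
      obtain R' where R': "R' \<subseteq> T" "generate (G\<lparr>carrier := T\<rparr>) R' = T" "card R' \<le> n * card R"
        using schreier_generators[OF fin R Tsub Tn] by blast
      obtain k where k: "m = n * k" using n(2) by blast
      have k1: "m div n = k" "k < m" "k \<ge> 1" using k n m2 by (auto intro!: Nat.gr0I simp: Suc_le_eq)
      have main: "card {L. subgroup L (G\<lparr>carrier := T\<rparr>) \<and> card (carrier (G\<lparr>carrier := T\<rparr>)) = k * card L} \<le> 2 ^ (18 * (n * d) * (k - 1))"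
      proof (rule less.IH[OF k1(2) prime_tower_group_subgroup[OF Tsub], of R'])
        show "card R' \<le> n * d" using R'(3) mult_le_mono2[OF d(1), of n] by linarith
        show "1 \<le> n * d" using n d by (simp add: Suc_le_eq)
      qed (use R' k1 in auto)
      have e: "18 * (n * d) * (k - 1) = 18 * d * (m - n)" using k by (simp add: algebra_simps diff_mult_distrib2)
      have c: "carrier (G\<lparr>carrier := T\<rparr>) = T" by simp
      show ?thesis using main unfolding \<S>_def k1(1) e c .
    qed
    have finS: "finite (\<S> n T)" if T: "finite T" for n T
      by (rule finite_subset[of _ "Pow T"]) (use T subgroup.subset in \<open>fastforce simp: \<S>_def\<close>)+
    have finTm: "finite T" if "T \<in> \<T> n" for n T
      using that finite_subset[OF subgroup.subset fin] by (auto simp: \<T>_def)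
    define E where "E = 18 * d * (m - 1)"
    have "card ?S \<le> card (\<Union>n\<in>{2..m}. \<Union>T\<in>{T \<in> \<T> n. n dvd m}. \<S> n T)"
    proof (rule card_mono[OF _ sub])
      show "finite (\<Union>n\<in>{2..m}. \<Union>T\<in>{T \<in> \<T> n. n dvd m}. \<S> n T)" using cardT finS finTm by auto
    qed
    also have "\<dots> \<le> (\<Sum>n\<in>{2..m}. card (\<Union>T\<in>{T \<in> \<T> n. n dvd m}. \<S> n T))" by (rule card_UN_le) simp
    also have "\<dots> \<le> (\<Sum>n\<in>{2..m}. 2 ^ (E - n))"
    proof (rule sum_mono)
      fix n assume n: "n \<in> {2..m}"
      have f: "finite {T \<in> \<T> n. n dvd m}" using cardT[of n] n by auto
      have "card (\<Union>T\<in>{T \<in> \<T> n. n dvd m}. \<S> n T) \<le> (\<Sum>T\<in>{T \<in> \<T> n. n dvd m}. card (\<S> n T))" by (rule card_UN_le[OF f])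
      also have "\<dots> \<le> (\<Sum>T\<in>{T \<in> \<T> n. n dvd m}. 2 ^ (18 * d * (m - n)))" by (rule sum_mono) (use cS n in auto)
      also have "\<dots> = card {T \<in> \<T> n. n dvd m} * 2 ^ (18 * d * (m - n))" by simp
      also have "\<dots> \<le> 2 ^ (8 * n * d) * 2 ^ (18 * d * (m - n))"
      proof (rule mult_right_mono)
        have "card {T \<in> \<T> n. n dvd m} \<le> card (\<T> n)" using cardT[of n] n by (intro card_mono) auto
        then show "card {T \<in> \<T> n. n dvd m} \<le> 2 ^ (8 * n * d)" using cardT[of n] n by auto
      qed simp
      also have "\<dots> = 2 ^ (8 * n * d + 18 * d * (m - n))" by (simp add: power_add)
      also have "\<dots> \<le> 2 ^ (E - n)"
      proof (rule power_increasing)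
        obtain j where j: "m = n + j" using n by (metis atLeastAtMost_iff le_Suc_ex)
        obtain i where i: "n = Suc (Suc i)" using n by (metis atLeastAtMost_iff Suc_le_D numeral_2_eq_2 le_Suc_ex add_Suc)
        obtain c where c: "d = Suc c" using d by (cases d) auto
        have "8 * n * d + 18 * d * (m - n) + n \<le> E"
          unfolding E_def j i c by (simp add: algebra_simps)
        then show "8 * n * d + 18 * d * (m - n) \<le> E - n" by linarith
      qed simp
      finally show "card (\<Union>T\<in>{T \<in> \<T> n. n dvd m}. \<S> n T) \<le> 2 ^ (E - n)" .
    qed
    also have "\<dots> \<le> 2 ^ E"
    proof -
      have "m \<le> 18 * 1 * (m - 1)" using m2 by simp
      also have "\<dots> \<le> E" unfolding E_def using d by (intro mult_right_mono mult_left_mono) auto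
      finally have "m \<le> E" .
      then show ?thesis using sum_half_powers[of m E] m2 by linarith
    qed
    finally show ?thesis by (simp add: E_def)
  qed
qed

section \<open>Chief factors and the count of normal subgroups\<close>

lemma affine_kernel_subgroup:
  assumes T: "group T" and a: "affine_action T W \<pi> lin"
  shows "subgroup {g \<in> carrier T. \<pi> g = \<one>\<^bsub>W\<^esub>} T"
proof -
  interpret T: group T by fact
  interpret W: comm_group W by (rule affine_actionD(1)[OF a])
  note mult = affine_actionD(5)[OF a] and one = affine_action_one[OF T a]
  have fix1: "\<pi> (g \<otimes>\<^bsub>T\<^esub> h) = \<pi> g" if "g \<in> carrier T" "h \<in> carrier T" "\<pi> h = \<one>\<^bsub>W\<^esub>" for g h
    using mult[OF that(1,2)] that hom_one[OF affine_actionD(4)[OF a that(1)] W.is_group W.is_group]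
      affine_actionD(6)[OF a that(1)] by simp
  show ?thesis
  proof (rule T.subgroupI)
    show "{g \<in> carrier T. \<pi> g = \<one>\<^bsub>W\<^esub>} \<noteq> {}" using one by auto
    show "inv\<^bsub>T\<^esub> g \<in> {g \<in> carrier T. \<pi> g = \<one>\<^bsub>W\<^esub>}" if "g \<in> {g \<in> carrier T. \<pi> g = \<one>\<^bsub>W\<^esub>}" for g
      using fix1[of "inv\<^bsub>T\<^esub> g" g] that one by simp
    show "g \<otimes>\<^bsub>T\<^esub> h \<in> {g \<in> carrier T. \<pi> g = \<one>\<^bsub>W\<^esub>}"
      if "g \<in> {g \<in> carrier T. \<pi> g = \<one>\<^bsub>W\<^esub>}" "h \<in> {g \<in> carrier T. \<pi> g = \<one>\<^bsub>W\<^esub>}" for g h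
      using fix1[of g h] that by simp
  qed auto
qed

lemma affine_action_cong:
  assumes "affine_action T W \<pi> lin" "\<And>g. g \<in> carrier T \<Longrightarrow> lin g = lin' g"
  shows "affine_action T W \<pi> lin'"
  using assms(1) unfolding affine_action_def by (simp add: assms(2))

lemma semilinear_cong:
  assumes "semilinear W S act" "\<And>g. g \<in> S' \<Longrightarrow> \<exists>s\<in>S. \<forall>w\<in>carrier W. act' g w = act s w" and W: "comm_group W"
  shows "semilinear W S' act'"
proof -
  interpret W: comm_group W by (rule W)
  from assms(1) obtain \<zeta> v where z: "\<zeta> \<in> carrier (End W)" and v: "v \<in> carrier W"
    and gen: "carrier W = insert \<one>\<^bsub>W\<^esub> (range (\<lambda>i::nat. (\<zeta> [^]\<^bsub>End W\<^esub> i) v))"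
    and lin: "\<forall>g\<in>S. \<exists>\<rho> u. \<forall>i::nat. act g ((\<zeta> [^]\<^bsub>End W\<^esub> i) v) = (\<zeta> [^]\<^bsub>End W\<^esub> (\<rho> * i + u)) v"
    unfolding semilinear_def by - (elim bexE conjE, rule that)
  show ?thesis
  proof (rule semilinearI[OF z v gen])
    fix g assume "g \<in> S'"
    then obtain s where s: "s \<in> S" "\<forall>w\<in>carrier W. act' g w = act s w" using assms(2) by blast
    obtain \<rho> u where ru: "\<forall>i::nat. act s ((\<zeta> [^]\<^bsub>End W\<^esub> i) v) = (\<zeta> [^]\<^bsub>End W\<^esub> (\<rho> * i + u)) v" using lin s(1) by blast
    have "act' g ((\<zeta> [^]\<^bsub>End W\<^esub> i) v) = (\<zeta> [^]\<^bsub>End W\<^esub> (\<rho> * i + u)) v" for i :: nat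
      using s(2) End_pow_Suc(1)[OF W z v, of i] ru by simp
    then show "\<exists>\<rho> u. \<forall>i::nat. act' g ((\<zeta> [^]\<^bsub>End W\<^esub> i) v) = (\<zeta> [^]\<^bsub>End W\<^esub> (\<rho> * i + u)) v" by blast
  qed
qed

lemma (in group) card_set_mult:
  assumes A: "subgroup A G" and M: "subgroup M G" and AM: "A \<inter> M \<subseteq> {\<one>}"
  shows "card (A <#> M) = card A * card M"
proof -
  interpret A: subgroup A G by fact
  interpret M: subgroup M G by fact
  have "A <#> M = (\<lambda>(a, m). a \<otimes> m) ` (A \<times> M)" by (auto simp: set_mult_def)
  moreover have "inj_on (\<lambda>(a, m). a \<otimes> m) (A \<times> M)"
  proof (rule inj_onI, clarify)
    fix a m b n assume *: "a \<in> A" "m \<in> M" "b \<in> A" "n \<in> M" "a \<otimes> m = b \<otimes> n"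
    have c: "a \<in> carrier G" "m \<in> carrier G" "b \<in> carrier G" "n \<in> carrier G" using * by auto
    have "inv b \<otimes> (a \<otimes> m) \<otimes> inv m = inv b \<otimes> (b \<otimes> n) \<otimes> inv m" using *(5) by simp
    then have e: "inv b \<otimes> a = n \<otimes> inv m" using c by (simp add: m_assoc)
    have "inv b \<otimes> a \<in> A" using * by simp
    moreover have "inv b \<otimes> a \<in> M" unfolding e using * by simp
    ultimately have 1: "inv b \<otimes> a = \<one>" using AM by blast
    then have "b \<otimes> (inv b \<otimes> a) = b" using c by simp
    then have "a = b" using c by simp
    moreover have "m = n" using *(5) \<open>a = b\<close> c by simp
    ultimately show "a = b \<and> m = n" by simp
  qed
  ultimately show ?thesis by (simp add: card_image card_cartesian_product)
qed

text \<open>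
  A minimal normal subgroup lies in the last term \<open>Q i\<close> that it meets nontrivially, and its
  \<open>p i\<close>-th powers and commutators lie in the next one.
\<close>

lemma (in prime_tower_group) minimal_normal_elementary:
  assumes A: "A \<lhd> G" "A \<noteq> {\<one>}" and min: "\<And>K. K \<lhd> G \<Longrightarrow> K \<subseteq> A \<Longrightarrow> K = {\<one>} \<or> K = A"
  shows "\<exists>i. (\<forall>a\<in>A. a [^] p i = \<one>) \<and> (\<forall>a\<in>A. \<forall>b\<in>A. a \<otimes> b = b \<otimes> a)"
proof -
  interpret A: normal A G by (rule A)
  have "\<not> A \<subseteq> {\<one>}" using A(2) A.one_closed by blast
  then obtain i where i: "\<not> A \<inter> Q i \<subseteq> {\<one>}" "A \<inter> Q (Suc i) \<subseteq> {\<one>}"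
    using prime_tower_last_layer[OF tower A.subset, of "{\<one>}"] by auto
  have "A \<inter> Q i = A" using min[OF normal_subgroup_intersect[OF A(1) Q_normal]] i(1) by blast
  then have AQ: "a \<in> Q i" if "a \<in> A" for a using that by blast
  have "a [^] p i = \<one>" if a: "a \<in> A" for a
  proof -
    have "a [^] p i \<in> A" using subgroup_int_pow_closed[OF A.subgroup_axioms a, of "int (p i)"] by (simp add: int_pow_int)
    then show ?thesis using Q_pow[OF AQ[OF a]] i(2) by blast
  qed
  moreover have "a \<otimes> b = b \<otimes> a" if a: "a \<in> A" and b: "b \<in> A" for a b
  proof -
    have "a \<otimes> b \<otimes> inv a \<otimes> inv b \<in> A" using a b by simp
    then have "a \<otimes> b \<otimes> inv a \<otimes> inv b = \<one>" using Q_comm[OF AQ[OF a] AQ[OF b]] i(2) by blast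
    moreover have "a \<otimes> b = (a \<otimes> b \<otimes> inv a \<otimes> inv b) \<otimes> (b \<otimes> a)" using a b by (simp add: m_assoc)
    ultimately show ?thesis using a b by simp
  qed
  ultimately show ?thesis by blast
qed

text \<open>
  Let \<open>M\<close> be a complement of the minimal normal subgroup \<open>A\<close>. The descent produces \<open>S \<le> M\<close> and an
  \<open>S\<close>-invariant \<open>U < A\<close> such that \<open>S\<close> acts semilinearly on \<open>A / U\<close>. Then \<open>T = A S\<close> acts on
  \<open>A / U\<close> by affine maps, with stabiliser \<open>L = U S\<close>. The index of \<open>T\<close> in \<open>G\<close> is that of \<open>S\<close> in \<open>M\<close>.
\<close>

lemma (in prime_tower_group) minimal_normal_witness:
  assumes A: "A \<lhd> G" "A \<noteq> {\<one>}" and min: "\<forall>K. K \<lhd> G \<longrightarrow> K \<subseteq> A \<longrightarrow> K = {\<one>} \<or> K = A"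
  shows "\<exists>T L t q (W :: 'a set monoid) \<pi> lin (r::nat). subgroup T G \<and> subgroup L G \<and> L \<subseteq> T \<and> \<not> A \<subseteq> L \<and> card (carrier G) = t * card T \<and>
    q \<ge> 2 \<and> q ^ t \<le> card A \<and> card T = q * card L \<and>
    semilinear_kernel (G\<lparr>carrier := T\<rparr>) q L W \<pi> lin r"
proof -
  interpret A: normal A G by (rule A)
  obtain i where exp: "\<And>a. a \<in> A \<Longrightarrow> a [^] p i = \<one>" and comm: "\<And>a b. a \<in> A \<Longrightarrow> b \<in> A \<Longrightarrow> a \<otimes> b = b \<otimes> a"
    using minimal_normal_elementary[OF A] min by blast
  obtain M where M: "complements M A"
    using abelian_normal_complement[OF prime_tower_group_axioms A(1) comm] by blast
  have Msub: "subgroup M G" and MA: "M \<inter> A = {\<one>}" and dec: "\<And>g. g \<in> carrier G \<Longrightarrow> \<exists>a\<in>A. \<exists>m\<in>M. g = a \<otimes> m"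
    using M by (auto simp: complements_def)
  interpret M: subgroup M G by (rule Msub)
  have conjA: "g \<otimes> a \<otimes> inv g \<in> A" if "g \<in> carrier G" "a \<in> A" for g a using A.inv_op_closed2[OF that] .
  \<comment> \<open>The descent starts from the trivial subgroup of \<open>A\<close>.\<close>
  have "\<exists>S U t c. subgroup S G \<and> S \<subseteq> M \<and> subgroup U G \<and> U \<subseteq> A \<and> U \<noteq> A \<and>
     (\<forall>s\<in>S. \<forall>u\<in>U. s \<otimes> u \<otimes> inv s \<in> U) \<and> card M = t * card S \<and> card A = c * card U \<and>
     c ^ t * card {\<one>} \<le> card A \<and>
     semilinear (G\<lparr>carrier := A\<rparr> Mod U) S (\<lambda>s C. (\<lambda>a. s \<otimes> a \<otimes> inv s) ` C)"
    by (rule semilinear_descent[OF A.subgroup_axioms comm Msub conjA[OF M.mem_carrier] Msub order_refl triv_subgroup])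
       (use A(2) in auto)
  then obtain S U t c where S: "subgroup S G" "S \<subseteq> M" and U: "subgroup U G" "U \<subseteq> A" "U \<noteq> A"
    and SU: "\<forall>s\<in>S. \<forall>u\<in>U. s \<otimes> u \<otimes> inv s \<in> U" and cM: "card M = t * card S" and cA: "card A = c * card U"
    and ct: "c ^ t * card {\<one>} \<le> card A"
    and sl: "semilinear (G\<lparr>carrier := A\<rparr> Mod U) S (\<lambda>s C. (\<lambda>a. s \<otimes> a \<otimes> inv s) ` C)"
    by - (elim exE conjE, rule that)
  interpret S: subgroup S G by (rule S)
  interpret U: subgroup U G by (rule U)
  define T where "T = A <#> S"
  define L where "L = U <#> S"
  have T: "subgroup T G" unfolding T_def by (rule mult_norm_subgroup[OF A(1) S(1)])
  interpret T: subgroup T G by (rule T)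
  have Tincl: "A \<subseteq> T" "S \<subseteq> T" using set_mult_incl[OF A.subgroup_axioms S(1)] by (auto simp: T_def)
  have Lincl: "U \<subseteq> L" "S \<subseteq> L" using set_mult_incl[OF U(1) S(1)] by (auto simp: L_def)
  have LT: "L \<subseteq> T" using U(2) by (auto simp: L_def T_def set_mult_def)
  have Lsub: "subgroup L G"
  proof (rule subgroupI)
    show "L \<subseteq> carrier G" using LT T.subset by blast
    show "L \<noteq> {}" using Lincl U.one_closed by blast
    fix x assume "x \<in> L"
    then obtain u s where us: "u \<in> U" "s \<in> S" "x = u \<otimes> s" unfolding L_def set_mult_def by blast
    have "inv x = (inv s \<otimes> inv u \<otimes> inv (inv s)) \<otimes> inv s" using us by (simp add: inv_mult_group m_assoc)
    moreover have "inv s \<otimes> inv u \<otimes> inv (inv s) \<in> U"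
      by (rule SU[rule_format]) (use us in auto)
    ultimately show "inv x \<in> L" using us S.m_inv_closed unfolding L_def set_mult_def by blast
    fix y assume "y \<in> L"
    then obtain w r where wr: "w \<in> U" "r \<in> S" "y = w \<otimes> r" unfolding L_def set_mult_def by blast
    have "x \<otimes> y = (u \<otimes> (s \<otimes> w \<otimes> inv s)) \<otimes> (s \<otimes> r)" using us wr by (simp add: m_assoc)
    moreover have "u \<otimes> (s \<otimes> w \<otimes> inv s) \<in> U" using us wr SU by auto
    ultimately show "x \<otimes> y \<in> L" using us wr S.m_closed unfolding L_def set_mult_def by blast
  qed
  have AS: "A \<inter> S \<subseteq> {\<one>}" using S(2) MA by blast
  have AL: "A \<inter> L = U"
  proof
    show "U \<subseteq> A \<inter> L" using U Lincl by blast
    show "A \<inter> L \<subseteq> U"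
    proof
      fix x assume x: "x \<in> A \<inter> L"
      then obtain u s where us: "u \<in> U" "s \<in> S" "x = u \<otimes> s" unfolding L_def set_mult_def by blast
      have "u \<in> A" "x \<in> A" using x us U(2) by auto
      then have "inv u \<otimes> x \<in> A" by simp
      moreover have "inv u \<otimes> x = s" using us by simp
      ultimately have "s = \<one>" using us AS by blast
      then show "x \<in> U" using us by simp
    qed
  qed
  let ?T = "G\<lparr>carrier := T\<rparr>"
  interpret TG: group ?T by (rule T.subgroup_is_group[OF is_group])
  have finT: "finite (carrier ?T)" using fin T.subset finite_subset by auto
  have AT: "A \<lhd> ?T" by (rule normal_restrict_supergroup[OF T A(1) Tincl(1)])
  have LTs: "subgroup L ?T" by (rule subgroup_incl[OF Lsub T LT])
  have decT: "\<exists>v\<in>A. \<exists>t\<in>L. g = v \<otimes>\<^bsub>?T\<^esub> t" if "g \<in> carrier ?T" for g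
  proof -
    have "g \<in> A <#> S" using that by (simp add: T_def)
    then show ?thesis using Lincl unfolding set_mult_def by auto
  qed
  have commT: "v \<otimes>\<^bsub>?T\<^esub> w \<otimes>\<^bsub>?T\<^esub> inv\<^bsub>?T\<^esub> v \<otimes>\<^bsub>?T\<^esub> inv\<^bsub>?T\<^esub> w \<in> L" if vw: "v \<in> A" "w \<in> A" for v w
  proof -
    have "v \<in> T" "w \<in> T" using vw Tincl by auto
    moreover have "v \<otimes> w \<otimes> inv v \<otimes> inv w = \<one>"
    proof -
      have "v \<otimes> w \<otimes> inv v \<otimes> inv w = w \<otimes> v \<otimes> inv v \<otimes> inv w" using comm[OF vw] by simp
      then show ?thesis using vw by (simp add: m_assoc)
    qed
    ultimately show ?thesis using subgroup.one_closed[OF Lsub] by (simp add: m_inv_consistent[OF T])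
  qed
  define W where "W = G\<lparr>carrier := A\<rparr> Mod U"
  have W_eq: "?T\<lparr>carrier := A\<rparr> Mod (A \<inter> L) = W" by (simp add: W_def AL)
  obtain \<pi> where pi: "affine_action ?T W \<pi> (\<lambda>g C. (\<lambda>x. g \<otimes>\<^bsub>?T\<^esub> x \<otimes>\<^bsub>?T\<^esub> inv\<^bsub>?T\<^esub> g) ` C)"
    "L = {g \<in> carrier ?T. \<pi> g = \<one>\<^bsub>W\<^esub>}"
    using TG.affine_of_supplement[OF finT AT LTs decT commT] unfolding W_eq by blast
  define lin where "lin g C = (\<lambda>x. g \<otimes> x \<otimes> inv g) ` C" for g C
  have aff: "affine_action ?T W \<pi> lin"
    by (rule affine_action_cong[OF pi(1)]) (simp add: lin_def fun_eq_iff m_inv_consistent[OF T])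
  have Wcg: "comm_group W" using affine_actionD(1)[OF aff] .
  have Wsub: "C \<subseteq> A" if "C \<in> carrier W" for C
    using that U(2) by (auto simp: W_def carrier_FactGroup r_coset_def)
  have "semilinear W (carrier ?T) lin"
  proof (rule semilinear_cong[OF sl[folded W_def] _ Wcg])
    fix g assume "g \<in> carrier ?T"
    then have "g \<in> A <#> S" by (simp add: T_def)
    then obtain a s where as: "a \<in> A" "s \<in> S" "g = a \<otimes> s" unfolding set_mult_def by blast
    have "lin g C = (\<lambda>x. s \<otimes> x \<otimes> inv s) ` C" if C: "C \<in> carrier W" for C
      unfolding lin_def
    proof (rule image_cong[OF refl])
      fix x assume "x \<in> C"
      then have x: "x \<in> A" using Wsub[OF C] by blast
      define y where "y = s \<otimes> x \<otimes> inv s"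
      have y: "y \<in> A" unfolding y_def by (rule conjA) (use as x in auto)
      have "g \<otimes> x \<otimes> inv g = a \<otimes> y \<otimes> inv a" using as x by (simp add: y_def inv_mult_group m_assoc)
      also have "\<dots> = y \<otimes> a \<otimes> inv a" using comm[OF as(1) y] by simp
      also have "\<dots> = y" using as(1) y by (simp add: m_assoc)
      finally show "g \<otimes> x \<otimes> inv g = s \<otimes> x \<otimes> inv s" by (simp add: y_def)
    qed
    then show "\<exists>s\<in>S. \<forall>w\<in>carrier W. lin g w = (\<lambda>x. s \<otimes> x \<otimes> inv s) ` w" using as(2) by blast
  qed
  moreover have "w [^]\<^bsub>W\<^esub> p i = \<one>\<^bsub>W\<^esub>" if w: "w \<in> carrier W" for w
  proof -
    interpret CA: comm_group "G\<lparr>carrier := A\<rparr>"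
      using A.subgroup_is_group[OF is_group] comm by (intro group.group_comm_groupI) auto
    interpret UN: normal U "G\<lparr>carrier := A\<rparr>"
      by (rule CA.subgroup_imp_normal[OF subgroup_incl[OF U(1) A.subgroup_axioms U(2)]])
    obtain x where x: "x \<in> A" "w = U #> x" using w by (auto simp: W_def carrier_FactGroup)
    have "w [^]\<^bsub>W\<^esub> p i = U #> (x [^] p i)" using UN.FactGroup_pow[of x "p i"] x by (simp add: W_def nat_pow_def)
    also have "\<dots> = U" using exp[OF x(1)] U.subset by simp
    finally show ?thesis by (simp add: W_def)
  qed
  moreover have cardT: "card T = card A * card S" unfolding T_def by (rule card_set_mult[OF A.subgroup_axioms S(1) AS])
  have cardL: "card L = card U * card S" unfolding L_def by (rule card_set_mult[OF U(1) S(1)]) (use AS U(2) in blast)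
  have cardG: "card (carrier G) = card A * card M"
  proof -
    have "carrier G = A <#> M"
      using dec setmult_subset_G[OF A.subset M.subset] unfolding set_mult_def by blast
    then show ?thesis using card_set_mult[OF A.subgroup_axioms Msub] MA by (simp add: Int_commute)
  qed
  have finAS: "finite A" "finite S" "finite U" using fin A.subset S.subset U.subset finite_subset by blast+
  then have pos: "card A > 0" "card S > 0" "card U > 0"
    using A.one_closed S.one_closed U.one_closed card_gt_0_iff by blast+
  have "card T = card (carrier W) * card L" using affine_action_card[OF TG.is_group finT aff] pi(2) by simp
  then have Wc: "card (carrier W) = c" using cardT cardL cA pos by simp
  have "c \<noteq> 0" "c \<noteq> 1" using cA pos card_subset_eq[OF finAS(1) U(2)] U(3) by auto
  then have c2: "c \<ge> 2" by simp
  have "\<not> A \<subseteq> L" using AL U(3) by blast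
  moreover have "card (carrier G) = t * card T" using cardG cM cardT by simp
  moreover have "c ^ t \<le> card A" using ct by simp
  moreover have "card T = c * card L" using cardT cardL cA by simp
  ultimately show ?thesis
    using T Lsub LT c2 Wc aff pi(2) pr[of i]
    by (intro exI[of _ T] exI[of _ L] exI[of _ t] exI[of _ c] exI[of _ W] exI[of _ \<pi>] exI[of _ lin] exI[of _ "p i"] conjI ballI)
qed

text \<open>
  The case of a minimal normal subgroup of the quotient by \<open>N\<close>, pulled back to \<open>G\<close>.
\<close>

lemma chief_factor_witness:
  fixes G :: "('a, 'b) monoid_scheme"
  assumes G: "prime_tower_group G p Q" and N: "N \<lhd> G" and A: "A \<lhd> G" and NA: "N \<subset> A"
    and min: "\<forall>K. K \<lhd> G \<longrightarrow> N \<subseteq> K \<longrightarrow> K \<subseteq> A \<longrightarrow> K = N \<or> K = A"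
  shows "\<exists>T L t q (W :: 'a set set monoid) \<pi> lin (r::nat). subgroup T G \<and> L \<subseteq> T \<and> N \<subseteq> L \<and> \<not> A \<subseteq> L \<and> card (carrier G) = t * card T \<and>
    q \<ge> 2 \<and> q ^ t * card N \<le> card A \<and> card T = q * card L \<and>
    semilinear_kernel (G\<lparr>carrier := T\<rparr>) q L W \<pi> lin r"
proof -
  interpret prime_tower_group G p Q by (rule G)
  interpret N: normal N G by (rule N)
  interpret A: normal A G by (rule A)
  define H where "H = G Mod N"
  define h where "h g = N #>\<^bsub>G\<^esub> g" for g
  interpret H: group H unfolding H_def by (rule N.factorgroup_is_group)
  interpret h: group_hom G H h
    by unfold_locales (use N.r_coset_hom_Mod in \<open>simp add: H_def h_def[abs_def]\<close>)
  have surj: "h ` carrier G = carrier H" by (simp add: H_def carrier_FactGroup h_def[abs_def])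
  interpret HT: prime_tower_group H p "\<lambda>i. h ` Q i"
    by (rule prime_tower_group_image[OF h.group_hom_axioms surj])
  have oneH: "\<one>\<^bsub>H\<^esub> = N" by (simp add: H_def)
  have hN: "h g = \<one>\<^bsub>H\<^esub> \<longleftrightarrow> g \<in> N" if "g \<in> carrier G" for g
    using N.rcos_const[OF is_group, of g] rcos_self[OF that N.subgroup_axioms] by (auto simp: h_def oneH)
  have hN1: "h g = \<one>\<^bsub>H\<^esub>" if "g \<in> N" for g using hN[of g] that by simp
  have ker: "kernel G H h = N" using hN N.subset by (auto simp: kernel_def)
  define pre where "pre X = {g \<in> carrier G. h g \<in> X}" for X
  have cpre: "card (pre X) = card X * card N" if "X \<subseteq> carrier H" for X
    using h.card_preimage[OF fin, of X] that surj ker by (simp add: pre_def)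
  have preh: "h ` pre X = X" if "X \<subseteq> carrier H" for X
    using that unfolding surj[symmetric] pre_def by blast
  have pre_sub: "subgroup (pre X) G" if X: "subgroup X H" for X
  proof (rule subgroupI)
    show "pre X \<noteq> {}" using subgroup.one_closed[OF X] h.hom_one one_closed by (auto simp: pre_def intro!: exI[of _ "\<one>\<^bsub>G\<^esub>"])
    show "inv\<^bsub>G\<^esub> g \<in> pre X" if "g \<in> pre X" for g using that subgroup.m_inv_closed[OF X] by (auto simp: pre_def)
    show "g \<otimes>\<^bsub>G\<^esub> k \<in> pre X" if "g \<in> pre X" "k \<in> pre X" for g k using that subgroup.m_closed[OF X] by (auto simp: pre_def)
  qed (auto simp: pre_def)
  define B where "B = h ` A"
  have B: "B \<lhd> H" unfolding B_def by (rule normal.surj_hom_normal_subgroup[OF A h.group_hom_axioms surj])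
  have BH: "B \<subseteq> carrier H" using subgroup.subset[OF normal_imp_subgroup[OF B]] .
  have preB: "pre B = A"
  proof
    show "A \<subseteq> pre B" using A.subset by (auto simp: pre_def B_def)
    show "pre B \<subseteq> A"
    proof
      fix g assume "g \<in> pre B"
      then obtain a where a: "g \<in> carrier G" "a \<in> A" "h g = h a" by (auto simp: pre_def B_def)
      have "h (g \<otimes>\<^bsub>G\<^esub> inv\<^bsub>G\<^esub> a) = \<one>\<^bsub>H\<^esub>" using a by simp
      then have "g \<otimes>\<^bsub>G\<^esub> inv\<^bsub>G\<^esub> a \<in> A" using hN[of "g \<otimes>\<^bsub>G\<^esub> inv\<^bsub>G\<^esub> a"] a NA by auto
      then have "(g \<otimes>\<^bsub>G\<^esub> inv\<^bsub>G\<^esub> a) \<otimes>\<^bsub>G\<^esub> a \<in> A" using a(2) by (rule A.m_closed)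
      then show "g \<in> A" using a by (simp add: m_assoc)
    qed
  qed
  have B1: "B \<noteq> {\<one>\<^bsub>H\<^esub>}"
  proof
    assume "B = {\<one>\<^bsub>H\<^esub>}"
    then have "h a = \<one>\<^bsub>H\<^esub>" if "a \<in> A" for a using that by (auto simp: B_def)
    then have "a \<in> N" if "a \<in> A" for a using hN[of a] that by simp
    then show False using NA by blast
  qed
  have minB: "\<forall>K. K \<lhd> H \<longrightarrow> K \<subseteq> B \<longrightarrow> K = {\<one>\<^bsub>H\<^esub>} \<or> K = B"
  proof (intro allI impI)
    fix K assume K: "K \<lhd> H" "K \<subseteq> B"
    have KH: "K \<subseteq> carrier H" using K(2) BH by blast
    have "pre K \<lhd> G"
      unfolding normal_inv_iff
    proof (intro conjI ballI pre_sub[OF normal_imp_subgroup[OF K(1)]])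
      fix x g assume xg: "x \<in> carrier G" "g \<in> pre K"
      then show "x \<otimes>\<^bsub>G\<^esub> g \<otimes>\<^bsub>G\<^esub> inv\<^bsub>G\<^esub> x \<in> pre K"
        using normal.inv_op_closed2[OF K(1), of "h x" "h g"] by (simp add: pre_def)
    qed
    moreover have "N \<subseteq> pre K"
      using hN1 N.subset subgroup.one_closed[OF normal_imp_subgroup[OF K(1)]] by (auto simp: pre_def)
    moreover have "pre K \<subseteq> A" unfolding preB[symmetric] using K(2) by (auto simp: pre_def)
    ultimately have "pre K = N \<or> pre K = A" by (rule min[rule_format])
    moreover have "h ` N = {\<one>\<^bsub>H\<^esub>}" 
      using hN1 N.one_closed by (auto intro!: image_eqI[of _ _ "\<one>\<^bsub>G\<^esub>"])
    ultimately show "K = {\<one>\<^bsub>H\<^esub>} \<or> K = B" using preh[OF KH] by (auto simp: B_def)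
  qed
  from HT.minimal_normal_witness[OF B B1 minB]
  obtain T L t q and W :: "'a set set monoid" and \<pi> lin and r :: nat where T: "subgroup T H" and L: "subgroup L H" "L \<subseteq> T" "\<not> B \<subseteq> L"
    and ct: "card (carrier H) = t * card T" and q: "q \<ge> 2" "q ^ t \<le> card B" "card T = q * card L"
    and W: "Factorial_Ring.prime r" "affine_action (H\<lparr>carrier := T\<rparr>) W \<pi> lin"
      "\<forall>w\<in>carrier W. w [^]\<^bsub>W\<^esub> r = \<one>\<^bsub>W\<^esub>" "card (carrier W) = q"
      "L = {g \<in> carrier (H\<lparr>carrier := T\<rparr>). \<pi> g = \<one>\<^bsub>W\<^esub>}" "semilinear W (carrier (H\<lparr>carrier := T\<rparr>)) lin"
    by - (elim exE conjE, rule that)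
  have TH: "T \<subseteq> carrier H" by (rule subgroup.subset[OF T])
  have LH: "L \<subseteq> carrier H" by (rule subgroup.subset[OF L(1)])
  define \<pi>' where "\<pi>' g = \<pi> (h g)" for g
  define lin' where "lin' g = lin (h g)" for g
  have Wcg: "comm_group W" by (rule affine_actionD(1)[OF W(2)])
  have "affine_action (G\<lparr>carrier := pre T\<rparr>) W \<pi>' lin'"
    unfolding affine_action_def
  proof (intro conjI ballI Wcg affine_actionD(2)[OF W(2)])
    have "\<pi>' ` pre T = \<pi> ` (h ` pre T)" by (simp add: \<pi>'_def[abs_def] image_image)
    then show "\<pi>' ` carrier (G\<lparr>carrier := pre T\<rparr>) = carrier W" using preh[OF TH] affine_actionD(3)[OF W(2)] by simp
    show "lin' g \<in> hom W W" if "g \<in> carrier (G\<lparr>carrier := pre T\<rparr>)" for g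
      using that affine_actionD(4)[OF W(2), of "h g"] by (simp add: lin'_def pre_def)
    show "\<pi>' (g \<otimes>\<^bsub>G\<lparr>carrier := pre T\<rparr>\<^esub> k) = \<pi>' g \<otimes>\<^bsub>W\<^esub> lin' g (\<pi>' k)"
      if "g \<in> carrier (G\<lparr>carrier := pre T\<rparr>)" "k \<in> carrier (G\<lparr>carrier := pre T\<rparr>)" for g k
      using that affine_actionD(5)[OF W(2), of "h g" "h k"] by (simp add: lin'_def \<pi>'_def pre_def)
  qed
  moreover have "semilinear W (carrier (G\<lparr>carrier := pre T\<rparr>)) lin'"
    by (rule semilinear_cong[OF W(6) _ Wcg]) (auto simp: lin'_def pre_def)
  moreover have "pre L = {g \<in> carrier (G\<lparr>carrier := pre T\<rparr>). \<pi>' g = \<one>\<^bsub>W\<^esub>}"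
    unfolding W(5) by (auto simp: pre_def \<pi>'_def)
  moreover have "card (carrier G) = t * card (pre T)"
  proof -
    have "pre (carrier H) = carrier G" by (auto simp: pre_def)
    then show ?thesis using cpre[of "carrier H"] cpre[OF TH] ct by simp
  qed
  moreover have "q ^ t * card N \<le> card A"
    using cpre[OF BH] q(2) preB by (simp add: mult_right_mono)
  moreover have "card (pre T) = q * card (pre L)" using cpre[OF TH] cpre[OF LH] q(3) by simp
  moreover have "N \<subseteq> pre L" using hN1 N.subset subgroup.one_closed[OF L(1)] by (auto simp: pre_def)
  moreover have "\<not> A \<subseteq> pre L"
  proof
    assume "A \<subseteq> pre L"
    then have "B \<subseteq> L" by (auto simp: B_def pre_def)
    then show False using L(3) by simp
  qed
  moreover have "pre L \<subseteq> pre T" using L(2) by (auto simp: pre_def)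
  ultimately show ?thesis using pre_sub[OF T] q(1) W(1,3,4)
    by (intro exI[of _ "pre T"] exI[of _ "pre L"] exI[of _ t] exI[of _ q] exI[of _ W] exI[of _ \<pi>'] exI[of _ lin'] exI[of _ r] conjI)
qed

lemma inverse_square_sum: "(\<Sum>n = 2..k. 1 / real n ^ 2) \<le> 1 - 1 / real k" if "k \<ge> 1" for k
  using that
proof (induction k rule: dec_induct)
  case base
  then show ?case by simp
next
  case (step k)
  have k: "real k > 0" using step by simp
  have "1 / real (Suc k) ^ 2 \<le> 1 / (real k * real (Suc k))"
    using k by (intro divide_left_mono) (auto simp: power2_eq_square intro: mult_right_mono)
  also have "\<dots> = 1 / real k - 1 / real (Suc k)" using k by (simp add: field_simps)
  finally show ?case using step by simp
qed

text \<open>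
  The subgroups \<open>L\<close> that chief factors of order \<open>n\<close> can contribute, with all reference to the chief
  factor removed, so that they can be counted.
\<close>

definition chief_stabilisers :: "('a, 'b) monoid_scheme \<Rightarrow> nat \<Rightarrow> 'a set set" where
  "chief_stabilisers G n = {L. \<exists>T t q (W :: 'a set set monoid) \<pi> lin (r::nat). subgroup T G \<and> L \<subseteq> T \<and> card (carrier G) = t * card T \<and>
    q \<ge> 2 \<and> q ^ t \<le> n \<and> card T = q * card L \<and>
    semilinear_kernel (G\<lparr>carrier := T\<rparr>) q L W \<pi> lin r}"

text \<open>
  There are at most \<open>n ^ 2\<close> pairs \<open>(t, q)\<close>. For each there are at most \<open>2 ^ (18 * d * (t - 1)) \<le> n ^ (18 * d)\<close>
  subgroups \<open>T\<close>. Each \<open>T\<close> has \<open>t * d\<close> generators, hence at most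
  \<open>q ^ (3 + 7 * (t * d)) \<le> n ^ (3 + 7 * d)\<close> stabilisers \<open>L\<close>. In total the exponent is
  \<open>2 + 18 * d + 3 + 7 * d\<close>.
\<close>

lemma (in prime_tower_group) card_chief_stabilisers:
  assumes R: "R \<subseteq> carrier G" "generate G R = carrier G" and d: "card R \<le> d" "d \<ge> 1" and n: "n \<ge> 2"
  shows "finite (chief_stabilisers G n) \<and> card (chief_stabilisers G n) \<le> n ^ (25 * d + 5)"
proof -
  define I where "I = {(t, q). 1 \<le> t \<and> 2 \<le> q \<and> q ^ t \<le> n}"
  define \<T> where "\<T> t = {T. subgroup T G \<and> card (carrier G) = t * card T}" for t
  define \<L> where "\<L> q T = {L. (\<exists>(W :: 'a set set monoid) \<pi> lin (r::nat). semilinear_kernel (G\<lparr>carrier := T\<rparr>) q L W \<pi> lin r)}" for q T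
  have I: "I \<subseteq> {1..n} \<times> {1..n}"
  proof clarify
    fix t q assume "(t, q) \<in> I"
    then have tq: "1 \<le> t" "2 \<le> q" "q ^ t \<le> n" by (auto simp: I_def)
    have "t < q ^ t" using tq by (simp add: power_gt_expt)
    moreover have "q ^ 1 \<le> q ^ t" using tq by (intro power_increasing) auto
    ultimately show "t \<in> {1..n} \<and> q \<in> {1..n}" using tq by auto
  qed
  then have finI: "finite I" by (rule finite_subset) simp
  have "card I \<le> card ({1..n} \<times> {1..n})" using I by (intro card_mono) auto
  then have cardI: "card I \<le> n ^ 2" by (simp add: card_cartesian_product power2_eq_square)
  have finT: "finite (\<T> t)" for t
    by (rule finite_subset[of _ "Pow (carrier G)"]) (use fin subgroup.subset in \<open>auto simp: \<T>_def\<close>)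
  have cardTL: "finite (\<Union>T\<in>\<T> t. \<L> q T) \<and> card (\<Union>T\<in>\<T> t. \<L> q T) \<le> n ^ (25 * d + 3)" if "(t, q) \<in> I" for t q
  proof -
    have tq: "1 \<le> t" "2 \<le> q" "q ^ t \<le> n" using that by (auto simp: I_def)
    have cT: "card (\<T> t) \<le> 2 ^ (18 * d * (t - 1))"
      unfolding \<T>_def by (rule card_subgroups_of_index_le[OF prime_tower_group_axioms R d tq(1)])
    have cL: "finite (\<L> q T) \<and> card (\<L> q T) \<le> q ^ (3 + 7 * (t * d))" if T: "T \<in> \<T> t" for T
    proof -
      have Tsub: "subgroup T G" and Tt: "card (carrier G) = t * card T" using T by (auto simp: \<T>_def)
      obtain R' where R': "R' \<subseteq> T" "generate (G\<lparr>carrier := T\<rparr>) R' = T" "card R' \<le> t * card R"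
        using schreier_generators[OF fin R Tsub Tt] by blast
      have gT: "group (G\<lparr>carrier := T\<rparr>)" by (rule subgroup.subgroup_is_group[OF Tsub is_group])
      have fT: "finite (carrier (G\<lparr>carrier := T\<rparr>))" using finite_subset[OF subgroup.subset[OF Tsub] fin] by simp
      have "finite (\<L> q T) \<and> card (\<L> q T) \<le> q ^ (3 + 7 * card R')"
      proof (rule card_semilinear_kernels_le[OF gT fT _ _ tq(2), where ?'w = "'a set set" and ?'c = unit])
        show "\<exists>(W :: 'a set set monoid) \<pi> lin (r::nat). semilinear_kernel (G\<lparr>carrier := T\<rparr>) q L W \<pi> lin r"
          if "L \<in> \<L> q T" for L using that unfolding \<L>_def mem_Collect_eq .
      qed (use R' in auto)
      moreover have "q ^ (3 + 7 * card R') \<le> q ^ (3 + 7 * (t * d))"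
      proof (rule power_increasing)
        have "card R' \<le> t * d" using R'(3) d(1) by (metis le_trans mult_le_mono2)
        then show "3 + 7 * card R' \<le> 3 + 7 * (t * d)" by simp
      qed (use tq in simp)
      ultimately show ?thesis by linarith
    qed
    have "card (\<Union>T\<in>\<T> t. \<L> q T) \<le> (\<Sum>T\<in>\<T> t. card (\<L> q T))" by (rule card_UN_le[OF finT])
    also have "\<dots> \<le> (\<Sum>T\<in>\<T> t. q ^ (3 + 7 * (t * d)))" by (rule sum_mono) (use cL in blast)
    also have "\<dots> = card (\<T> t) * q ^ (3 + 7 * (t * d))" by simp
    also have "\<dots> \<le> n ^ (18 * d) * (n ^ 3 * n ^ (7 * d))"
    proof (rule mult_mono)
      have "(2::nat) ^ (18 * d * (t - 1)) \<le> 2 ^ (t * (18 * d))" by (rule power_increasing) auto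
      also have "\<dots> = (2 ^ t) ^ (18 * d)" by (rule power_mult)
      also have "\<dots> \<le> n ^ (18 * d)"
      proof (rule power_mono)
        have "(2::nat) ^ t \<le> q ^ t" using tq by (intro power_mono) auto
        then show "2 ^ t \<le> n" using tq by linarith
      qed simp
      finally show "card (\<T> t) \<le> n ^ (18 * d)" using cT by linarith
      have "q ^ 1 \<le> q ^ t" using tq by (intro power_increasing) auto
      then have "q ^ 3 \<le> n ^ 3" using tq by (intro power_mono) auto
      moreover have "q ^ (7 * (t * d)) = (q ^ t) ^ (7 * d)" by (simp add: power_mult[symmetric] mult_ac)
      moreover have "(q ^ t) ^ (7 * d) \<le> n ^ (7 * d)" using tq by (intro power_mono) auto
      ultimately show "q ^ (3 + 7 * (t * d)) \<le> n ^ 3 * n ^ (7 * d)" unfolding power_add by (simp add: mult_mono)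
    qed auto
    also have "\<dots> = n ^ (25 * d + 3)" by (simp add: power_add[symmetric] algebra_simps)
    finally show ?thesis using finT cL by blast
  qed
  have sub: "chief_stabilisers G n \<subseteq> (\<Union>(t, q)\<in>I. \<Union>T\<in>\<T> t. \<L> q T)"
  proof
    fix L assume "L \<in> chief_stabilisers G n"
    then obtain T t q and W :: "'a set set monoid" and \<pi> lin and r :: nat where *: "subgroup T G" "L \<subseteq> T"
      "card (carrier G) = t * card T" "q \<ge> 2" "q ^ t \<le> n" "card T = q * card L" and W: "Factorial_Ring.prime r" "affine_action (G\<lparr>carrier := T\<rparr>) W \<pi> lin"
      "\<forall>w\<in>carrier W. w [^]\<^bsub>W\<^esub> r = \<one>\<^bsub>W\<^esub>" "card (carrier W) = q"
      "L = {g \<in> carrier (G\<lparr>carrier := T\<rparr>). \<pi> g = \<one>\<^bsub>W\<^esub>}" "semilinear W (carrier (G\<lparr>carrier := T\<rparr>)) lin"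
      unfolding chief_stabilisers_def mem_Collect_eq by - (elim exE conjE, rule that)
    have "L \<in> \<L> q T" unfolding \<L>_def mem_Collect_eq
      by (rule exI[of _ W], rule exI[of _ \<pi>], rule exI[of _ lin], rule exI[of _ r], intro conjI W)
    have "card (carrier G) > 0" using fin one_closed card_gt_0_iff by blast
    then have "t \<ge> 1" using *(3) by (cases t) auto
    then have "(t, q) \<in> I" "T \<in> \<T> t" using * by (auto simp: I_def \<T>_def)
    then show "L \<in> (\<Union>(t, q)\<in>I. \<Union>T\<in>\<T> t. \<L> q T)"
      using \<open>L \<in> \<L> q T\<close> by (intro UN_I[of "(t, q)"]) auto
  qed
  have finU: "finite (\<Union>(t, q)\<in>I. \<Union>T\<in>\<T> t. \<L> q T)" by (rule finite_UN_I[OF finI]) (use cardTL in auto)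
  have "card (chief_stabilisers G n) \<le> card (\<Union>(t, q)\<in>I. \<Union>T\<in>\<T> t. \<L> q T)" by (rule card_mono[OF finU sub])
  also have "\<dots> \<le> (\<Sum>x\<in>I. card (case x of (t, q) \<Rightarrow> \<Union>T\<in>\<T> t. \<L> q T))" by (rule card_UN_le[OF finI])
  also have "\<dots> \<le> (\<Sum>x\<in>I. n ^ (25 * d + 3))" by (rule sum_mono) (use cardTL in auto)
  also have "\<dots> = card I * n ^ (25 * d + 3)" by simp
  also have "\<dots> \<le> n ^ 2 * n ^ (25 * d + 3)" using cardI by (rule mult_right_mono) simp
  also have "\<dots> = n ^ (25 * d + 5)"
    unfolding power_add[symmetric] by (rule arg_cong[where f = "\<lambda>e. n ^ e"]) simp
  finally show ?thesis using finite_subset[OF sub finU] by simp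
qed

text \<open>
  Choose \<open>A\<close> minimal among the normal subgroups properly containing \<open>N\<close>, and the stabiliser \<open>L\<close> for the
  chief factor \<open>A / N\<close>, which contains \<open>N\<close> but not \<open>A\<close>. The largest normal subgroup of \<open>G\<close>
  inside \<open>A \<inter> L\<close> lies between \<open>N\<close> and \<open>A\<close> and differs from \<open>A\<close>, so it is \<open>N\<close>: the pair \<open>(A, L)\<close>
  determines \<open>N\<close>. The exponent is that of \<open>card_chief_stabilisers\<close> increased by 2, to make the sum over
  the orders \<open>n\<close> of chief factors converge.
\<close>

lemma (in prime_tower_group) card_normal_subgroups_le:
  assumes R: "R \<subseteq> carrier G" "generate G R = carrier G" and d: "card R \<le> d" "d \<ge> 1" and k: "k \<ge> 1"
  shows "card {N. N \<lhd> G \<and> card (carrier G) = k * card N} \<le> k ^ (25 * d + 7)"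
  using k
proof (induction k rule: less_induct)
  case (less k)
  define \<N> where "\<N> k = {N. N \<lhd> G \<and> card (carrier G) = k * card N}" for k
  define c where "c = 25 * d + 5"
  have finN: "finite (\<N> k)" for k
    by (rule finite_subset[of _ "Pow (carrier G)"]) (use fin subgroup.subset[OF normal_imp_subgroup] in \<open>fastforce simp: \<N>_def\<close>)+
  have pos: "card N > 0" if "N \<lhd> G" for N
    using finite_subset[OF subgroup.subset[OF normal_imp_subgroup[OF that]] fin] subgroup.one_closed[OF normal_imp_subgroup[OF that]]
      card_gt_0_iff by blast
  show ?case
  proof (cases "k = 1")
    case True
    have "\<N> k \<subseteq> {carrier G}"
    proof
      fix N assume "N \<in> \<N> k"
      then have N: "N \<lhd> G" "card (carrier G) = k * card N" by (auto simp: \<N>_def)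
      have "N = carrier G"
        by (rule card_subset_eq[OF fin subgroup.subset[OF normal_imp_subgroup[OF N(1)]]]) (use N(2) True in simp)
      then show "N \<in> {carrier G}" by simp
    qed
    then have "card (\<N> k) \<le> card {carrier G}" by (intro card_mono) auto
    then show ?thesis using True by (simp add: \<N>_def)
  next
    case False
    then have k2: "k \<ge> 2" using less.prems by simp
    define J where "J = {n \<in> {2..k}. n dvd k}"
    define core where "core A L = {x \<in> A. \<forall>g\<in>carrier G. g \<otimes> x \<otimes> inv g \<in> L}" for A L
    have sub: "\<N> k \<subseteq> (\<Union>n\<in>J. (\<lambda>(A, L). core A L) ` (\<N> (k div n) \<times> chief_stabilisers G n))"
    proof
      fix N assume "N \<in> \<N> k"
      then have N: "N \<lhd> G" "card (carrier G) = k * card N" by (auto simp: \<N>_def)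
      interpret N: normal N G by (rule N(1))
      define \<K> where "\<K> = {K. K \<lhd> G \<and> N \<subset> K}"
      have finK: "finite \<K>"
      proof (rule finite_subset)
        show "\<K> \<subseteq> Pow (carrier G)"
          unfolding \<K>_def by (intro subsetI PowI) (blast dest: subgroup.subset[OF normal_imp_subgroup])
      qed (simp add: fin)
      have "N \<noteq> carrier G" using N(2) k2 pos[OF N(1)] by auto
      then have "carrier G \<in> \<K>" using normal_self N.subset by (auto simp: \<K>_def)
      then obtain A where A: "A \<in> \<K>" and Amin: "\<And>K. K \<in> \<K> \<Longrightarrow> K \<subseteq> A \<Longrightarrow> A = K"
        using finite_has_minimal[OF finK] by blast
      have An: "A \<lhd> G" "N \<subset> A" using A by (auto simp: \<K>_def)
      have min: "\<forall>K. K \<lhd> G \<longrightarrow> N \<subseteq> K \<longrightarrow> K \<subseteq> A \<longrightarrow> K = N \<or> K = A"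
        using Amin by (auto simp: \<K>_def)
      interpret A: normal A G by (rule An(1))
      obtain T L t q and W :: "'a set set monoid" and \<pi> lin and r :: nat where w: "subgroup T G" "L \<subseteq> T" "N \<subseteq> L" "\<not> A \<subseteq> L"
        "card (carrier G) = t * card T" "q \<ge> 2" "q ^ t * card N \<le> card A" "card T = q * card L" and W: "Factorial_Ring.prime r" "affine_action (G\<lparr>carrier := T\<rparr>) W \<pi> lin"
      "\<forall>w\<in>carrier W. w [^]\<^bsub>W\<^esub> r = \<one>\<^bsub>W\<^esub>" "card (carrier W) = q"
      "L = {g \<in> carrier (G\<lparr>carrier := T\<rparr>). \<pi> g = \<one>\<^bsub>W\<^esub>}" "semilinear W (carrier (G\<lparr>carrier := T\<rparr>)) lin"
        using chief_factor_witness[OF prime_tower_group_axioms N(1) An min] by - (elim exE conjE, rule that)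
      obtain j where j: "card (carrier G) = j * card A" using subgroup_card_dvd[OF A.subgroup_axioms] by blast
      have NA: "subgroup N (G\<lparr>carrier := A\<rparr>)" using subgroup_incl[OF N.subgroup_axioms A.subgroup_axioms] An(2) by blast
      obtain n where n: "card A = n * card N"
        using group.subgroup_card_dvd[OF A.subgroup_is_group[OF is_group] NA] by auto
      have kjn: "k = j * n" using N(2) j n pos[OF N(1)] by simp
      have jn: "j \<ge> 1" "n \<ge> 1" using kjn k2 by (auto intro!: Nat.gr0I simp: Suc_le_eq)
      have "n \<noteq> 1"
      proof
        assume "n = 1"
        then have "N = A" using card_subset_eq[OF finite_subset[OF A.subset fin]] An(2) n by auto
        then show False using An(2) by blast
      qed
      then have n2: "n \<ge> 2" using jn by simp
      have "n \<in> J" using n2 kjn jn by (auto simp: J_def)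
      moreover have "A \<in> \<N> (k div n)" using An(1) j kjn n2 by (simp add: \<N>_def)
      moreover have "L \<in> chief_stabilisers G n"
        unfolding chief_stabilisers_def mem_Collect_eq
      proof (rule exI[of _ T], rule exI[of _ t], rule exI[of _ q], rule exI[of _ W], rule exI[of _ \<pi>],
          rule exI[of _ lin], rule exI[of _ r], intro conjI w(1,2,5,6,8) W)
        show "q ^ t \<le> n" using w(7) n pos[OF N(1)] by simp
      qed
      moreover have "N = core A L"
      proof -
        have "core A L \<lhd> G"
          unfolding normal_inv_iff
        proof (intro conjI ballI)
          interpret TT: subgroup T G by (rule w(1))
          have gT: "group (G\<lparr>carrier := T\<rparr>)" by (rule TT.subgroup_is_group[OF is_group])
          have Lsub: "subgroup L G"
            using incl_subgroup[OF w(1) affine_kernel_subgroup[OF gT W(2)]] W(5) by simp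
          interpret L: subgroup L G by (rule Lsub)
          show "subgroup (core A L) G"
          proof (rule subgroupI)
            show "core A L \<subseteq> carrier G" using A.subset by (auto simp: core_def)
            show "core A L \<noteq> {}" using A.one_closed by (auto simp: core_def intro!: exI[of _ \<one>])
            show "inv x \<in> core A L" if "x \<in> core A L" for x
            proof -
              have x: "x \<in> A" "\<And>g. g \<in> carrier G \<Longrightarrow> g \<otimes> x \<otimes> inv g \<in> L" using that by (auto simp: core_def)
              have "g \<otimes> inv x \<otimes> inv g = inv (g \<otimes> x \<otimes> inv g)" if "g \<in> carrier G" for g
                using that x(1) by (simp add: inv_mult_group m_assoc)
              then show ?thesis using x by (simp add: core_def)
            qed
            show "x \<otimes> y \<in> core A L" if "x \<in> core A L" "y \<in> core A L" for x y
            proof -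
              have x: "x \<in> A" "\<And>g. g \<in> carrier G \<Longrightarrow> g \<otimes> x \<otimes> inv g \<in> L" using that by (auto simp: core_def)
              have y: "y \<in> A" "\<And>g. g \<in> carrier G \<Longrightarrow> g \<otimes> y \<otimes> inv g \<in> L" using that by (auto simp: core_def)
              have "g \<otimes> (x \<otimes> y) \<otimes> inv g = (g \<otimes> x \<otimes> inv g) \<otimes> (g \<otimes> y \<otimes> inv g)" if "g \<in> carrier G" for g
                using that x(1) y(1) by (simp add: m_assoc)
              then show ?thesis using x y by (simp add: core_def)
            qed
          qed
          fix g x assume g: "g \<in> carrier G" and "x \<in> core A L"
          then have x: "x \<in> A" "\<And>g. g \<in> carrier G \<Longrightarrow> g \<otimes> x \<otimes> inv g \<in> L" by (auto simp: core_def)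
          have "f \<otimes> (g \<otimes> x \<otimes> inv g) \<otimes> inv f = (f \<otimes> g) \<otimes> x \<otimes> inv (f \<otimes> g)" if "f \<in> carrier G" for f
            using that g x(1) by (simp add: inv_mult_group m_assoc)
          then show "g \<otimes> x \<otimes> inv g \<in> core A L" using x g A.inv_op_closed2[OF g x(1)] by (simp add: core_def)
        qed
        moreover have "N \<subseteq> core A L" using An(2) w(3) N.inv_op_closed2 by (auto simp: core_def)
        moreover have "core A L \<subseteq> A" by (auto simp: core_def)
        moreover have "core A L \<noteq> A"
        proof
          assume e: "core A L = A"
          have "x \<in> L" if x: "x \<in> A" for x
          proof -
            have "x \<in> core A L" using e x by simp
            then have "\<one> \<otimes> x \<otimes> inv \<one> \<in> L" unfolding core_def by blast
            then show ?thesis using x by simp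
          qed
          then show False using w(4) by blast
        qed
        ultimately show ?thesis using min by blast
      qed
      ultimately show "N \<in> (\<Union>n\<in>J. (\<lambda>(A, L). core A L) ` (\<N> (k div n) \<times> chief_stabilisers G n))"
        by (intro UN_I[of n] image_eqI[of _ _ "(A, L)"]) auto
    qed
    have cs: "finite (chief_stabilisers G n)" "card (chief_stabilisers G n) \<le> n ^ c" if "n \<in> J" for n
      using card_chief_stabilisers[OF R d, of n] that by (auto simp: J_def c_def)
    have finJ: "finite J" by (simp add: J_def)
    have "card (\<N> k) \<le> card (\<Union>n\<in>J. (\<lambda>(A, L). core A L) ` (\<N> (k div n) \<times> chief_stabilisers G n))"
      by (rule card_mono[OF _ sub]) (use finJ finN cs in auto)
    also have "\<dots> \<le> (\<Sum>n\<in>J. card ((\<lambda>(A, L). core A L) ` (\<N> (k div n) \<times> chief_stabilisers G n)))"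
      by (rule card_UN_le[OF finJ])
    also have "\<dots> \<le> (\<Sum>n\<in>J. (k div n) ^ (c + 2) * n ^ c)"
    proof (rule sum_mono)
      fix n assume n: "n \<in> J"
      have kn: "k div n < k" "k div n \<ge> 1" using n k2 by (auto simp: J_def Suc_le_eq div_greater_zero_iff)
      have "card ((\<lambda>(A, L). core A L) ` (\<N> (k div n) \<times> chief_stabilisers G n)) \<le> card (\<N> (k div n) \<times> chief_stabilisers G n)"
        using finN cs[OF n] by (intro card_image_le) auto
      also have "\<dots> = card (\<N> (k div n)) * card (chief_stabilisers G n)" by (rule card_cartesian_product)
      also have "\<dots> \<le> (k div n) ^ (c + 2) * n ^ c"
      proof (rule mult_mono)
        have "c + 2 = 25 * d + 7" by (simp add: c_def)
        then show "card (\<N> (k div n)) \<le> (k div n) ^ (c + 2)" using less.IH[OF kn] by (simp only: \<N>_def)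
      qed (use cs(2)[OF n] in auto)
      finally show "card ((\<lambda>(A, L). core A L) ` (\<N> (k div n) \<times> chief_stabilisers G n)) \<le> (k div n) ^ (c + 2) * n ^ c" .
    qed
    finally have le: "card (\<N> k) \<le> (\<Sum>n\<in>J. (k div n) ^ (c + 2) * n ^ c)" .
    have "real (card (\<N> k)) \<le> real (\<Sum>n\<in>J. (k div n) ^ (c + 2) * n ^ c)" using le by (rule of_nat_mono)
    also have "\<dots> = (\<Sum>n\<in>J. real k ^ (c + 2) * (1 / real n ^ 2))"
      unfolding of_nat_sum
    proof (rule sum.cong[OF refl])
      fix n assume n: "n \<in> J"
      obtain j where j: "k = n * j" using n by (auto simp: J_def)
      have n0: "n > 0" using n by (auto simp: J_def)
      have "k div n = j" using j n0 by simp
      then show "real ((k div n) ^ (c + 2) * n ^ c) = real k ^ (c + 2) * (1 / real n ^ 2)"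
        using n0 by (simp add: j power_mult_distrib power2_eq_square)
    qed
    also have "\<dots> = real k ^ (c + 2) * (\<Sum>n\<in>J. 1 / real n ^ 2)" by (simp only: sum_distrib_left)
    also have "\<dots> \<le> real k ^ (c + 2) * 1"
    proof (rule mult_left_mono)
      have "(\<Sum>n\<in>J. 1 / real n ^ 2) \<le> (\<Sum>n = 2..k. 1 / real n ^ 2)" by (rule sum_mono2) (auto simp: J_def)
      also have "\<dots> \<le> 1 - 1 / real k" by (rule inverse_square_sum[OF less.prems])
      also have "\<dots> \<le> 1" by simp
      finally show "(\<Sum>n\<in>J. 1 / real n ^ 2) \<le> 1" .
    qed simp
    finally have "real (card (\<N> k)) \<le> real (k ^ (c + 2))" by simp
    then have "card (\<N> k) \<le> k ^ (c + 2)" by (simp only: of_nat_le_iff)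
    moreover have "c + 2 = 25 * d + 7" by (simp add: c_def)
    ultimately show ?thesis by (simp only: \<N>_def)
  qed
qed

section \<open>From the profinite group to its finite quotients\<close>

context topological_group begin

lemma continuous_l_mult:
  assumes "g \<in> carrier G"
  shows "continuous_map T T (\<lambda>x. g \<otimes> x)"
proof -
  have "continuous_map T (prod_topology T T) (\<lambda>x. (g, x))"
    by (intro continuous_map_pairedI) (use assms topspace_eq in \<open>auto simp: continuous_map_const\<close>)
  from continuous_map_compose[OF this continuous_mult] show ?thesis by (simp add: o_def)
qed

lemma continuous_r_mult:
  assumes "g \<in> carrier G"
  shows "continuous_map T T (\<lambda>x. x \<otimes> g)"
proof -
  have "continuous_map T (prod_topology T T) (\<lambda>x. (x, g))"
    by (intro continuous_map_pairedI) (use assms topspace_eq in \<open>auto simp: continuous_map_const\<close>)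
  from continuous_map_compose[OF this continuous_mult] show ?thesis by (simp add: o_def)
qed

lemma continuous_conj:
  assumes "g \<in> carrier G"
  shows "continuous_map T T (\<lambda>x. g \<otimes> x \<otimes> inv g)"
  using continuous_map_compose[OF continuous_l_mult[OF assms] continuous_r_mult[of "inv g"]] assms
  by (simp add: o_def)

lemma closure_of_subgroup:
  assumes H: "subgroup H G"
  shows "subgroup (T closure_of H) G"
proof (rule subgroupI)
  have HT: "H \<subseteq> topspace T" using subgroup.subset[OF H] topspace_eq by simp
  have sub: "H \<subseteq> T closure_of H" by (rule closure_of_subset[OF HT])
  show cl: "T closure_of H \<subseteq> carrier G" using closure_of_subset_topspace[of T H] topspace_eq by simp
  show "T closure_of H \<noteq> {}" using sub subgroup.one_closed[OF H] by blast
  show "inv x \<in> T closure_of H" if x: "x \<in> T closure_of H" for x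
  proof -
    have "(\<lambda>x. inv x) ` (T closure_of H) \<subseteq> T closure_of ((\<lambda>x. inv x) ` H)"
      by (rule continuous_map_image_closure_subset[OF continuous_inv])
    also have "\<dots> \<subseteq> T closure_of H" by (rule closure_of_mono) (use subgroup.m_inv_closed[OF H] in auto)
    finally show ?thesis using x by blast
  qed
  have left: "h \<otimes> x \<in> T closure_of H" if h: "h \<in> H" and x: "x \<in> T closure_of H" for h x
  proof -
    have hc: "h \<in> carrier G" using h subgroup.subset[OF H] by blast
    have "(\<lambda>x. h \<otimes> x) ` (T closure_of H) \<subseteq> T closure_of ((\<lambda>x. h \<otimes> x) ` H)"
      by (rule continuous_map_image_closure_subset[OF continuous_l_mult[OF hc]])
    also have "\<dots> \<subseteq> T closure_of H" by (rule closure_of_mono) (use subgroup.m_closed[OF H h] in auto)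
    finally show ?thesis using x by blast
  qed
  show "x \<otimes> y \<in> T closure_of H" if x: "x \<in> T closure_of H" and y: "y \<in> T closure_of H" for x y
  proof -
    have yc: "y \<in> carrier G" using y cl by blast
    have "(\<lambda>x. x \<otimes> y) ` (T closure_of H) \<subseteq> T closure_of ((\<lambda>x. x \<otimes> y) ` H)"
      by (rule continuous_map_image_closure_subset[OF continuous_r_mult[OF yc]])
    also have "\<dots> \<subseteq> T closure_of (T closure_of H)" by (rule closure_of_mono) (use left[OF _ y] in auto)
    finally show ?thesis using x by (auto simp: closure_of_closure_of)
  qed
qed

text \<open>
  The closure in the definition of \<open>D_subgroup\<close> is taken in \<open>S\<close>; for closed \<open>S\<close> it agrees with the closure
  in the whole group. Normality in the whole group, not only in \<open>S\<close>, holds because conjugation permutes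
  the generators and is continuous.
\<close>

lemma D_subgroup_step:
  fixes p :: nat
  assumes S: "S \<lhd> G" and cl: "closedin T S"
  defines "D \<equiv> D_subgroup p (G\<lparr>carrier := S\<rparr>) (subtopology T S)"
  shows "D \<lhd> G" "closedin T D" "D \<subseteq> S" "x \<in> S \<Longrightarrow> x [^] p \<in> D"
    "x \<in> S \<Longrightarrow> y \<in> S \<Longrightarrow> x \<otimes> y \<otimes> inv x \<otimes> inv y \<in> D"
proof -
  interpret S: normal S G by (rule S)
  interpret SG: group "G\<lparr>carrier := S\<rparr>" by (rule S.subgroup_is_group[OF is_group])
  have pw: "x [^]\<^bsub>G\<lparr>carrier := S\<rparr>\<^esub> (n::nat) = x [^] n" for x n by (simp add: nat_pow_def)
  define Y where "Y = derived_set G S \<union> {x [^] p |x. x \<in> S}"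
  have powS: "x [^] (n::nat) \<in> S" if "x \<in> S" for x n using SG.nat_pow_closed[of x n] that by (simp add: pw)
  have YS: "Y \<subseteq> S" using powS by (auto simp: Y_def)
  have YG: "Y \<subseteq> carrier G" using YS S.subset by blast
  define X where "X = generate G Y"
  have X: "subgroup X G" unfolding X_def by (rule generate_is_subgroup[OF YG])
  have XS: "X \<subseteq> S" unfolding X_def by (rule generate_subgroup_incl[OF YS S.subgroup_axioms])
  have "generate (G\<lparr>carrier := S\<rparr>) Y = X" unfolding X_def by (rule generate_consistent[OF YS S.subgroup_axioms])
  moreover have "derived_set (G\<lparr>carrier := S\<rparr>) (carrier (G\<lparr>carrier := S\<rparr>)) \<union>
      {x [^]\<^bsub>G\<lparr>carrier := S\<rparr>\<^esub> p |x. x \<in> carrier (G\<lparr>carrier := S\<rparr>)} = Y"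
    using derived_set_consistent[OF order_refl S.subgroup_axioms] by (simp add: Y_def pw)
  ultimately have "D = subtopology T S closure_of X" by (simp add: D_def D_subgroup_def)
  also have "\<dots> = S \<inter> T closure_of X" using XS by (simp add: closure_of_subtopology Int_absorb1)
  also have "\<dots> = T closure_of X" using closure_of_minimal[OF XS cl] by blast
  finally have D: "D = T closure_of X" .
  show "closedin T D" unfolding D by (rule closedin_closure_of)
  show "D \<subseteq> S" unfolding D by (rule closure_of_minimal[OF XS cl])
  have "X \<subseteq> topspace T" using XS S.subset topspace_eq by simp
  then have XD: "X \<subseteq> D" unfolding D by (rule closure_of_subset)
  have YX: "Y \<subseteq> X" unfolding X_def by (auto intro: generate.incl)
  show "x [^] p \<in> D" if "x \<in> S" using that YX XD by (auto simp: Y_def)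
  show "x \<otimes> y \<otimes> inv x \<otimes> inv y \<in> D" if "x \<in> S" "y \<in> S"
    using that YX XD by (auto simp: Y_def)
  show "D \<lhd> G"
    unfolding normal_inv_iff
  proof (intro conjI ballI)
    show "subgroup D G" unfolding D by (rule closure_of_subgroup[OF X])
    fix g d assume g: "g \<in> carrier G" and d: "d \<in> D"
    define c where "c x = g \<otimes> x \<otimes> inv g" for x
    have hom: "c \<in> hom G G" by (rule homI) (use g in \<open>simp_all add: c_def m_assoc\<close>)
    interpret c: group_hom G G c by unfold_locales (rule hom)
    have cS: "c x \<in> S" if "x \<in> S" for x unfolding c_def by (rule S.inv_op_closed2[OF g that])
    have "c ` Y \<subseteq> Y"
    proof (rule image_subsetI)
      fix y assume "y \<in> Y"
      then consider (comm) a b where "a \<in> S" "b \<in> S" "y = a \<otimes> b \<otimes> inv a \<otimes> inv b" | (pow) a where "a \<in> S" "y = a [^] p"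
        by (auto simp: Y_def)
      then show "c y \<in> Y"
      proof cases
        case comm
        then have "c y = c a \<otimes> c b \<otimes> inv (c a) \<otimes> inv (c b)" by simp
        then show ?thesis using cS[OF comm(1)] cS[OF comm(2)] by (auto simp: Y_def)
      next
        case pow
        then have "c y = c a [^] p" using c.hom_nat_pow[of a p] by simp
        then show ?thesis using cS[OF pow(1)] by (auto simp: Y_def)
      qed
    qed
    then have "c ` X \<subseteq> X" unfolding X_def
      using hom_generate_subset[OF is_group is_group hom YG X[unfolded X_def]] YX[unfolded X_def] by blast
    then have "T closure_of (c ` X) \<subseteq> D" unfolding D by (rule closure_of_mono)
    moreover have "c ` (T closure_of X) \<subseteq> T closure_of (c ` X)"
      unfolding c_def[abs_def] by (rule continuous_map_image_closure_subset[OF continuous_conj[OF g]])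
    ultimately have "c d \<in> D" using d unfolding D by blast
    then show "g \<otimes> d \<otimes> inv g \<in> D" by (simp add: c_def)
  qed
qed

lemma Pi_series_normal_closed: "Pi_series G T p n \<lhd> G \<and> closedin T (Pi_series G T p n)"
proof (induction n)
  case 0
  show ?case using normal_self closedin_topspace[of T] topspace_eq by simp
next
  case (Suc n)
  then show ?case using D_subgroup_step(1,2)[of "Pi_series G T p n" "p (Suc n)"] by simp
qed

text \<open>
  The shift reflects that the step from the \<open>n\<close>-th term to the next one uses the prime \<open>p (n + 1)\<close>.
\<close>

lemma Pi_series_prime_series: "prime_series (\<lambda>n. p (Suc n)) G (Pi_series G T p)"
  unfolding prime_series_def
proof (intro conjI allI ballI)
  fix n
  note nc = Pi_series_normal_closed[of p n]
  show "Pi_series G T p n \<lhd> G" using nc by blast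
  show "Pi_series G T p (Suc n) \<subseteq> Pi_series G T p n"
    using D_subgroup_step(3)[OF conjunct1[OF nc] conjunct2[OF nc], of "p (Suc n)"] by simp
  show "x [^] p (Suc n) \<in> Pi_series G T p (Suc n)" if "x \<in> Pi_series G T p n" for x
    using D_subgroup_step(4)[OF conjunct1[OF nc] conjunct2[OF nc] that, of "p (Suc n)"] by simp
  show "x \<otimes> y \<otimes> inv x \<otimes> inv y \<in> Pi_series G T p (Suc n)" if "x \<in> Pi_series G T p n" "y \<in> Pi_series G T p n" for x y
    using D_subgroup_step(5)[OF conjunct1[OF nc] conjunct2[OF nc] that, of "p (Suc n)"] by simp
qed simp

lemma openin_r_coset:
  assumes N: "subgroup N G" "openin T N" and g: "g \<in> carrier G"
  shows "openin T (N #> g)"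
proof -
  have "openin T {x \<in> topspace T. x \<otimes> inv g \<in> N}"
    by (rule openin_continuous_map_preimage[OF continuous_r_mult N(2)]) (use g in simp)
  also have "{x \<in> topspace T. x \<otimes> inv g \<in> N} = N #> g"
  proof
    show "{x \<in> topspace T. x \<otimes> inv g \<in> N} \<subseteq> N #> g"
    proof clarify
      fix x assume x: "x \<in> topspace T" "x \<otimes> inv g \<in> N"
      have "x = (x \<otimes> inv g) \<otimes> g" using x g topspace_eq by (simp add: m_assoc)
      then show "x \<in> N #> g" using x(2) unfolding r_coset_def by blast
    qed
    show "N #> g \<subseteq> {x \<in> topspace T. x \<otimes> inv g \<in> N}"
      using subgroup.subset[OF N(1)] g topspace_eq by (auto simp: r_coset_def m_assoc subset_iff)
  qed
  finally show ?thesis .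
qed

lemma finite_rcosets_open:
  assumes comp: "compact_space T" and N: "subgroup N G" "openin T N"
  shows "finite (rcosets N)"
proof -
  have op: "openin T C" if "C \<in> rcosets N" for C
    using that openin_r_coset[OF N] unfolding RCOSETS_def by blast
  have "\<Union>(rcosets N) = topspace T" using rcosets_part_G[OF N(1)] topspace_eq by simp
  then obtain \<F> where F: "finite \<F>" "\<F> \<subseteq> rcosets N" "\<Union>\<F> = topspace T"
    using comp op unfolding compact_space by metis
  have "rcosets N \<subseteq> \<F>"
  proof
    fix C assume C: "C \<in> rcosets N"
    obtain x where x: "x \<in> carrier G" "C = N #> x" using C unfolding RCOSETS_def by blast
    have xC: "x \<in> C" using rcos_self[OF x(1) N(1)] x(2) by simp
    then obtain D where D: "D \<in> \<F>" "x \<in> D" using F(3) x(1) topspace_eq by blast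
    have "C = D" using rcos_disjoint[OF N(1)] C D F(2) xC unfolding pairwise_def disjnt_def by blast
    then show "C \<in> \<F>" using D(1) by simp
  qed
  then show ?thesis using F(1) by (rule finite_subset)
qed

end

text \<open>
  Turns the index of \<open>N\<close> into an equation between cardinalities in the finite quotient by \<open>N0\<close>.
\<close>

lemma (in group) index_quotient:
  assumes N0: "N0 \<lhd> G" and N: "N \<lhd> G" and sub: "N0 \<subseteq> N" and fin: "finite (rcosets N0)"
  shows "(\<lambda>x. N0 #> x) ` N \<lhd> G Mod N0"
    "card (carrier (G Mod N0)) = card (rcosets N) * card ((\<lambda>x. N0 #> x) ` N)"
proof -
  interpret N0: normal N0 G by (rule N0)
  interpret N: normal N G by (rule N)
  interpret H: group "G Mod N0" by (rule N0.factorgroup_is_group)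
  interpret K: group "G Mod N" by (rule N.factorgroup_is_group)
  interpret h: group_hom G "G Mod N0" "\<lambda>x. N0 #> x"
    by unfold_locales (rule N0.r_coset_hom_Mod)
  have surj: "(\<lambda>x. N0 #> x) ` carrier G = carrier (G Mod N0)" by (simp add: carrier_FactGroup)
  show "(\<lambda>x. N0 #> x) ` N \<lhd> G Mod N0" by (rule N.surj_hom_normal_subgroup[OF h.group_hom_axioms surj])
  define q where "q C = N #> (SOME x. x \<in> C)" for C
  have q: "q (N0 #> x) = N #> x" if x: "x \<in> carrier G" for x
  proof -
    have "x \<in> N0 #> x" by (rule rcos_self[OF x N0.subgroup_axioms])
    then have "(SOME y. y \<in> N0 #> x) \<in> N0 #> x" by (rule someI)
    then have "(SOME y. y \<in> N0 #> x) \<in> N #> x" using sub unfolding r_coset_def by blast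
    then show ?thesis unfolding q_def using repr_independence[OF _ x N.subgroup_axioms] by simp
  qed
  interpret q: group_hom "G Mod N0" "G Mod N" q
  proof unfold_locales
    show "q \<in> hom (G Mod N0) (G Mod N)"
    proof (rule homI)
      fix C assume "C \<in> carrier (G Mod N0)"
      then obtain x where x: "x \<in> carrier G" "C = N0 #> x" by (auto simp: carrier_FactGroup)
      then show "q C \<in> carrier (G Mod N)" using q by (simp add: carrier_FactGroup)
      fix D assume "D \<in> carrier (G Mod N0)"
      then obtain y where y: "y \<in> carrier G" "D = N0 #> y" by (auto simp: carrier_FactGroup)
      show "q (C \<otimes>\<^bsub>G Mod N0\<^esub> D) = q C \<otimes>\<^bsub>G Mod N\<^esub> q D"
        unfolding x(2) y(2) mult_FactGroup N0.rcos_sum[OF x(1) y(1)] q[OF x(1)] q[OF y(1)] N.rcos_sum[OF x(1) y(1)]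
        by (rule q) (use x(1) y(1) in simp)
    qed
  qed
  have ker: "kernel (G Mod N0) (G Mod N) q = (\<lambda>x. N0 #> x) ` N"
  proof
    show "kernel (G Mod N0) (G Mod N) q \<subseteq> (\<lambda>x. N0 #> x) ` N"
    proof
      fix C assume "C \<in> kernel (G Mod N0) (G Mod N) q"
      then obtain x where x: "x \<in> carrier G" "C = N0 #> x" "N #> x = N" using q by (auto simp: kernel_def carrier_FactGroup)
      have "x \<in> N" using rcos_self[OF x(1) N.subgroup_axioms] x(3) by simp
      then show "C \<in> (\<lambda>x. N0 #> x) ` N" using x(2) by simp
    qed
    show "(\<lambda>x. N0 #> x) ` N \<subseteq> kernel (G Mod N0) (G Mod N) q"
      using q N.rcos_const[OF is_group] by (auto simp: kernel_def carrier_FactGroup)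
  qed
  have "carrier (G Mod N) = q ` carrier (G Mod N0)" using q by (force simp: carrier_FactGroup image_image)
  moreover have "finite (carrier (G Mod N0))" using fin by (simp add: FactGroup_def)
  ultimately have "card (carrier (G Mod N0)) = card (carrier (G Mod N)) * card ((\<lambda>x. N0 #> x) ` N)"
    using q.card_preimage[of "carrier (G Mod N)"] ker q.hom_closed by (simp add: Collect_conj_eq Int_absorb2 subset_iff)
  then show "card (carrier (G Mod N0)) = card (rcosets N) * card ((\<lambda>x. N0 #> x) ` N)" by (simp add: FactGroup_def)
qed

text \<open>
  That the image of the \<open>\<Pi>\<close>-series reaches the trivial group is a compactness argument: the closed sets
  \<open>Pi_series G T p n - N\<close> decrease with empty intersection, so one of them is empty.
\<close>

lemma (in profinite_group) finite_quotient_tower: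
  assumes p: "\<And>i. i \<ge> 1 \<Longrightarrow> Factorial_Ring.prime (p i)" "inj_on p {1..}" and graded: "Pi_graded p G T"
    and N: "N \<lhd> G" "openin T N"
  shows "prime_tower_group (G Mod N) (\<lambda>i. p (Suc i)) (\<lambda>i. (\<lambda>x. N #> x) ` Pi_series G T p i)"
proof -
  interpret N: normal N G by (rule N(1))
  interpret H: group "G Mod N" by (rule N.factorgroup_is_group)
  interpret h: group_hom G "G Mod N" "\<lambda>x. N #> x" by unfold_locales (rule N.r_coset_hom_Mod)
  have surj: "(\<lambda>x. N #> x) ` carrier G = carrier (G Mod N)" by (simp add: carrier_FactGroup)
  have dec: "decseq (Pi_series G T p)"
    using prime_seriesD(3)[OF Pi_series_prime_series] by (rule decseq_SucI)
  have "\<exists>n. Pi_series G T p n \<subseteq> N"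
  proof (rule ccontr)
    assume a: "\<nexists>n. Pi_series G T p n \<subseteq> N"
    have "(\<Inter>n. Pi_series G T p n - N) \<noteq> {}"
    proof (rule compact_space_imp_nest[OF compact])
      show "closedin T (Pi_series G T p n - N)" for n using Pi_series_normal_closed N(2) by (intro closedin_diff) auto
      show "Pi_series G T p n - N \<noteq> {}" for n using a by blast
      show "decseq (\<lambda>n. Pi_series G T p n - N)" using dec unfolding decseq_def by blast
    qed
    moreover have "(\<Inter>n. Pi_series G T p n - N) \<subseteq> {\<one>} - N" using graded unfolding Pi_graded_def by blast
    ultimately show False using N.one_closed by blast
  qed
  then obtain n where n: "Pi_series G T p n \<subseteq> N" by blast
  have "(\<lambda>x. N #> x) ` Pi_series G T p n = {N}"
  proof -
    have "N #> x = N" if "x \<in> Pi_series G T p n" for x using N.rcos_const[OF is_group] n that by blast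
    moreover have "\<one> \<in> Pi_series G T p n"
      using subgroup.one_closed[OF normal_imp_subgroup[OF conjunct1[OF Pi_series_normal_closed]]] .
    ultimately show ?thesis by blast
  qed
  then have "prime_tower (\<lambda>i. p (Suc i)) (G Mod N) (\<lambda>i. (\<lambda>x. N #> x) ` Pi_series G T p i)"
    using h.prime_series_image[OF Pi_series_prime_series surj] by (auto simp: prime_tower_def)
  moreover have "finite (carrier (G Mod N))" using finite_rcosets_open[OF compact N.subgroup_axioms N(2)] by (simp add: FactGroup_def)
  moreover have "inj (\<lambda>i. p (Suc i))" using p(2) by (auto simp: inj_on_def)
  ultimately show ?thesis using p(1) H.is_group by (simp add: prime_tower_group_def prime_tower_group_axioms_def)
qed

lemma (in topological_group) dense_generates_quotient:
  assumes S: "S \<subseteq> carrier G" "T closure_of (generate G S) = carrier G" and N: "N \<lhd> G" "openin T N"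
  shows "generate (G Mod N) ((\<lambda>x. N #> x) ` S) = carrier (G Mod N)"
proof -
  interpret N: normal N G by (rule N(1))
  interpret H: group "G Mod N" by (rule N.factorgroup_is_group)
  interpret h: group_hom G "G Mod N" "\<lambda>x. N #> x" by unfold_locales (rule N.r_coset_hom_Mod)
  have "carrier (G Mod N) \<subseteq> (\<lambda>x. N #> x) ` generate G S"
  proof
    fix C assume "C \<in> carrier (G Mod N)"
    then obtain x where x: "x \<in> carrier G" "C = N #> x" by (auto simp: carrier_FactGroup)
    have "x \<in> T closure_of (generate G S)" using x S by simp
    moreover have "x \<in> N #> x" by (rule rcos_self[OF x(1) N.subgroup_axioms])
    ultimately obtain y where y: "y \<in> generate G S" "y \<in> N #> x"
      using openin_r_coset[OF N.subgroup_axioms N(2) x(1)] unfolding in_closure_of by blast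
    have "N #> x = N #> y" by (rule repr_independence[OF y(2) x(1) N.subgroup_axioms])
    then show "C \<in> (\<lambda>x. N #> x) ` generate G S" using y(1) x(2) by simp
  qed
  moreover have "(\<lambda>x. N #> x) ` generate G S \<subseteq> carrier (G Mod N)"
    using generate_incl[OF S(1)] by (auto simp: carrier_FactGroup)
  ultimately have "(\<lambda>x. N #> x) ` generate G S = carrier (G Mod N)" by blast
  then show ?thesis using h.generate_img[OF S(1)] by simp
qed

text \<open>
  The members of the family are told apart in the quotient by their intersection, to which the bound for
  finite groups applies. The summand 1 in \<open>card S + 1\<close> makes the number of generators positive even if
  \<open>S\<close> is empty.
\<close>

lemma (in profinite_group) card_finite_family_le:
  assumes p: "\<And>i. i \<ge> 1 \<Longrightarrow> Factorial_Ring.prime (p i)" "inj_on p {1..}" and graded: "Pi_graded p G T"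
    and S: "finite S" "S \<subseteq> carrier G" "T closure_of (generate G S) = carrier G" and k: "k \<ge> 1"
    and F: "finite \<F>" "\<F> \<subseteq> open_normal_subgroups G T k"
  shows "card \<F> \<le> k ^ (25 * (card S + 1) + 7)"
proof (cases "\<F> = {}")
  case True
  then show ?thesis by simp
next
  case False
  define M where "M = \<Inter>\<F>"
  have FN: "N \<lhd> G" "openin T N" "card (rcosets N) = k" if "N \<in> \<F>" for N
    using F(2) that by (auto simp: open_normal_subgroups_def)
  have M: "M \<lhd> G" unfolding normal_inv_iff
  proof (intro conjI ballI)
    show "subgroup M G" unfolding M_def
      by (rule subgroups_Inter) (use FN(1) normal_imp_subgroup False in auto)
    show "g \<otimes> x \<otimes> inv g \<in> M" if "g \<in> carrier G" "x \<in> M" for g x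
      using that normal.inv_op_closed2[OF FN(1)] by (auto simp: M_def)
  qed
  interpret M: normal M G by (rule M)
  have Mo: "openin T M" unfolding M_def using FN(2) F(1) False by (intro openin_Inter) auto
  interpret H: prime_tower_group "G Mod M" "\<lambda>i. p (Suc i)" "\<lambda>i. (\<lambda>x. M #> x) ` Pi_series G T p i"
    by (rule finite_quotient_tower[OF p graded M Mo])
  define im where "im N = (\<lambda>x. M #> x) ` N" for N
  have sub: "M \<subseteq> N" if "N \<in> \<F>" for N using that by (auto simp: M_def)
  have finM: "finite (rcosets M)" by (rule finite_rcosets_open[OF compact M.subgroup_axioms Mo])
  have "inj_on im \<F>"
  proof (rule inj_onI)
    have le: "N \<subseteq> N'" if N: "N \<in> \<F>" and N': "N' \<in> \<F>" and e: "im N = im N'" for N N'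
    proof
      fix x assume x: "x \<in> N"
      have xc: "x \<in> carrier G" using x subgroup.subset[OF normal_imp_subgroup[OF FN(1)[OF N]]] by blast
      have "M #> x \<in> im N'" unfolding e[symmetric] unfolding im_def using x by (rule imageI)
      then obtain y where y: "y \<in> N'" "M #> x = M #> y" unfolding im_def by (elim imageE)
      have "x \<in> M #> y" using rcos_self[OF xc M.subgroup_axioms] y(2) by simp
      then obtain m where m: "m \<in> M" "x = m \<otimes> y" unfolding r_coset_def by blast
      show "x \<in> N'" unfolding m(2)
        by (rule subgroup.m_closed[OF normal_imp_subgroup[OF FN(1)[OF N']]]) (rule subsetD[OF sub[OF N'] m(1)], rule y(1))
    qed
    fix N N' assume "N \<in> \<F>" "N' \<in> \<F>" "im N = im N'"
    then show "N = N'" using le by blast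
  qed
  moreover have "im ` \<F> \<subseteq> {N. N \<lhd> G Mod M \<and> card (carrier (G Mod M)) = k * card N}"
    using index_quotient[OF M FN(1) sub finM] FN(3) unfolding im_def by auto
  moreover have "finite {N. N \<lhd> G Mod M \<and> card (carrier (G Mod M)) = k * card N}"
    by (rule finite_subset[of _ "Pow (carrier (G Mod M))"])
       (use H.fin subgroup.subset[OF normal_imp_subgroup] in \<open>blast | simp\<close>)+
  ultimately have "card \<F> \<le> card {N. N \<lhd> G Mod M \<and> card (carrier (G Mod M)) = k * card N}"
    by (rule card_inj_on_le)
  also have "\<dots> \<le> k ^ (25 * (card S + 1) + 7)"
  proof (rule H.card_normal_subgroups_le)
    show "(\<lambda>x. M #> x) ` S \<subseteq> carrier (G Mod M)" using S(2) by (auto simp: carrier_FactGroup)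
    show "generate (G Mod M) ((\<lambda>x. M #> x) ` S) = carrier (G Mod M)"
      by (rule dense_generates_quotient[OF S(2,3) M Mo])
    show "card ((\<lambda>x. M #> x) ` S) \<le> card S + 1" using card_image_le[OF S(1), of "\<lambda>x. M #> x"] by simp
  qed (use k in auto)
  finally show ?thesis .
qed

theorem proposition4p3:
  fixes G :: "('a, 'b) monoid_scheme" and T :: "'a topology" and p :: "nat \<Rightarrow> nat"
  assumes "\<And>i. i \<ge> 1 \<Longrightarrow> Factorial_Ring.prime (p i)"
    and "inj_on p {1..}"
    and "profinite_group G T"
    and "topologically_finitely_generated G T"
    and "Pi_graded p G T"
  shows "polynomial_normal_subgroup_growth G T"
proof -
  interpret profinite_group G T by fact
  obtain S where S: "finite S" "S \<subseteq> carrier G" "T closure_of (generate G S) = carrier G"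
    using assms(4) unfolding topologically_finitely_generated_def by blast
  define c where "c = 25 * (card S + 1) + 7"
  have bound: "card \<F> \<le> k ^ c" if "k \<ge> 1" "finite \<F>" "\<F> \<subseteq> open_normal_subgroups G T k" for k \<F>
    unfolding c_def by (rule card_finite_family_le[OF assms(1,2,5) S that])
  \<comment> \<open>An infinite set would contain finite families of every size, against the uniform bound.\<close>
  have fin: "finite (open_normal_subgroups G T k)" if k: "k \<ge> 1" for k
  proof (rule ccontr)
    assume "infinite (open_normal_subgroups G T k)"
    then obtain \<F> where "\<F> \<subseteq> open_normal_subgroups G T k" "finite \<F>" "card \<F> = Suc (k ^ c)"
      using infinite_arbitrarily_large by metis
    then show False using bound[OF k, of \<F>] by simp
  qed
  have "real (s_normal G T k) \<le> 1 * real k ^ (c + 1)" if k: "k \<ge> 1" for k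
  proof -
    have "s_normal G T k \<le> (\<Sum>l = 1..k. k ^ c)"
      unfolding s_normal_def a_normal_def
    proof (rule sum_mono)
      fix l assume l: "l \<in> {1..k}"
      have "card (open_normal_subgroups G T l) \<le> l ^ c" using bound[OF _ fin order_refl] l by simp
      also have "\<dots> \<le> k ^ c" using l by (intro power_mono) auto
      finally show "card (open_normal_subgroups G T l) \<le> k ^ c" .
    qed
    also have "\<dots> = k ^ (c + 1)" by simp
    finally have "real (s_normal G T k) \<le> real (k ^ (c + 1))" by (rule of_nat_mono)
    then show ?thesis by simp
  qed
  then show ?thesis unfolding polynomial_normal_subgroup_growth_def using fin by blast
qed


end
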